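(* Let $\pi=(\pi_k)_{k\ge0}$ be a probability distribution on the nonnegative integers with finite, non-zero mean. If $\pi$ has finite support and $\pi_1=0$, then $\Sigma_{p.p.}(\textsc{ugwt}(\pi))$ is finite.
   Context: $\textsc{ugwt}(\pi)$, the unimodular Galton-Watson tree with degree distribution $\pi$, is the law of the random rooted tree (viewed up to rooted isomorphism) obtained by a Galton-Watson branching process in which the root has offspring distribution $\pi$ and all its descendants have offspring distribution $\widehat{\pi}=(\widehat{\pi}_k)_{k\ge0}$, $\widehat{\pi}_k=\frac{(k+1)\pi_{k+1}}{\sum_i i\pi_i}$ (all numbers of offspring being independent). Spectral measures. For a countable locally finite graph $G=(V,E)$, the adjacency operator $A$ acts on finitely supported functions in $\ell^2_{\mathbb{C}}(V)$, with $\langle \mathfrak{e}_x|A\mathfrak{e}_y\rangle=1$ if $\{x,y\}\in E$ and $0$ otherwise, where $(\mathfrak{e}_x)_{x\in V}$ is the canonical basis. $G$ is called self-adjoint if $A$ is essentially self-adjoint. In that case, for $o\in V$, $\mu_{(G,o)}$ is the unique Borel probability measure on $\mathbb{R}$ such that $\langle \mathfrak{e}_o|(A-z)^{-1}\mathfrak{e}_o\rangle=\int_{\mathbb{R}}\frac{1}{\xi-z}\,\mu_{(G,o)}(d\xi)$ for all $z\in\mathbb{C}\setminus\mathbb{R}$. For $(G,o)\sim\mathcal{L}=\textsc{ugwt}(\pi)$, $G$ is almost surely self-adjoint, and one sets $\mu_{\mathcal{L}}(\cdot):=\mathbb{E}[\mu_{(G,o)}(\cdot)]$. The pure-point support is $\Sigma_{p.p.}(\mathcal{L}):=\{\lambda\in\mathbb{R}\colon\mu_{\mathcal{L}}(\{\lambda\})>0\}$.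 *)

theory Defs
  imports "HOL-Probability.Probability"
begin

section \<open>Unbounded operators on \<open>\<ell>\<^sup>2(V)\<close>\<close>

text \<open>A vector of \<open>\<ell>\<^sup>2(V)\<close> is a function on the whole vertex type that vanishes off \<open>V\<close>.
  An operator is represented by its graph, a set of pairs of vectors.\<close>

definition ell2 :: "'v set \<Rightarrow> ('v \<Rightarrow> complex) set" where
  "ell2 V = {f. (\<forall>x. x \<notin> V \<longrightarrow> f x = 0) \<and> (\<lambda>x. (cmod (f x))\<^sup>2) summable_on V}"

definition ell2_inner :: "'v set \<Rightarrow> ('v \<Rightarrow> complex) \<Rightarrow> ('v \<Rightarrow> complex) \<Rightarrow> complex" where
  "ell2_inner V f g = (\<Sum>\<^sub>\<infinity>x\<in>V. cnj (f x) * g x)"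

definition ell2_norm :: "'v set \<Rightarrow> ('v \<Rightarrow> complex) \<Rightarrow> real" where
  "ell2_norm V f = sqrt (\<Sum>\<^sub>\<infinity>x\<in>V. (cmod (f x))\<^sup>2)"

definition basis_vec :: "'v \<Rightarrow> 'v \<Rightarrow> complex" where
  "basis_vec y = (\<lambda>x. if x = y then 1 else 0)"

type_synonym 'v operator = "(('v \<Rightarrow> complex) \<times> ('v \<Rightarrow> complex)) set"

definition op_closure :: "'v set \<Rightarrow> 'v operator \<Rightarrow> 'v operator" where
  "op_closure V T = {(f, g). f \<in> ell2 V \<and> g \<in> ell2 V \<and>
     (\<exists>F G. (\<forall>n. (F n, G n) \<in> T) \<and>
        (\<lambda>n. ell2_norm V (\<lambda>x. F n x - f x)) \<longlonglongrightarrow> 0 \<and>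
        (\<lambda>n. ell2_norm V (\<lambda>x. G n x - g x)) \<longlonglongrightarrow> 0)}"

definition op_adjoint :: "'v set \<Rightarrow> 'v operator \<Rightarrow> 'v operator" where
  "op_adjoint V T = {(f, g). f \<in> ell2 V \<and> g \<in> ell2 V \<and>
     (\<forall>(h, k) \<in> T. ell2_inner V f k = ell2_inner V g h)}"

definition self_adjoint :: "'v set \<Rightarrow> 'v operator \<Rightarrow> bool" where
  "self_adjoint V T \<longleftrightarrow> op_adjoint V T = T"

definition essentially_self_adjoint :: "'v set \<Rightarrow> 'v operator \<Rightarrow> bool" where
  "essentially_self_adjoint V T \<longleftrightarrow> self_adjoint V (op_closure V T)"

text \<open>\<open>(T - z)\<^sup>-\<^sup>1 h\<close>, i.e. the vector \<open>f\<close> in the domain of \<open>T\<close> with \<open>T f - z f = h\<close>.\<close>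

definition resolvent :: "'v operator \<Rightarrow> complex \<Rightarrow> ('v \<Rightarrow> complex) \<Rightarrow> 'v \<Rightarrow> complex" where
  "resolvent T z h = (THE f. (f, \<lambda>x. h x + z * f x) \<in> T)"


section \<open>Spectral measures of graphs\<close>

type_synonym 'v graph = "'v set \<times> 'v set set"

definition adjacency :: "'v graph \<Rightarrow> 'v operator" where
  "adjacency = (\<lambda>(V, E).
     {(f, \<lambda>x. \<Sum>y | f y \<noteq> 0. (if {x, y} \<in> E then 1 else 0) * f y) | f.
        (\<forall>x. x \<notin> V \<longrightarrow> f x = 0) \<and> finite {y. f y \<noteq> 0}})"

definition self_adjoint_graph :: "'v graph \<Rightarrow> bool" where
  "self_adjoint_graph G \<longleftrightarrow> essentially_self_adjoint (fst G) (adjacency G)"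

text \<open>For a self-adjoint graph, \<open>A\<close> in \<open>(A - z)\<^sup>-\<^sup>1\<close> stands for the closure of the adjacency
  operator, its unique self-adjoint extension. The zero measure on the remaining graphs is
  a dummy value.\<close>

definition spectral_measure :: "'v graph \<Rightarrow> 'v \<Rightarrow> real measure" where
  "spectral_measure G v =
     (if self_adjoint_graph G then
        (THE M. prob_space M \<and> sets M = sets borel \<and>
           (\<forall>z. z \<notin> \<real> \<longrightarrow>
              ell2_inner (fst G) (basis_vec v)
                (resolvent (op_closure (fst G) (adjacency G)) z (basis_vec v)) =
              (\<integral>\<xi>. 1 / (complex_of_real \<xi> - z) \<partial>M)))
      else null_measure borel)"


section \<open>Unimodular Galton-Watson trees\<close>

text \<open>Rooted trees are encoded in Ulam-Harris form: a set of words over the natural numbers,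
  rooted at the empty word, in which the children of \<open>u\<close> are the words \<open>u @ [i]\<close>.
  The spectral measure at the root depends only on the rooted isomorphism class of the tree,
  so its expectation may be taken over these labelled representatives.\<close>

type_synonym uh_tree = "nat list set"

definition tree_graph :: "uh_tree \<Rightarrow> nat list graph" where
  "tree_graph T = (T, {{u, u @ [i]} | u i. u @ [i] \<in> T})"

definition tree_space :: "uh_tree measure" where
  "tree_space = sigma UNIV (range (\<lambda>v. {T. v \<in> T}))"

text \<open>The tree in which the word \<open>u\<close>, if present, has the \<open>c u\<close> children
  \<open>u @ [0], \<dots>, u @ [c u - 1]\<close>.\<close>

definition tree_of_offspring :: "(nat list \<Rightarrow> nat) \<Rightarrow> uh_tree" where
  "tree_of_offspring c = {v. \<forall>u i w. v = u @ [i] @ w \<longrightarrow> i < c u}"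

definition offspring_hat :: "nat pmf \<Rightarrow> nat pmf" where
  "offspring_hat \<pi> =
     embed_pmf (\<lambda>k. real (k + 1) * pmf \<pi> (k + 1) / (\<Sum>i. real i * pmf \<pi> i))"

definition ugwt :: "nat pmf \<Rightarrow> uh_tree measure" where
  "ugwt \<pi> =
     distr (Pi\<^sub>M UNIV (\<lambda>u. measure_pmf (if u = [] then \<pi> else offspring_hat \<pi>)))
       tree_space tree_of_offspring"

definition mean_spectral_measure :: "uh_tree measure \<Rightarrow> real set \<Rightarrow> ennreal" where
  "mean_spectral_measure L B = (\<integral>\<^sup>+T. emeasure (spectral_measure (tree_graph T) []) B \<partial>L)"

definition pp_support :: "uh_tree measure \<Rightarrow> real set" where
  "pp_support L = {\<xi>. mean_spectral_measure L {\<xi>} > 0}"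


section \<open>Well-definedness of the law\<close>

lemma pmf_offspring_hat:
  assumes "summable (\<lambda>k. real k * pmf \<pi> k)" and "(\<Sum>k. real k * pmf \<pi> k) \<noteq> 0"
  shows "pmf (offspring_hat \<pi>) k =
    real (k + 1) * pmf \<pi> (k + 1) / (\<Sum>i. real i * pmf \<pi> i)"
proof -
  define m where "m = (\<Sum>i. real i * pmf \<pi> i)"
  have m0: "m \<ge> 0"
    unfolding m_def by (intro suminf_nonneg assms) auto
  have "(\<lambda>i. real i * pmf \<pi> i) sums m"
    unfolding m_def using assms(1) by (rule summable_sums)
  hence "(\<lambda>k. real (k + 1) * pmf \<pi> (k + 1)) sums m"
    using sums_Suc_iff [of "\<lambda>i. real i * pmf \<pi> i" m] by simp
  hence "(\<lambda>k. real (k + 1) * pmf \<pi> (k + 1) / m) sums (m / m)"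
    by (rule sums_divide)
  hence s: "(\<lambda>k. real (k + 1) * pmf \<pi> (k + 1) / m) sums 1"
    using assms(2) by (simp add: m_def)
  have "(\<integral>\<^sup>+k. ennreal (real (k + 1) * pmf \<pi> (k + 1) / m) \<partial>count_space UNIV) = 1"
    unfolding nn_integral_count_space_nat
    using s m0 by (subst suminf_ennreal_eq [OF _ s]) auto
  hence "pmf (embed_pmf (\<lambda>k. real (k + 1) * pmf \<pi> (k + 1) / m)) k =
      real (k + 1) * pmf \<pi> (k + 1) / m"
    using m0 by (intro pmf_embed_pmf) auto
  thus ?thesis
    by (simp add: offspring_hat_def m_def)
qed

lemma measurable_tree_of_offspring [measurable]:
  "tree_of_offspring \<in>
     Pi\<^sub>M UNIV (\<lambda>u. measure_pmf (if u = [] then \<pi> else offspring_hat \<pi>)) \<rightarrow>\<^sub>M tree_space"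
  (is "_ \<in> ?M \<rightarrow>\<^sub>M _")
  unfolding tree_space_def
proof (rule measurable_measure_of)
  fix A assume "A \<in> range (\<lambda>v::nat list. {T. v \<in> T})"
  then obtain v where A: "A = {T. v \<in> T}" by blast
  have coord: "(\<lambda>c. c u) \<in> ?M \<rightarrow>\<^sub>M count_space UNIV" for u :: "nat list"
  proof -
    have "(\<lambda>c. c u) \<in> ?M \<rightarrow>\<^sub>M measure_pmf (if u = [] then \<pi> else offspring_hat \<pi>)"
      by (rule measurable_component_singleton) simp
    thus ?thesis by (simp cong: measurable_cong_sets)
  qed
  have "tree_of_offspring -` A \<inter> space ?M =
      {c \<in> space ?M. \<forall>u i w. v = u @ [i] @ w \<longrightarrow> i < c u}"
    by (auto simp: A tree_of_offspring_def)
  also have "\<dots> \<in> sets ?M"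
    using coord by measurable
  finally show "tree_of_offspring -` A \<inter> space ?M \<in> sets ?M" .
qed auto

lemma prob_space_ugwt: "prob_space (ugwt \<pi>)"
  unfolding ugwt_def
  by (intro prob_space.prob_space_distr prob_space_PiM measurable_tree_of_offspring)
     (rule prob_space_measure_pmf)

end

theory Submission
  imports Defs "HOL-Computational_Algebra.Fundamental_Theorem_Algebra"
begin

text \<open>The resolvent of a branching tree at its root satisfies the recursion \<open>h = -1 / (z
  + \<Sum> h\<^sub>i)\<close> over the subtrees at the children. Let \<open>z\<close> approach a
  real point \<open>\<lambda>\<close> vertically. The vertices whose spectral measure charges
  \<open>\<lambda>\<close> then decompose into blocks, separated by frontier vertices that are
  adjacent to at least two blocks, and the mass transport principle across edges shows that the
  expected mass at \<open>\<lambda>\<close> is the density of blocks minus the density of frontier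
  vertices.

  If \<open>\<lambda>\<close> is not an eigenvalue of a block of depth at most \<open>D\<close>,
  then all blocks have more than \<open>D\<close> vertices, so the density of blocks is of order
  \<open>1/D\<close> times the probability that the root lies in a finite block. Since no vertex
  other than an isolated root has fewer than two neighbours, a finite block must be closed off in
  two directions, so that this probability is \<open>O(x\<^sup>2)\<close>, where \<open>x\<close> is
  the probability that a child is a frontier vertex; the density of frontier vertices is at least of
  order \<open>x\<^sup>2\<close>. Hence for large \<open>D\<close>, depending only on the offspring
  law, there is no mass at \<open>\<lambda>\<close> except at the finitely many eigenvalues of
  blocks of depth at most \<open>D\<close>.\<close>

section \<open>The resolvent recursion\<close>

text \<open>At a vertex of positive mass the recursion yields mass = 1 / (1 + S), where S adds up
  the slopes lim Im h / eps of the child branches. Hence 1 - mass = S * mass splits over the edges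
  at the vertex, and each term depends only on the two trees left by cutting that edge; under the
  size-biased law these are independent copies of one branching tree, so that flows can be sent
  across the edge. Flows to the frontier are shares that sum to 1 at each frontier vertex. On an
  edge inside a block the two opposite flows sum to 1, so their expectation depends only on which
  edges lie inside blocks. The spectral split may thus be traded for a split by the sizes of the two
  sides, which leaves about 1/N for each vertex of a block of N vertices. Blocks may be infinite, so
  sizes are counted down to depth \<open>K\<close>, and \<open>K\<close> tends to infinity only in
  the last estimate. The condition \<open>pmf \<pi> 1 = 0\<close> excludes dead ends, at which a
  block could stop without meeting the frontier. All constants depend on the offspring law alone,
  not on \<lambda>.\<close>

type_synonym offspring = "nat list \<Rightarrow> nat"

definition subtree :: "offspring \<Rightarrow> nat \<Rightarrow> offspring" where
  "subtree c i = (\<lambda>u. c (i # u))"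

lemma Im_neg_inverse: "Im (- 1 / w) = Im w / (cmod w)\<^sup>2"
  unfolding Im_divide cmod_power2 by (rule arg_cong2[where f="(/)"]) simp_all

lemma Im_neg_inverse_cmod: "Im (- 1 / w) = (cmod (- 1 / w))\<^sup>2 * Im w"
  unfolding Im_neg_inverse by (simp add: norm_divide power_divide)

lemma cmod_le_inverse_Im:
  assumes "0 < e" "e \<le> Im w"
  shows "cmod (- 1 / w) \<le> 1 / e"
proof -
  have "e \<le> cmod w" using assms abs_Im_le_cmod[of w] by linarith
  thus ?thesis using assms by (simp add: norm_divide frac_le)
qed

locale degree_bound =
  fixes d :: nat
begin

text \<open>Truncating the root degree at \<open>d\<close> lets the resolvent recursion converge for every offspring
  function; the truncation is invisible in trees of degree at most \<open>d\<close>.\<close>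

definition rdeg :: "offspring \<Rightarrow> nat" where
  "rdeg c = min d (c [])"

lemma rdeg_le: "rdeg c \<le> d" by (simp add: rdeg_def)

text \<open>The root resolvent entry of the tree cut off below level \<open>n\<close>; the base case
  is an isolated vertex.\<close>

primrec hn :: "nat \<Rightarrow> offspring \<Rightarrow> complex \<Rightarrow> complex" where
  "hn 0 c z = - 1 / z"
| "hn (Suc n) c z = - 1 / (z + (\<Sum>i<rdeg c. hn n (subtree c i) z))"

lemma hn_Im_pos:
  assumes "0 < Im z"
  shows "0 < Im (hn n c z)"
proof (induction n arbitrary: c)
  case 0
  show ?case using assms by (auto simp: Im_neg_inverse complex_eq_iff simp del: divide_minus_left)
next
  case (Suc n)
  have "0 \<le> (\<Sum>i<rdeg c. Im (hn n (subtree c i) z))" by (intro sum_nonneg less_imp_le Suc)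
  hence "0 < Im (z + (\<Sum>i<rdeg c. hn n (subtree c i) z))" using assms by simp
  moreover from this have "z + (\<Sum>i<rdeg c. hn n (subtree c i) z) \<noteq> 0" by (metis less_irrefl zero_complex.simps(2))
  ultimately show ?case unfolding hn.simps Im_neg_inverse by (intro divide_pos_pos) auto
qed

lemma hn_sum_Im_nonneg:
  assumes "0 < Im z"
  shows "0 \<le> (\<Sum>i<k. Im (hn n (subtree c i) z))"
  by (intro sum_nonneg less_imp_le hn_Im_pos assms)

lemma hn_cmod_le:
  assumes "0 < Im z"
  shows "cmod (hn n c z) \<le> 1 / Im z"
proof (cases n)
  case 0
  then show ?thesis using cmod_le_inverse_Im[OF assms] by simp
next
  case (Suc m)
  show ?thesis unfolding Suc hn.simps
    by (rule cmod_le_inverse_Im[OF assms]) (use hn_sum_Im_nonneg[OF assms] in simp)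
qed

lemma sum_cmod_le:
  assumes "\<And>i. i < k \<Longrightarrow> cmod (g i) \<le> b" "k \<le> d" "0 \<le> b"
  shows "cmod (\<Sum>i<k. g i) \<le> real d * b"
proof -
  have "cmod (\<Sum>i<k. g i) \<le> (\<Sum>i<k. b)"
    by (rule sum_norm_le) (use assms in auto)
  also have "\<dots> \<le> real d * b" using assms by (simp add: mult_right_mono)
  finally show ?thesis .
qed

section \<open>Contraction of the recursion in the hyperbolic metric\<close>

definition hlow :: "complex \<Rightarrow> real" where
  "hlow z = Im z / (cmod z + real d / Im z)\<^sup>2"

lemma hlow_pos: "0 < Im z \<Longrightarrow> 0 < hlow z"
  unfolding hlow_def by (intro divide_pos_pos zero_less_power add_pos_nonneg) (auto simp: complex_eq_iff)

text \<open>The imaginary part of -1/w is Im w / |w|^2, with Im w at least Im z and |w| at most |z|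
  + d / Im z. Uniformity in the depth and the tree is what the base case of
  \<open>hn_hyperbolic\<close> needs, where a Euclidean bound becomes one relative to the imaginary
  parts.\<close>

lemma hn_Im_ge:
  assumes z: "0 < Im z"
  shows "hlow z \<le> Im (hn n c z)"
proof -
  obtain S where S: "hn n c z = - 1 / (z + S)" "0 \<le> Im S" "cmod S \<le> real d / Im z"
  proof (cases n)
    case 0
    then show ?thesis using that[of 0] z by simp
  next
    case (Suc m)
    have "cmod (\<Sum>i<rdeg c. hn m (subtree c i) z) \<le> real d * (1 / Im z)"
      by (rule sum_cmod_le) (use hn_cmod_le[OF z] rdeg_le z in auto)
    then show ?thesis using that[of "\<Sum>i<rdeg c. hn m (subtree c i) z"] Suc hn_sum_Im_nonneg[OF z] by simp
  qed
  have nz: "0 < cmod (z + S)" using S z by (auto simp: complex_eq_iff)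
  have "cmod (z + S) \<le> cmod z + real d / Im z"
    using norm_triangle_ineq[of z S] S by linarith
  hence "(cmod (z + S))\<^sup>2 \<le> (cmod z + real d / Im z)\<^sup>2" by (intro power_mono) auto
  hence "hlow z \<le> Im z / (cmod (z + S))\<^sup>2"
    unfolding hlow_def using z nz by (intro divide_left_mono) (auto intro!: mult_pos_pos)
  also have "\<dots> \<le> Im (z + S) / (cmod (z + S))\<^sup>2" using S by (intro divide_right_mono) auto
  finally show ?thesis unfolding S(1) Im_neg_inverse .
qed

text \<open>In the upper half-plane, |a - b|^2 / (Im a * Im b) is an increasing function of the
  hyperbolic distance. By Cauchy-Schwarz a bound on it survives addition.\<close>

lemma sum_hyperbolic:
  fixes g g' :: "nat \<Rightarrow> complex"
  assumes "\<And>i. i < k \<Longrightarrow> (cmod (g i - g' i))\<^sup>2 \<le> C * Im (g i) * Im (g' i)"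
    and "\<And>i. i < k \<Longrightarrow> 0 \<le> Im (g i)" "\<And>i. i < k \<Longrightarrow> 0 \<le> Im (g' i)" "0 \<le> C"
  shows "(cmod ((\<Sum>i<k. g i) - (\<Sum>i<k. g' i)))\<^sup>2 \<le> C * (\<Sum>i<k. Im (g i)) * (\<Sum>i<k. Im (g' i))"
proof -
  have "cmod ((\<Sum>i<k. g i) - (\<Sum>i<k. g' i)) \<le> (\<Sum>i<k. sqrt (C * Im (g i)) * sqrt (Im (g' i)))"
    unfolding sum_subtractf[symmetric]
  proof (rule sum_norm_le)
    fix i assume "i \<in> {..<k}"
    thus "cmod (g i - g' i) \<le> sqrt (C * Im (g i)) * sqrt (Im (g' i))"
      using assms(1)[of i] by (simp add: real_le_rsqrt real_sqrt_mult[symmetric])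
  qed
  hence "(cmod ((\<Sum>i<k. g i) - (\<Sum>i<k. g' i)))\<^sup>2 \<le> (\<Sum>i<k. sqrt (C * Im (g i)) * sqrt (Im (g' i)))\<^sup>2"
    by (intro power_mono) auto
  also have "\<dots> \<le> (\<Sum>i<k. (sqrt (C * Im (g i)))\<^sup>2) * (\<Sum>i<k. (sqrt (Im (g' i)))\<^sup>2)"
    by (rule Cauchy_Schwarz_ineq_sum)
  also have "\<dots> = (\<Sum>i<k. C * Im (g i)) * (\<Sum>i<k. Im (g' i))"
    using assms by (intro arg_cong2[where f="(*)"] sum.cong) auto
  finally show ?thesis by (simp add: sum_distrib_left)
qed

text \<open>With s = d / Im z, every S with 0 \<le> Im S \<le> s satisfies Im S \<le> s / (Im z + s)
  * (Im z + Im S). Translation by z gains this factor at each of the two points compared, hence the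
  square.\<close>

definition hrate :: "complex \<Rightarrow> real" where
  "hrate z = (real d / Im z / (Im z + real d / Im z))\<^sup>2"

definition hconst :: "complex \<Rightarrow> real" where
  "hconst z = (2 / Im z / hlow z)\<^sup>2"

lemma hrate_bounds: "0 < Im z \<Longrightarrow> 0 \<le> hrate z" "0 < Im z \<Longrightarrow> hrate z < 1"
proof -
  assume z: "0 < Im z"
  show "0 \<le> hrate z" by (simp add: hrate_def)
  have "0 \<le> real d / Im z" using z by simp
  hence "real d / Im z / (Im z + real d / Im z) < 1" "0 \<le> real d / Im z / (Im z + real d / Im z)"
    using z by (subst divide_less_eq_1_pos, simp_all add: add_pos_nonneg del: divide_divide_eq_left)
  thus "hrate z < 1" unfolding hrate_def by (simp add: power_less_one_iff)
qed

text \<open>The recursion is composed of a sum, which preserves the bound, the translation by z,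
  which contracts it by \<open>hrate\<close>, and w -> -1/w, which is a hyperbolic isometry.\<close>

lemma hn_hyperbolic:
  assumes z: "0 < Im z"
  shows "(cmod (hn n c z - hn (n + k) c z))\<^sup>2 \<le>
    hconst z * hrate z ^ n * Im (hn n c z) * Im (hn (n + k) c z)"
proof (induction n arbitrary: c)
  case 0
  have "cmod (hn 0 c z - hn k c z) \<le> 2 / Im z"
    using norm_triangle_ineq4[of "hn 0 c z" "hn k c z"] hn_cmod_le[OF z, of 0 c] hn_cmod_le[OF z, of k c]
    by (simp del: hn.simps)
  hence "(cmod (hn 0 c z - hn k c z))\<^sup>2 \<le> (2 / Im z)\<^sup>2" by (intro power_mono) auto
  also have "\<dots> = hconst z * (hlow z * hlow z)"
    using hlow_pos[OF z] by (simp add: hconst_def power2_eq_square)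
  also have "\<dots> \<le> hconst z * (Im (hn 0 c z) * Im (hn k c z))"
    using hn_Im_ge[OF z, of 0 c] hn_Im_ge[OF z, of k c] hlow_pos[OF z]
    by (intro mult_left_mono mult_mono) (auto simp: hconst_def simp del: hn.simps)
  finally show ?case by (simp add: mult.assoc del: hn.simps)
next
  case (Suc n)
  define S where "S = (\<Sum>i<rdeg c. hn n (subtree c i) z)"
  define S' where "S' = (\<Sum>i<rdeg c. hn (n + k) (subtree c i) z)"
  define s where "s = real d / Im z"
  define C where "C = hconst z * hrate z ^ n"
  have C0: "0 \<le> C" unfolding C_def hconst_def using hrate_bounds[OF z] by simp
  have 1: "(cmod (S - S'))\<^sup>2 \<le> C * Im S * Im S'"
    unfolding S_def S'_def Im_sum
    by (rule sum_hyperbolic) (use Suc C0 in \<open>auto simp: C_def intro: less_imp_le[OF hn_Im_pos[OF z]]\<close>)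
  have S0: "0 \<le> Im S" "0 \<le> Im S'" unfolding S_def S'_def by (auto simp: hn_sum_Im_nonneg z)
  have "cmod S \<le> real d * (1 / Im z)" "cmod S' \<le> real d * (1 / Im z)" unfolding S_def S'_def
    by (rule sum_cmod_le; use hn_cmod_le[OF z] rdeg_le z in auto)+
  hence Ss: "Im S \<le> s" "Im S' \<le> s" unfolding s_def
    using abs_Im_le_cmod[of S] abs_Im_le_cmod[of S'] by auto
  have s0: "0 \<le> s" unfolding s_def using z by simp
  define q where "q = s / (Im z + s)"
  have q: "x \<le> q * (Im z + x)" if "0 \<le> x" "x \<le> s" for x
    using that z s0 by (simp add: q_def field_simps mult_right_mono)
  have q0: "0 \<le> q" using z s0 by (simp add: q_def)
  have "Im S * Im S' \<le> (q * (Im z + Im S)) * (q * (Im z + Im S'))"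
    using q[OF S0(1) Ss(1)] q[OF S0(2) Ss(2)] S0 z q0 by (intro mult_mono) auto
  hence 2: "(cmod (S - S'))\<^sup>2 \<le> C * hrate z * Im (z + S) * Im (z + S')"
    using order_trans[OF 1] mult_left_mono[OF _ C0]
    by (fastforce simp: hrate_def q_def s_def power2_eq_square algebra_simps)
  have nz: "z + S \<noteq> 0" "z + S' \<noteq> 0" using S0 z by (auto simp: complex_eq_iff)
  have "- 1 / (z + S) - - 1 / (z + S') = (S - S') / ((z + S) * (z + S'))"
    using nz by (simp add: field_simps)
  hence "(cmod (- 1 / (z + S) - - 1 / (z + S')))\<^sup>2 = (cmod (S - S'))\<^sup>2 / ((cmod (z + S))\<^sup>2 * (cmod (z + S'))\<^sup>2)"
    by (simp only: norm_divide norm_mult power_divide power_mult_distrib)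
  also have "\<dots> \<le> C * hrate z * Im (z + S) * Im (z + S') / ((cmod (z + S))\<^sup>2 * (cmod (z + S'))\<^sup>2)"
    using 2 by (intro divide_right_mono) auto
  also have "\<dots> = C * hrate z * Im (- 1 / (z + S)) * Im (- 1 / (z + S'))"
    unfolding Im_neg_inverse by simp
  finally show ?case by (simp add: S_def S'_def C_def mult_ac)
qed

text \<open>Imaginary parts are at most 1 / Im z, so the hyperbolic decay becomes a Euclidean
  geometric rate with ratio sqrt (\<open>hrate z\<close>).\<close>

lemma hn_convergent:
  assumes z: "0 < Im z"
  shows "convergent (\<lambda>n. hn n c z)"
proof -
  define D where "D = sqrt (hconst z) / Im z"
  define r where "r = sqrt (hrate z)"
  have r: "0 \<le> r" "r < 1" using hrate_bounds[OF z] by (auto simp: r_def)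
  have D0: "0 \<le> D" using z by (simp add: D_def hconst_def)
  have *: "cmod (hn n c z - hn (n + k) c z) \<le> D * r ^ n" for n k
  proof (rule power2_le_imp_le)
    have I: "0 \<le> Im (hn m c z)" "Im (hn m c z) \<le> 1 / Im z" for m
      using hn_Im_pos[OF z, of m c] hn_cmod_le[OF z, of m c] abs_Im_le_cmod[of "hn m c z"] by auto
    have "(cmod (hn n c z - hn (n + k) c z))\<^sup>2 \<le>
        hconst z * hrate z ^ n * (Im (hn n c z) * Im (hn (n + k) c z))"
      using hn_hyperbolic[OF z, of n c k] by (simp add: mult.assoc)
    also have "\<dots> \<le> hconst z * hrate z ^ n * (1 / Im z * (1 / Im z))"
      using I hrate_bounds[OF z] z by (intro mult_left_mono mult_mono) (auto simp: hconst_def)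
    also have "\<dots> = (D * r ^ n)\<^sup>2"
    proof -
      have "(r ^ n)\<^sup>2 = hrate z ^ n" using hrate_bounds[OF z]
        by (simp add: r_def power_mult[symmetric] power_mult mult.commute[of n 2])
      moreover have "D\<^sup>2 = hconst z / (Im z)\<^sup>2" by (simp add: D_def power_divide hconst_def)
      ultimately show ?thesis unfolding power_mult_distrib by (simp add: power2_eq_square)
    qed
    finally show "(cmod (hn n c z - hn (n + k) c z))\<^sup>2 \<le> (D * r ^ n)\<^sup>2" .
  qed (use r D0 in auto)
  have "Cauchy (\<lambda>n. hn n c z)"
  proof (rule CauchyI)
    fix e :: real assume e: "0 < e"
    have "(\<lambda>n. D * r ^ n) \<longlonglongrightarrow> D * 0" by (intro tendsto_mult LIMSEQ_power_zero tendsto_const) (use r in auto)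
    hence "eventually (\<lambda>n. D * r ^ n < e / 2) sequentially"
      using order_tendstoD(2)[of _ "D * 0" _ "e/2"] e by simp
    then obtain N where N: "D * r ^ N < e / 2" by (auto simp: eventually_sequentially)
    show "\<exists>M. \<forall>m\<ge>M. \<forall>n\<ge>M. cmod (hn m c z - hn n c z) < e"
    proof (intro exI allI impI)
      fix m n assume "N \<le> m" "N \<le> n"
      hence "cmod (hn N c z - hn m c z) < e/2" "cmod (hn N c z - hn n c z) < e/2"
        using *[of N "m - N"] *[of N "n - N"] N by auto
      thus "cmod (hn m c z - hn n c z) < e"
        using norm_triangle_ineq4[of "hn N c z - hn n c z" "hn N c z - hn m c z"]
        by (simp add: algebra_simps)
    qed
  qed
  thus ?thesis by (simp add: Cauchy_convergent_iff)
qed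

definition h :: "offspring \<Rightarrow> complex \<Rightarrow> complex" where
  "h c z = lim (\<lambda>n. hn n c z)"

lemma hn_tendsto: "0 < Im z \<Longrightarrow> (\<lambda>n. hn n c z) \<longlonglongrightarrow> h c z"
  unfolding h_def using hn_convergent convergent_LIMSEQ_iff by blast

lemma h_Im_pos:
  assumes "0 < Im z"
  shows "0 < Im (h c z)"
proof -
  have "hlow z \<le> Im (h c z)"
    by (rule tendsto_lowerbound[OF tendsto_Im[OF hn_tendsto[OF assms]]]) (use hn_Im_ge[OF assms] in auto)
  thus ?thesis using hlow_pos[OF assms] by linarith
qed

lemma h_rec:
  assumes "0 < Im z"
  shows "h c z = - 1 / (z + (\<Sum>i<rdeg c. h (subtree c i) z))"
proof -
  have "0 < Im (z + (\<Sum>i<rdeg c. h (subtree c i) z))"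
    using assms h_Im_pos[OF assms] by (auto intro!: add_pos_nonneg sum_nonneg intro: less_imp_le)
  hence "z + (\<Sum>i<rdeg c. h (subtree c i) z) \<noteq> 0" by (metis less_irrefl zero_complex.simps(2))
  hence "(\<lambda>n. hn (Suc n) c z) \<longlonglongrightarrow> - 1 / (z + (\<Sum>i<rdeg c. h (subtree c i) z))"
    unfolding hn.simps by (intro tendsto_intros hn_tendsto assms)
  moreover have "(\<lambda>n. hn (Suc n) c z) \<longlonglongrightarrow> h c z" using hn_tendsto[OF assms] by (rule LIMSEQ_Suc)
  ultimately show ?thesis by (rule LIMSEQ_unique[symmetric])
qed

end

section \<open>Finite approximations have discrete spectral measures\<close>

abbreviation root_prod :: "complex set \<Rightarrow> complex poly" where
  "root_prod A \<equiv> \<Prod>x\<in>A. [:- x, 1:]"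

lemma root_prod_monic:
  assumes "finite A"
  shows "degree (root_prod A) = card A" "coeff (root_prod A) (card A) = 1"
proof -
  show d: "degree (root_prod A) = card A" by (subst degree_prod_sum_eq) auto
  have "lead_coeff (root_prod A) = 1" by (subst lead_coeff_prod) simp
  thus "coeff (root_prod A) (card A) = 1" by (simp only: d)
qed

lemma poly_root_prod: "poly (root_prod A) z = (\<Prod>x\<in>A. z - x)"
  by (simp add: poly_prod)

lemma prod_remove_div:
  assumes "finite A" "x \<in> A" "z \<notin> A"
  shows "(\<Prod>y\<in>A-{x}. z - y) = (\<Prod>y\<in>A. z - y) / (z - (x::complex))"
proof -
  have "(\<Prod>y\<in>A. z - y) = (z - x) * (\<Prod>y\<in>A-{x}. z - y)" using assms by (simp add: prod.remove)
  thus ?thesis using assms by auto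
qed

text \<open>Stieltjes transforms of finite discrete measures. The atoms are complex numbers that
  happen to be real, because they will be obtained as the roots of complex polynomials.\<close>

definition discrete_stieltjes :: "complex set \<Rightarrow> (complex \<Rightarrow> real) \<Rightarrow> (complex \<Rightarrow> complex) \<Rightarrow> bool" where
  "discrete_stieltjes X w g \<longleftrightarrow> finite X \<and> X \<subseteq> \<real> \<and> (\<forall>x\<in>X. 0 < w x) \<and>
    (\<forall>z. 0 < Im z \<longrightarrow> g z = (\<Sum>x\<in>X. of_real (w x) / (x - z)))"

lemma discrete_stieltjes_add:
  assumes "discrete_stieltjes X v f" "discrete_stieltjes Y w g"
  shows "\<exists>Z u. discrete_stieltjes Z u (\<lambda>z. f z + g z)"
proof (intro exI)
  let ?v = "\<lambda>x. if x \<in> X then v x else 0" and ?w = "\<lambda>x. if x \<in> Y then w x else 0"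
  have fin: "finite X" "finite Y" using assms by (auto simp: discrete_stieltjes_def)
  have "(\<Sum>x\<in>X. of_real (v x) / (x - z)) + (\<Sum>x\<in>Y. of_real (w x) / (x - z)) =
      (\<Sum>x\<in>X \<union> Y. of_real (?v x + ?w x) / (x - z))" for z
  proof -
    have "(\<Sum>x\<in>X. of_real (v x) / (x - z)) = (\<Sum>x\<in>X \<union> Y. of_real (?v x) / (x - z))"
         "(\<Sum>x\<in>Y. of_real (w x) / (x - z)) = (\<Sum>x\<in>X \<union> Y. of_real (?w x) / (x - z))"
      using fin by (auto intro!: sum.mono_neutral_cong_left)
    thus ?thesis by (simp only: of_real_add add_divide_distrib sum.distrib)
  qed
  thus "discrete_stieltjes (X \<union> Y) (\<lambda>x. ?v x + ?w x) (\<lambda>z. f z + g z)"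
    using assms unfolding discrete_stieltjes_def by (auto intro: add_pos_pos)
qed

lemma discrete_stieltjes_sum:
  assumes "\<And>i. i < k \<Longrightarrow> \<exists>X w. discrete_stieltjes X w (g i)"
  shows "\<exists>X w. discrete_stieltjes X w (\<lambda>z. \<Sum>i<(k::nat). g i z)"
  using assms
proof (induction k)
  case 0
  have "discrete_stieltjes {} (\<lambda>_. 0) (\<lambda>z. 0)" by (simp add: discrete_stieltjes_def)
  thus ?case by auto
next
  case (Suc k)
  obtain X v Y w where "discrete_stieltjes X v (\<lambda>z. \<Sum>i<k. g i z)" "discrete_stieltjes Y w (g k)"
    using Suc.IH Suc.prems by (meson less_Suc_eq)
  thus ?case using discrete_stieltjes_add by simp
qed

text \<open>The poles of \<open>-1/(z + g z)\<close> are the roots of a polynomial all of whose roots are real, because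
  \<open>z + g z\<close> has a nonzero imaginary part off the real line, and simple, because \<open>z + g z\<close> has
  positive derivative on the real line.\<close>

lemma discrete_stieltjes_step:
  assumes g: "discrete_stieltjes X w g"
  shows "\<exists>Y r. discrete_stieltjes Y r (\<lambda>z. - 1 / (z + g z)) \<and> (\<Sum>y\<in>Y. r y) = 1"
proof -
  have X: "finite X" "X \<subseteq> \<real>" and w: "\<And>x. x \<in> X \<Longrightarrow> 0 < w x"
    and gz: "\<And>z. 0 < Im z \<Longrightarrow> g z = (\<Sum>x\<in>X. of_real (w x) / (x - z))"
    using g by (auto simp: discrete_stieltjes_def)
  \<comment> \<open>\<open>G\<close> continues \<open>z + g z\<close> from the upper half-plane,
    where alone \<open>g\<close> is known, to all points off \<open>X\<close>; \<open>D\<close>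
    clears its denominators and leaves the numerator \<open>E\<close>.\<close>
  define G where "G z = z - (\<Sum>x\<in>X. of_real (w x) / (z - x))" for z :: complex
  define D where "D = root_prod X"
  define W where "W = (\<Sum>x\<in>X. smult (of_real (w x)) (root_prod (X - {x})))"
  define E where "E = pCons 0 D - W"
  define n where "n = card X"
  have polyE: "poly E z = z * poly D z - (\<Sum>x\<in>X. of_real (w x) * (\<Prod>y\<in>X-{x}. z - y))" for z
    unfolding E_def W_def by (simp add: poly_sum poly_root_prod)
  have E_G: "poly E z = poly D z * G z" if "z \<notin> X" for z
    using that X unfolding polyE G_def D_def poly_root_prod
    by (simp add: prod_remove_div right_diff_distrib sum_distrib_left mult.commute)
  have D0: "poly D z \<noteq> 0" if "z \<notin> X" for z
    using that X unfolding D_def poly_root_prod by auto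
  have E_X: "poly E x \<noteq> 0" if x: "x \<in> X" for x
  proof -
    have "(\<Sum>x'\<in>X. of_real (w x') * (\<Prod>y\<in>X-{x'}. x - y)) = of_real (w x) * (\<Prod>y\<in>X-{x}. x - y)"
      using X x by (subst sum.remove[of _ x]) (auto intro!: sum.neutral)
    moreover have "poly D x = 0" using X x by (auto simp: D_def poly_root_prod)
    moreover have "(\<Prod>y\<in>X-{x}. x - y) \<noteq> 0" using X by auto
    ultimately show ?thesis using w[OF x] by (simp add: polyE)
  qed
  have G_nonreal: "G z \<noteq> 0" if z: "Im z \<noteq> 0" for z
  proof -
    have "Im (G z) = Im z * (1 + (\<Sum>x\<in>X. w x / (cmod (z - x))\<^sup>2))"
    proof -
      have "Im (of_real (w x) / (z - x)) = - (Im z * (w x / (cmod (z - x))\<^sup>2))" if "x \<in> X" for x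
      proof -
        have "Im x = 0" using that X by (auto simp: complex_is_Real_iff)
        thus ?thesis unfolding Im_divide cmod_power2 by simp
      qed
      thus ?thesis by (simp add: G_def sum_negf sum_distrib_left distrib_left)
    qed
    moreover have "0 \<le> (\<Sum>x\<in>X. w x / (cmod (z - x))\<^sup>2)" by (intro sum_nonneg) (auto dest!: w)
    ultimately show ?thesis using z by (metis add_pos_nonneg less_irrefl mult_eq_0_iff zero_complex.simps(2) zero_less_one)
  qed
  \<comment> \<open>The derivative of \<open>G\<close> at a real point. Its positivity makes the
    zeros of \<open>E\<close> simple, and its reciprocals become the new weights.\<close>
  define G' where "G' y = 1 + (\<Sum>x\<in>X. w x / (Re y - Re x)\<^sup>2)" for y
  have G'_pos: "0 < G' y" for y
    unfolding G'_def by (intro add_pos_nonneg sum_nonneg) (auto dest!: w)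
  have E': "poly (pderiv E) y = poly D y * of_real (G' y)" "y \<in> \<real>" "y \<notin> X" if y: "poly E y = 0" for y
  proof -
    show yX: "y \<notin> X" using E_X y by auto
    hence Gy: "G y = 0" using E_G[OF yX] D0[OF yX] y by simp
    hence "Im y = 0" using G_nonreal by auto
    thus yR: "y \<in> \<real>" by (simp add: complex_is_Real_iff)
    have "((\<lambda>z. of_real (w x) / (z - x)) has_field_derivative - of_real (w x / (Re y - Re x)\<^sup>2)) (at y)"
      if "x \<in> X" for x
    proof -
      have xy: "y \<noteq> x" using that yX by auto
      have "x \<in> \<real>" using that X by auto
      hence "y - x = of_real (Re y - Re x)" using yR
        by (simp add: complex_eq_iff complex_is_Real_iff)
      hence "- of_real (w x / (Re y - Re x)\<^sup>2) = - of_real (w x) / (y - x)\<^sup>2"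
        by (simp only: of_real_divide of_real_power minus_divide_left)
      moreover have "((\<lambda>z. of_real (w x) / (z - x)) has_field_derivative - of_real (w x) / (y - x)\<^sup>2) (at y)"
        using xy by (auto intro!: derivative_eq_intros simp: power2_eq_square)
      ultimately show ?thesis by (simp only:)
    qed
    hence "(G has_field_derivative (1 - (\<Sum>x\<in>X. - of_real (w x / (Re y - Re x)\<^sup>2)))) (at y)"
      unfolding G_def by (intro DERIV_diff DERIV_ident DERIV_sum) auto
    hence "(G has_field_derivative of_real (G' y)) (at y)"
      by (simp add: G'_def sum_negf)
    hence "((\<lambda>z. poly D z * G z) has_field_derivative poly D y * of_real (G' y)) (at y)"
      using DERIV_mult[OF poly_DERIV[of D y], of G "of_real (G' y)"] Gy by (simp add: mult.commute)
    moreover have "eventually (\<lambda>z. poly D z * G z = poly E z) (nhds y)"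
    proof (rule eventually_nhds_in_open[THEN eventually_mono])
      show "open (- X)" using X by (simp add: finite_imp_closed open_Compl)
    qed (use yX E_G in auto)
    ultimately have "(poly E has_field_derivative poly D y * of_real (G' y)) (at y)"
      using DERIV_cong_ev[OF refl _ refl, of "\<lambda>z. poly D z * G z" "poly E" y] by simp
    thus "poly (pderiv E) y = poly D y * of_real (G' y)"
      using poly_DERIV DERIV_unique by blast
  qed
  have degW: "degree W \<le> n"
    unfolding W_def
  proof (rule degree_sum_le)
    show "degree (smult (of_real (w x)) (root_prod (X - {x}))) \<le> n" if "x \<in> X" for x
      using root_prod_monic(1)[of "X - {x}"] X that w[OF that] by (simp add: n_def)
  qed (use X in auto)
  have degD: "degree D = n" "coeff D n = 1" "D \<noteq> 0"
    using root_prod_monic[OF X(1)] unfolding D_def n_def by auto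
  have degE: "degree E = Suc n" "lead_coeff E = 1"
  proof -
    have "degree (pCons 0 D) = Suc n" using degD by simp
    thus 1: "degree E = Suc n" unfolding E_def using degW
      by (metis degree_diff_less degree_add_eq_left degree_minus diff_conv_add_uminus le_imp_less_Suc)
    show "lead_coeff E = 1" unfolding 1 using degW degD by (simp add: E_def coeff_eq_0)
  qed
  define Y where "Y = {y. poly E y = 0}"
  have "E \<noteq> 0" using degE by auto
  hence finY: "finite Y" unfolding Y_def by (rule poly_roots_finite)
  have "rsquarefree E" unfolding rsquarefree_roots
    using E' D0 G'_pos by (metis less_irrefl mult_eq_0_iff of_real_eq_0_iff)
  hence E_prod: "E = root_prod Y"
    using complex_poly_decompose_rsquarefree[of E] degE by (simp add: Y_def)
  have cardY: "card Y = Suc n" using degE root_prod_monic[OF finY] E_prod by simp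
  define r where "r y = 1 / G' y" for y
  \<comment> \<open>Lagrange interpolation of \<open>D\<close>, of degree \<open>n\<close>, at the
    \<open>n + 1\<close> roots of \<open>E\<close>. Comparing the coefficients of degree
    \<open>n\<close> then gives total weight 1.\<close>
  have DY: "D = (\<Sum>y\<in>Y. smult (of_real (r y)) (root_prod (Y - {y})))" (is "_ = ?R")
  proof (rule poly_eqI_degree[where A=Y])
    have cy: "card (Y - {y}) = n" if "y \<in> Y" for y using that finY cardY by simp
    have "degree ?R \<le> n"
    proof (rule degree_sum_le[OF finY])
      show "degree (smult (of_real (r y)) (root_prod (Y - {y}))) \<le> n" if "y \<in> Y" for y
        using root_prod_monic(1)[of "Y - {y}"] finY cy[OF that] G'_pos[of y] by (simp add: r_def)
    qed
    thus "degree ?R < card Y" "degree D < card Y" using cardY degD by auto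
    fix y assume y: "y \<in> Y"
    have "poly ?R y = (\<Sum>y'\<in>Y. of_real (r y') * (\<Prod>u\<in>Y-{y'}. y - u))"
      by (simp add: poly_sum poly_root_prod)
    also have "\<dots> = of_real (r y) * (\<Prod>u\<in>Y-{y}. y - u)"
      using finY y by (subst sum.remove[of _ y]) (auto intro!: sum.neutral)
    also have "(\<Prod>u\<in>Y-{y}. y - u) = poly (pderiv E) y"
    proof -
      have "E = [:-y,1:] * root_prod (Y - {y})" using E_prod finY y by (simp add: prod.remove)
      hence "pderiv E = [:-y,1:] * pderiv (root_prod (Y - {y})) + root_prod (Y - {y}) * 1"
        using pderiv_mult[of "[:-y,1:]" "root_prod (Y - {y})"] by (simp add: pderiv_pCons)
      thus ?thesis by (simp add: poly_root_prod)
    qed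
    also have "of_real (r y) * poly (pderiv E) y = poly D y"
      using E'[of y] y G'_pos[of y] by (simp add: Y_def r_def)
    finally show "poly D y = poly ?R y" ..
  qed
  have "coeff (root_prod (Y - {y})) n = 1" if "y \<in> Y" for y
    using root_prod_monic(2)[of "Y - {y}"] that finY cardY by simp
  hence "of_real (\<Sum>y\<in>Y. r y) = coeff D n"
    by (subst DY) (auto simp: coeff_sum of_real_sum)
  hence sum_r: "(\<Sum>y\<in>Y. r y) = 1" using degD by (metis of_real_eq_1_iff)
  have "discrete_stieltjes Y r (\<lambda>z. - 1 / (z + g z))"
    unfolding discrete_stieltjes_def
  proof (intro conjI allI impI ballI)
    show "Y \<subseteq> \<real>" using E' by (auto simp: Y_def)
    show "0 < r y" for y using G'_pos by (simp add: r_def)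
    fix z :: complex assume z: "0 < Im z"
    have zX: "z \<notin> X" "z \<notin> Y" using z X \<open>Y \<subseteq> \<real>\<close> by (auto simp: complex_is_Real_iff)
    have "G z = z + g z"
      unfolding G_def gz[OF z] by (simp add: sum_negf[symmetric] minus_divide_right del: sum_negf)
    hence "- 1 / (z + g z) = - poly D z / poly E z"
      using E_G[OF zX(1)] D0[OF zX(1)] by simp
    also have "poly D z = (\<Sum>y\<in>Y. of_real (r y) * (\<Prod>u\<in>Y-{y}. z - u))"
      by (subst DY) (simp add: poly_sum poly_root_prod)
    also have "\<dots> = (\<Sum>y\<in>Y. of_real (r y) * (poly E z / (z - y)))"
      using finY zX by (intro sum.cong refl) (subst prod_remove_div, auto simp: E_prod poly_root_prod)
    also have "- \<dots> / poly E z = (\<Sum>y\<in>Y. of_real (r y) / (y - z))"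
    proof -
      have "poly E z \<noteq> 0" using zX by (simp add: Y_def)
      hence "- (of_real (r y) * (poly E z / (z - y))) / poly E z = of_real (r y) / (y - z)" if "y \<in> Y" for y
      proof -
        have "z - y \<noteq> 0" "y - z \<noteq> 0" using that zX by auto
        thus ?thesis using \<open>poly E z \<noteq> 0\<close> by (simp add: field_simps)
      qed
      thus ?thesis by (simp add: sum_negf[symmetric] sum_divide_distrib del: sum_negf)
    qed
    finally show "- 1 / (z + g z) = (\<Sum>y\<in>Y. of_real (r y) / (y - z))" .
  qed (rule finY)
  with sum_r show ?thesis by blast
qed

lemma (in degree_bound) hn_discrete_stieltjes:
  "\<exists>X w. discrete_stieltjes X w (hn n c) \<and> (\<Sum>x\<in>X. w x) = 1"
proof (induction n arbitrary: c)
  case 0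
  have "discrete_stieltjes {0} (\<lambda>_. 1) (hn 0 c)" by (simp add: discrete_stieltjes_def)
  thus ?case by (intro exI[of _ "{0}"] exI[of _ "\<lambda>_. 1"]) (auto simp del: hn.simps)
next
  case (Suc n)
  have "\<exists>X w. discrete_stieltjes X w (\<lambda>z. \<Sum>i<rdeg c. hn n (subtree c i) z)"
    by (rule discrete_stieltjes_sum) (use Suc in blast)
  then obtain X w where "discrete_stieltjes X w (\<lambda>z. \<Sum>i<rdeg c. hn n (subtree c i) z)" by blast
  from discrete_stieltjes_step[OF this] show ?case by simp
qed

section \<open>Existence and uniqueness of the spectral measure\<close>

definition stieltjes :: "real measure \<Rightarrow> complex \<Rightarrow> complex" where
  "stieltjes M z = (\<integral>x. 1 / (of_real x - z) \<partial>M)"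

lemma cmod_of_real_diff_ge: "\<bar>Im z\<bar> \<le> cmod (of_real x - z)"
  using abs_Im_le_cmod[of "of_real x - z"] by simp

lemma cauchy_kernel_bound:
  assumes "Im z \<noteq> 0"
  shows "cmod (1 / (of_real x - z)) \<le> 1 / \<bar>Im z\<bar>"
  using assms cmod_of_real_diff_ge[of z x] by (simp add: norm_divide frac_le)

lemma cauchy_kernel_cont: "Im z \<noteq> 0 \<Longrightarrow> isCont (\<lambda>x. 1 / (of_real x - z)) x"
  by (intro continuous_intros) (auto simp: complex_eq_iff)

lemma (in real_distribution) integrable_cauchy_kernel:
  assumes "Im z \<noteq> 0"
  shows "integrable M (\<lambda>x. 1 / (of_real x - z))"
proof (rule integrable_const_bound[where B="1 / \<bar>Im z\<bar>"])
  show "AE x in M. norm (1 / (of_real x - z)) \<le> 1 / \<bar>Im z\<bar>"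
    using cauchy_kernel_bound[OF assms] by auto
qed (use assms in measurable)

lemma Im_cauchy_kernel: "Im (1 / (of_real x - z)) = Im z / ((x - Re z)\<^sup>2 + (Im z)\<^sup>2)"
  unfolding Im_divide by simp

lemma (in real_distribution) Im_stieltjes:
  assumes "Im z \<noteq> 0"
  shows "Im (stieltjes M z) = (\<integral>x. Im z / ((x - Re z)\<^sup>2 + (Im z)\<^sup>2) \<partial>M)"
    "integrable M (\<lambda>x. Im z / ((x - Re z)\<^sup>2 + (Im z)\<^sup>2))"
  using integral_Im[OF integrable_cauchy_kernel[OF assms]] integrable_Im[OF integrable_cauchy_kernel[OF assms]]
  unfolding stieltjes_def Im_cauchy_kernel by auto

lemma stieltjes_cnj: "stieltjes M (cnj z) = cnj (stieltjes M z)"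
proof -
  have "stieltjes M (cnj z) = (\<integral>x. cnj (1 / (of_real x - z)) \<partial>M)"
    unfolding stieltjes_def by (rule Bochner_Integration.integral_cong) simp_all
  also have "\<dots> = cnj (stieltjes M z)" unfolding stieltjes_def by (rule Bochner_Integration.integral_cnj)
  finally show ?thesis .
qed

lemma discrete_stieltjes_measure:
  assumes "discrete_stieltjes X w g" "(\<Sum>x\<in>X. w x) = 1"
  shows "\<exists>M. real_distribution M \<and> (\<forall>z. 0 < Im z \<longrightarrow> g z = stieltjes M z)"
proof -
  have X: "finite X" "X \<subseteq> \<real>" and w: "\<And>x. x \<in> X \<Longrightarrow> 0 < w x"
    and gz: "\<And>z. 0 < Im z \<Longrightarrow> g z = (\<Sum>x\<in>X. of_real (w x) / (x - z))"
    using assms by (auto simp: discrete_stieltjes_def)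
  define v where "v x = (if x \<in> X then w x else 0)" for x
  define p where "p = embed_pmf v"
  have p: "pmf p x = v x" for x
    unfolding p_def
  proof (rule pmf_embed_pmf)
    show "0 \<le> v x" for x using w[of x] by (auto simp: v_def intro: less_imp_le)
    have "(\<integral>\<^sup>+x. ennreal (v x) \<partial>count_space UNIV) = (\<integral>\<^sup>+x. ennreal (v x) \<partial>count_space X)"
      by (rule nn_integral_count_space_eq) (auto simp: v_def)
    also have "\<dots> = (\<Sum>x\<in>X. ennreal (w x))"
      using X by (subst nn_integral_count_space_finite) (auto simp: v_def)
    also have "\<dots> = ennreal (\<Sum>x\<in>X. w x)" by (rule sum_ennreal) (use w less_imp_le in blast)
    finally show "(\<integral>\<^sup>+x. ennreal (v x) \<partial>count_space UNIV) = 1" using assms by simp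
  qed
  have setp: "set_pmf p \<subseteq> X" unfolding set_pmf_eq p by (auto simp: v_def)
  define M where "M = distr (measure_pmf p) borel Re"
  have "real_distribution M"
    unfolding M_def real_distribution_def real_distribution_axioms_def
    by (auto intro!: measure_pmf.prob_space_distr)
  moreover have "g z = stieltjes M z" if z: "0 < Im z" for z
  proof -
    have "stieltjes M z = (\<integral>x. 1 / (of_real (Re x) - z) \<partial>measure_pmf p)"
      unfolding stieltjes_def M_def using z by (subst integral_distr) auto
    also have "\<dots> = (\<Sum>x\<in>X. pmf p x *\<^sub>R (1 / (of_real (Re x) - z)))"
      by (rule integral_measure_pmf[OF X(1)]) (use setp in auto)
    also have "\<dots> = (\<Sum>x\<in>X. of_real (w x) / (x - z))"
      using X by (intro sum.cong) (auto simp: p v_def scaleR_conv_of_real complex_is_Real_iff subset_iff of_real_Re)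
    finally show ?thesis using gz[OF z] by simp
  qed
  ultimately show ?thesis by blast
qed

text \<open>The function 2 * (1 - y^2 / (x^2 + y^2)) = 2 x^2 / (x^2 + y^2) is non-negative, and at
  least 1 when |x| \<ge> y; its integral is read off from the transform at the point i y.\<close>

lemma (in real_distribution) prob_tail_le:
  assumes y: "0 < y" and C: "y * (1 - y * Im (stieltjes M (Complex 0 y))) \<le> C"
  shows "1 - 2 * C / y \<le> prob {- y <.. y}"
proof -
  have i: "integrable M (\<lambda>x. y / (x\<^sup>2 + y\<^sup>2))" "Im (stieltjes M (Complex 0 y)) = (\<integral>x. y / (x\<^sup>2 + y\<^sup>2) \<partial>M)"
    using Im_stieltjes[of "Complex 0 y"] y by auto
  have "prob (- {- y <.. y}) = (\<integral>x. indicator (- {- y <.. y}) x \<partial>M)" by simp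
  also have "\<dots> \<le> (\<integral>x. 2 * (1 - y * (y / (x\<^sup>2 + y\<^sup>2))) \<partial>M)"
  proof (rule integral_mono)
    fix x
    have pos: "0 < x\<^sup>2 + y\<^sup>2" using y by (simp add: add_nonneg_pos)
    have "1 \<le> 2 * (1 - y * (y / (x\<^sup>2 + y\<^sup>2)))" if "x \<notin> {- y <.. y}"
    proof -
      have "y \<le> \<bar>x\<bar>" using that by auto
      hence "y\<^sup>2 \<le> x\<^sup>2" using y by (metis abs_le_square_iff abs_of_pos)
      thus ?thesis using pos by (simp add: field_simps power2_eq_square)
    qed
    moreover have "0 \<le> 2 * (1 - y * (y / (x\<^sup>2 + y\<^sup>2)))" using pos by (simp add: field_simps power2_eq_square)
    ultimately show "indicator (- {- y <.. y}) x \<le> 2 * (1 - y * (y / (x\<^sup>2 + y\<^sup>2)))"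
      by (auto simp: indicator_def)
  next
    show "integrable M (\<lambda>x. 2 * (1 - y * (y / (x\<^sup>2 + y\<^sup>2))))"
      by (intro integrable_mult_right Bochner_Integration.integrable_diff i(1) integrable_const)
  qed (simp add: emeasure_eq_measure)
  also have "\<dots> = 2 * (1 - y * Im (stieltjes M (Complex 0 y)))"
    unfolding i(2) integral_mult_right_zero
    using prob_space
    by (subst Bochner_Integration.integral_diff) (auto intro!: integrable_mult_right i(1) simp del: times_divide_eq_right)
  also have "\<dots> \<le> 2 * C / y" using C y by (simp add: field_simps)
  finally have "prob (- {- y <.. y}) \<le> 2 * C / y" .
  moreover have "prob (- {- y <.. y}) = 1 - prob {- y <.. y}"
    using prob_compl[of "{- y <.. y}"] by (simp add: Compl_eq_Diff_UNIV)
  ultimately show ?thesis by simp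
qed

context degree_bound
begin

text \<open>Comparison with the isolated vertex: the difference from -1/z is S / (z (z + S)) with
  |S| \<le> d / y, hence of order y^(-3) at z = i y. The bound is the same for all \<open>n\<close>,
  which will give tightness.\<close>

lemma hn_tail:
  assumes y: "0 < y"
  shows "y * (1 - y * Im (hn n c (Complex 0 y))) \<le> real d / y"
proof -
  let ?z = "Complex 0 y"
  have z: "0 < Im ?z" using y by simp
  obtain S where S: "hn n c ?z = - 1 / (?z + S)" "0 \<le> Im S" "cmod S \<le> real d / y"
  proof (cases n)
    case 0
    then show ?thesis using that[of 0] y by simp
  next
    case (Suc m)
    have "cmod (\<Sum>i<rdeg c. hn m (subtree c i) ?z) \<le> real d * (1 / Im ?z)"
      by (rule sum_cmod_le) (use hn_cmod_le[OF z] rdeg_le y in auto)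
    then show ?thesis using that[of "\<Sum>i<rdeg c. hn m (subtree c i) ?z"] Suc hn_sum_Im_nonneg[OF z] by simp
  qed
  have nz: "y \<le> cmod (?z + S)" using abs_Im_le_cmod[of "?z + S"] S y by simp
  have nz': "?z + S \<noteq> 0" "?z \<noteq> 0" using nz y S(2) by (auto simp: complex_eq_iff)
  have "hn n c ?z - (- 1 / ?z) = S / (?z * (?z + S))"
    using nz' by (simp add: S(1) field_simps)
  hence "cmod (hn n c ?z - (- 1 / ?z)) = cmod S / (y * cmod (?z + S))"
    using y by (simp only: norm_divide norm_mult) (simp add: complex_norm)
  also have "\<dots> \<le> (real d / y) / (y * y)"
    using S nz y by (intro frac_le mult_left_mono) auto
  finally have "\<bar>Im (hn n c ?z) - Im (- 1 / ?z)\<bar> \<le> real d / y ^ 3"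
    using abs_Im_le_cmod[of "hn n c ?z - (- 1 / ?z)"] by (simp add: power3_eq_cube)
  moreover have "Im (- 1 / ?z) = 1 / y" unfolding Im_neg_inverse using y by (simp add: complex_norm power2_eq_square)
  ultimately have "1 / y - Im (hn n c ?z) \<le> real d / y ^ 3" by linarith
  hence "y\<^sup>2 * (1 / y - Im (hn n c ?z)) \<le> y\<^sup>2 * (real d / y ^ 3)" using y by (intro mult_left_mono) auto
  thus ?thesis using y by (simp add: power2_eq_square power3_eq_cube right_diff_distrib)
qed

text \<open>The measures of the finite approximations are tight, and a weak limit has the right
  transform because the Cauchy kernel is bounded and continuous.\<close>

lemma h_measure_exists: "\<exists>M. real_distribution M \<and> (\<forall>z. 0 < Im z \<longrightarrow> h c z = stieltjes M z)"
proof -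
  have "\<forall>n. \<exists>M. real_distribution M \<and> (\<forall>z. 0 < Im z \<longrightarrow> hn n c z = stieltjes M z)"
    using hn_discrete_stieltjes discrete_stieltjes_measure by metis
  then obtain \<mu> where \<mu>: "\<And>n. real_distribution (\<mu> n)" "\<And>n z. 0 < Im z \<Longrightarrow> hn n c z = stieltjes (\<mu> n) z"
    by metis
  have "tight \<mu>"
    unfolding tight_def
  proof (intro conjI allI impI \<mu>)
    fix e :: real assume e: "0 < e"
    \<comment> \<open>Makes the tail bound 2 d / y^2 smaller than \<open>e\<close>: the second
      summand gives 2 d < e y, and the summand 1 gives y \<le> y^2.\<close>
    define y where "y = 1 + 2 * real d / e"
    have y: "1 \<le> y" "0 < y" using e by (auto simp: y_def add_pos_nonneg)
    have "2 * (real d / y) / y < e"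
    proof -
      have "2 * real d < e * y" using e by (simp add: y_def distrib_left)
      also have "\<dots> \<le> e * (y * y)" using e y by simp
      finally show ?thesis using y by (simp add: field_simps)
    qed
    moreover have "1 - 2 * (real d / y) / y \<le> measure (\<mu> n) {- y <.. y}" for n
      by (rule real_distribution.prob_tail_le[OF \<mu>(1) y(2)])
         (use hn_tail[OF y(2), of n c] \<mu>(2)[of "Complex 0 y" n] y in simp)
    ultimately have "\<And>n. 1 - e < measure (\<mu> n) {- y <.. y}" by (meson diff_strict_left_mono less_le_trans)
    thus "\<exists>a b. a < b \<and> (\<forall>n. 1 - e < measure (\<mu> n) {a<..b})"
      using y by (intro exI[of _ "-y"] exI[of _ y]) auto
  qed
  from tight_imp_convergent_subsubsequence[OF this strict_mono_id] obtain r M where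
    r: "strict_mono r" and M: "real_distribution M" and conv: "weak_conv_m (\<mu> \<circ> r) M" by auto
  have "h c z = stieltjes M z" if z: "0 < Im z" for z
  proof -
    have "(\<lambda>n. stieltjes ((\<mu> \<circ> r) n) z) \<longlonglongrightarrow> stieltjes M z"
      unfolding stieltjes_def
      by (rule weak_conv_imp_integral_bdd_continuous_conv[OF _ M conv])
         (use z \<mu> cauchy_kernel_bound[of z] cauchy_kernel_cont[of z] in auto)
    moreover have "(\<lambda>n. hn (r n) c z) \<longlonglongrightarrow> h c z"
      using LIMSEQ_subseq_LIMSEQ[OF hn_tendsto[OF z] r] by (simp add: o_def)
    ultimately show ?thesis using \<mu>(2)[OF z] LIMSEQ_unique by simp
  qed
  with M show ?thesis by blast
qed

end

section \<open>Stieltjes inversion and uniqueness\<close>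

lemma (in real_distribution) stieltjes_inversion:
  assumes ab: "a \<le> b" and e: "0 < e"
  shows "(\<integral>\<^sup>+\<xi>. ennreal (arctan ((b - \<xi>) / e) - arctan ((a - \<xi>) / e)) \<partial>M) =
    (\<integral>\<^sup>+x. ennreal (Im (stieltjes M (Complex x e)) * indicator {a..b} x) \<partial>lborel)"
proof -
  interpret pair_sigma_finite M lborel ..
  define f where "f \<xi> x = e / ((\<xi> - x)\<^sup>2 + e\<^sup>2)" for \<xi> x :: real
  have pos: "0 < (\<xi> - x)\<^sup>2 + e\<^sup>2" for \<xi> x :: real using e by (simp add: add_nonneg_pos)
  have f0: "0 \<le> f \<xi> x" for \<xi> x using e pos[of \<xi> x] by (simp add: f_def)
  have [measurable]: "case_prod f \<in> borel_measurable (borel \<Otimes>\<^sub>M borel)"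
    unfolding f_def by measurable
  have inner: "(\<integral>\<^sup>+x. ennreal (f \<xi> x * indicator {a..b} x) \<partial>lborel) =
      ennreal (arctan ((b - \<xi>) / e) - arctan ((a - \<xi>) / e))" for \<xi>
  proof -
    have "has_bochner_integral lborel (\<lambda>x. f \<xi> x * indicator {a..b} x)
        (arctan ((b - \<xi>) / e) - arctan ((a - \<xi>) / e))"
    proof (rule has_bochner_integral_FTC_Icc_real[OF ab])
      fix x
      show "((\<lambda>x. arctan ((x - \<xi>) / e)) has_real_derivative f \<xi> x) (at x)"
        using e pos[of \<xi> x]
        by (auto intro!: derivative_eq_intros simp: f_def divide_simps power2_eq_square)
           (auto simp: algebra_simps)
      show "isCont (f \<xi>) x" unfolding f_def using pos[of \<xi> x] by (intro continuous_intros) auto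
    qed
    thus ?thesis using f0 by (subst nn_integral_eq_integral)
       (auto simp: has_bochner_integral_iff intro!: mult_nonneg_nonneg)
  qed
  have outer: "(\<integral>\<^sup>+\<xi>. ennreal (f \<xi> x * indicator {a..b} x) \<partial>M) =
      ennreal (Im (stieltjes M (Complex x e)) * indicator {a..b} x)" for x
  proof -
    have "integrable M (\<lambda>\<xi>. f \<xi> x)" "Im (stieltjes M (Complex x e)) = (\<integral>\<xi>. f \<xi> x \<partial>M)"
      using Im_stieltjes[of "Complex x e"] e by (auto simp: f_def)
    thus ?thesis using f0 by (subst nn_integral_eq_integral) (auto intro!: mult_nonneg_nonneg)
  qed
  have "(\<integral>\<^sup>+\<xi>. (\<integral>\<^sup>+x. ennreal (f \<xi> x * indicator {a..b} x) \<partial>lborel) \<partial>M) =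
      (\<integral>\<^sup>+x. (\<integral>\<^sup>+\<xi>. ennreal (f \<xi> x * indicator {a..b} x) \<partial>M) \<partial>lborel)"
    by (rule Fubini'[symmetric]) measurable
  thus ?thesis unfolding inner outer .
qed

text \<open>The upper end of the window approaches \<open>b\<close> from above at distance 1/(n+1),
  slowly compared with the kernel width 1/(n+1)^2. Hence the point x = b receives its full weight
  instead of half of it, and the limit is a cdf.\<close>

lemma arctan_kernel_tendsto:
  "(\<lambda>n. arctan ((b + 1 / Suc n - x) / (1 / (Suc n)\<^sup>2)) - arctan ((- real (Suc n) - x) / (1 / (Suc n)\<^sup>2)))
    \<longlonglongrightarrow> pi * indicator {..b} x"
proof -
  have top: "filterlim (\<lambda>n. real (Suc n)) at_top sequentially"
    using filterlim_compose[OF filterlim_real_sequentially filterlim_Suc] .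
  have bot: "filterlim (\<lambda>n. - real (Suc n)) at_bot sequentially"
    using top unfolding filterlim_uminus_at_top .
  have ev: "eventually (\<lambda>n. c \<le> real (Suc n)) sequentially" for c
    using top by (simp add: filterlim_at_top)
  have A: "(\<lambda>n. arctan ((- real (Suc n) - x) / (1 / (Suc n)\<^sup>2))) \<longlonglongrightarrow> - (pi / 2)"
  proof (rule filterlim_compose[OF tendsto_arctan_at_bot], rule filterlim_at_bot_mono[OF bot])
    show "eventually (\<lambda>n. (- real (Suc n) - x) / (1 / (Suc n)\<^sup>2) \<le> - real (Suc n)) sequentially"
      using ev[of "1 + \<bar>x\<bar>"]
    proof eventually_elim
      case (elim n)
      have "1 * real (Suc n) \<le> (real (Suc n) + x) * (real (Suc n))\<^sup>2"
        using elim by (intro mult_mono) (auto simp: power2_eq_square)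
      thus ?case by (simp add: algebra_simps)
    qed
  qed
  show ?thesis
  proof (cases "x \<le> b")
    case True
    have "(\<lambda>n. arctan ((b + 1 / Suc n - x) / (1 / (Suc n)\<^sup>2))) \<longlonglongrightarrow> pi / 2"
    proof (rule filterlim_compose[OF tendsto_arctan_at_top], rule filterlim_at_top_mono[OF top])
      have "real (Suc n) \<le> (b + 1 / Suc n - x) / (1 / (Suc n)\<^sup>2)" for n
      proof -
        have "real (Suc n) = 1 / Suc n * (real (Suc n))\<^sup>2" by (simp add: power2_eq_square)
        also have "\<dots> \<le> (b + 1 / Suc n - x) * (real (Suc n))\<^sup>2" using True by (intro mult_right_mono) auto
        finally show ?thesis by simp
      qed
      thus "eventually (\<lambda>n. real (Suc n) \<le> (b + 1 / Suc n - x) / (1 / (Suc n)\<^sup>2)) sequentially" by simp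
    qed
    from tendsto_diff[OF this A] show ?thesis using True by simp
  next
    case False
    have "(\<lambda>n. arctan ((b + 1 / Suc n - x) / (1 / (Suc n)\<^sup>2))) \<longlonglongrightarrow> - (pi / 2)"
    proof (rule filterlim_compose[OF tendsto_arctan_at_bot], rule filterlim_at_bot_mono[OF bot])
      show "eventually (\<lambda>n. (b + 1 / Suc n - x) / (1 / (Suc n)\<^sup>2) \<le> - real (Suc n)) sequentially"
        using ev[of "2 / (x - b)"]
      proof eventually_elim
        case (elim n)
        hence "2 \<le> (x - b) * real (Suc n)" using False by (simp add: field_simps)
        hence "2 * real (Suc n) \<le> (x - b) * real (Suc n) * real (Suc n)" by (rule mult_right_mono) simp
        moreover have "(b + 1 / Suc n - x) / (1 / (Suc n)\<^sup>2) = real (Suc n) - (x - b) * real (Suc n) * real (Suc n)"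
          by (simp add: power2_eq_square field_simps)
        moreover have "N - X \<le> - N" if "2 * N \<le> X" for N X :: real using that by simp
        ultimately show ?case by (simp only:)
      qed
    qed
    from tendsto_diff[OF this A] show ?thesis using False by simp
  qed
qed

text \<open>By the inversion formula the integral of \<open>F n\<close> is determined by the
  transform at height 1/(n+1)^2, and it tends to pi times the cdf at \<open>b\<close>.\<close>

theorem stieltjes_unique:
  assumes M: "real_distribution M" and N: "real_distribution N"
    and eq: "\<And>z. 0 < Im z \<Longrightarrow> stieltjes M z = stieltjes N z"
  shows "M = N"
proof (rule cdf_unique[OF M N], rule ext)
  fix b
  define F where "F n x = arctan ((b + 1 / Suc n - x) / (1 / (Suc n)\<^sup>2)) - arctan ((- real (Suc n) - x) / (1 / (Suc n)\<^sup>2))"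
    for n :: nat and x :: real
  have F_bound: "\<bar>F n x\<bar> \<le> pi" for n x
    unfolding F_def using arctan_bounded[of "(b + 1 / Suc n - x) / (1 / (Suc n)\<^sup>2)"]
      arctan_bounded[of "(- real (Suc n) - x) / (1 / (Suc n)\<^sup>2)"] by linarith
  have F_meas [measurable]: "F n \<in> borel_measurable borel" for n unfolding F_def by measurable
  \<comment> \<open>From \<open>n0\<close> on the window is a proper interval, so \<open>F n\<close>
    is non-negative and the inversion formula applies.\<close>
  obtain n0 where n0: "- b \<le> real n0" using real_arch_simple by blast
  have ab: "- real (Suc n) \<le> b + 1 / Suc n" if "n0 \<le> n" for n
    using that n0 order_trans[of 0 "1 / real (Suc n)" "1 / real (Suc n)"] by (smt (verit) of_nat_Suc of_nat_mono divide_nonneg_nonneg of_nat_0_le_iff)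
  have F_nonneg: "0 \<le> F n x" if "n0 \<le> n" for n x
  proof -
    have "(- real (Suc n) - x) / (1 / (Suc n)\<^sup>2) \<le> (b + 1 / Suc n - x) / (1 / (Suc n)\<^sup>2)"
      using ab[OF that] by (intro divide_right_mono) auto
    thus ?thesis unfolding F_def by (simp add: arctan_le_iff)
  qed
  have lim: "(\<lambda>n. \<integral>x. F n x \<partial>P) \<longlonglongrightarrow> pi * cdf P b" if P: "real_distribution P" for P
  proof -
    interpret P: real_distribution P by fact
    have "(\<lambda>n. \<integral>x. F n x \<partial>P) \<longlonglongrightarrow> (\<integral>x. pi * indicator {..b} x \<partial>P)"
      by (rule integral_dominated_convergence[where w="\<lambda>_. pi"])
         (use arctan_kernel_tendsto[of b] F_bound in \<open>auto simp: F_def[abs_def]\<close>)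
    thus ?thesis by (simp add: cdf_def)
  qed
  have int: "(\<integral>x. F n x \<partial>P) = enn2real (\<integral>\<^sup>+x. ennreal (Im (stieltjes P (Complex x (1 / (Suc n)\<^sup>2))) *
      indicator {- real (Suc n)..b + 1 / Suc n} x) \<partial>lborel)" if P: "real_distribution P" "n0 \<le> n" for P n
  proof -
    interpret P: real_distribution P by fact
    have "(\<integral>x. F n x \<partial>P) = enn2real (\<integral>\<^sup>+x. ennreal (F n x) \<partial>P)"
      using F_nonneg[OF P(2)] by (intro integral_eq_nn_integral) auto
    thus ?thesis unfolding F_def using P.stieltjes_inversion[OF ab[OF P(2)], of "1 / (Suc n)\<^sup>2"] by simp
  qed
  have "(\<integral>x. F n x \<partial>M) = (\<integral>x. F n x \<partial>N)" if "n0 \<le> n" for n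
    unfolding int[OF M that] int[OF N that] by (simp add: eq)
  hence "(\<lambda>n. \<integral>x. F n x \<partial>M) \<longlonglongrightarrow> pi * cdf N b"
    using Lim_transform_eventually[OF lim[OF N]] by (metis (mono_tags, lifting) eventually_sequentially)
  hence "pi * cdf M b = pi * cdf N b" using lim[OF M] LIMSEQ_unique by blast
  thus "cdf M b = cdf N b" by simp
qed

section \<open>Boundary behaviour at a real point\<close>

text \<open>Approaching the real line along one fixed sequence makes all boundary quantities
  sequential limits, hence Borel functions of the tree.\<close>

definition eps :: "nat \<Rightarrow> real" where "eps n = 1 / real (Suc n)"

lemma eps_pos: "0 < eps n" by (simp add: eps_def)

lemma eps_tendsto: "eps \<longlonglongrightarrow> 0"
  unfolding eps_def[abs_def] using lim_inverse_n' LIMSEQ_Suc by blast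

lemma eps_antimono: "m \<le> n \<Longrightarrow> eps n \<le> eps m"
  unfolding eps_def by (intro divide_left_mono) auto

text \<open>If \<open>H\<close> is the Stieltjes transform of a probability measure along \<open>l + i eps n\<close>, then \<open>mass H\<close> is the
  atom at \<open>l\<close>; the integral of \<open>1/(x - l)\<^sup>2\<close> is \<open>slope H\<close>, and that of \<open>1/(x - l)\<close> is \<open>bval H\<close>, provided that
  the former is finite (otherwise these limits are junk).\<close>

definition mass :: "(nat \<Rightarrow> complex) \<Rightarrow> real" where
  "mass H = lim (\<lambda>n. eps n * Im (H n))"

text \<open>A natural bound makes the condition a countable union over \<open>B\<close>, which
  yields its measurability.\<close>

definition slope_finite :: "(nat \<Rightarrow> complex) \<Rightarrow> bool" where
  "slope_finite H \<longleftrightarrow> (\<exists>B::nat. \<forall>n. Im (H n) / eps n \<le> real B)"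

definition slope :: "(nat \<Rightarrow> complex) \<Rightarrow> real" where
  "slope H = lim (\<lambda>n. Im (H n) / eps n)"

definition bval :: "(nat \<Rightarrow> complex) \<Rightarrow> real" where
  "bval H = lim (\<lambda>n. Re (H n))"

text \<open>The facts about Stieltjes transforms that the boundary analysis uses, collected so that
  the recursion can be studied without mentioning measures. The last clause is a first-order
  expansion H = r + i a eps + o(eps).\<close>

definition boundary_regular :: "(nat \<Rightarrow> complex) \<Rightarrow> bool" where
  "boundary_regular H \<longleftrightarrow> (\<forall>n. 0 < Im (H n)) \<and> incseq (\<lambda>n. Im (H n) / eps n) \<and>
     (\<exists>m. (\<lambda>n. of_real (eps n) * H n) \<longlonglongrightarrow> \<i> * of_real m) \<and>
     (slope_finite H \<longrightarrow> (\<exists>r a. (\<lambda>n. (H n - of_real r) / of_real (eps n)) \<longlonglongrightarrow> \<i> * of_real a))"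

lemma tendsto_mult_eps:
  assumes "(\<lambda>n. F n / of_real (eps n)) \<longlonglongrightarrow> (l::complex)"
  shows "F \<longlonglongrightarrow> 0"
proof -
  have "(\<lambda>n. of_real (eps n) * (F n / of_real (eps n))) \<longlonglongrightarrow> of_real 0 * l"
    by (intro tendsto_mult tendsto_of_real eps_tendsto assms)
  thus ?thesis using eps_pos by (simp add: less_imp_neq[symmetric])
qed

lemma boundary_regular_Im: "boundary_regular H \<Longrightarrow> 0 < Im (H n)"
  by (simp add: boundary_regular_def)

lemma boundary_regular_mass:
  assumes "boundary_regular H"
  shows "(\<lambda>n. of_real (eps n) * H n) \<longlonglongrightarrow> \<i> * of_real (mass H)" "0 \<le> mass H"
proof -
  obtain m where m: "(\<lambda>n. of_real (eps n) * H n) \<longlonglongrightarrow> \<i> * of_real m"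
    using assms by (auto simp: boundary_regular_def)
  have m': "(\<lambda>n. eps n * Im (H n)) \<longlonglongrightarrow> m" using tendsto_Im[OF m] by simp
  hence "mass H = m" unfolding mass_def by (rule limI)
  thus "(\<lambda>n. of_real (eps n) * H n) \<longlonglongrightarrow> \<i> * of_real (mass H)" using m by simp
  show "0 \<le> mass H" unfolding \<open>mass H = m\<close>
    by (rule tendsto_lowerbound[OF m']) (use boundary_regular_Im[OF assms] eps_pos in \<open>auto intro!: always_eventually mult_nonneg_nonneg less_imp_le\<close>)
qed

lemma boundary_regular_slope_finite:
  assumes H: "boundary_regular H" "slope_finite H"
  shows "(\<lambda>n. (H n - of_real (bval H)) / of_real (eps n)) \<longlonglongrightarrow> \<i> * of_real (slope H)"
    "H \<longlonglongrightarrow> of_real (bval H)" "(\<lambda>n. Im (H n) / eps n) \<longlonglongrightarrow> slope H" "0 < slope H" "mass H = 0"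
proof -
  obtain r a where ra: "(\<lambda>n. (H n - of_real r) / of_real (eps n)) \<longlonglongrightarrow> \<i> * of_real a"
    using H by (auto simp: boundary_regular_def)
  have "(\<lambda>n. H n - of_real r) \<longlonglongrightarrow> 0" using tendsto_mult_eps[OF ra] .
  hence Hr: "H \<longlonglongrightarrow> of_real r" by (simp add: Lim_null[symmetric])
  have r: "bval H = r" unfolding bval_def using tendsto_Re[OF Hr] by (intro limI) simp
  have Im_a: "(\<lambda>n. Im (H n) / eps n) \<longlonglongrightarrow> a"
    using tendsto_Im[OF ra] by (simp only: Im_divide_of_real) simp
  hence a: "slope H = a" unfolding slope_def by (rule limI)
  show "(\<lambda>n. (H n - of_real (bval H)) / of_real (eps n)) \<longlonglongrightarrow> \<i> * of_real (slope H)"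
    "H \<longlonglongrightarrow> of_real (bval H)" "(\<lambda>n. Im (H n) / eps n) \<longlonglongrightarrow> slope H"
    using ra Hr Im_a r a by auto
  have "Im (H 0) / eps 0 \<le> a"
    by (rule incseq_le[OF _ Im_a]) (use H in \<open>simp add: boundary_regular_def\<close>)
  moreover have "0 < Im (H 0) / eps 0" using boundary_regular_Im[OF H(1), of 0] eps_pos[of 0] by simp
  ultimately show "0 < slope H" using a by linarith
  have "(\<lambda>n. of_real (eps n) * H n) \<longlonglongrightarrow> of_real 0 * of_real r"
    by (intro tendsto_mult tendsto_of_real eps_tendsto Hr)
  hence "\<i> * of_real (mass H) = 0" using boundary_regular_mass(1)[OF H(1)] LIMSEQ_unique by fastforce
  thus "mass H = 0" by simp
qed

lemma slope_finiteI:
  assumes "boundary_regular H" "(\<lambda>n. Im (H n) / eps n) \<longlonglongrightarrow> a"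
  shows "slope_finite H" "slope H = a"
proof -
  obtain B :: nat where "a \<le> B" using real_arch_simple by blast
  moreover have "Im (H n) / eps n \<le> a" for n
    by (rule incseq_le[OF _ assms(2)]) (use assms in \<open>simp add: boundary_regular_def\<close>)
  ultimately show "slope_finite H" unfolding slope_finite_def by (meson order_trans)
  show "slope H = a" unfolding slope_def using assms(2) by (rule limI)
qed

lemma (in real_distribution) stieltjes_atom:
  "(\<lambda>n. of_real (eps n) * stieltjes M (Complex l (eps n))) \<longlonglongrightarrow> \<i> * of_real (prob {l})"
proof -
  have "(\<lambda>n. \<integral>x. of_real (eps n) * (1 / (of_real x - Complex l (eps n))) \<partial>M) \<longlonglongrightarrow>
      (\<integral>x. \<i> * of_real (indicator {l} x) \<partial>M)"
  proof (rule integral_dominated_convergence[where w="\<lambda>_. 1"])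
    show "AE x in M. (\<lambda>n. of_real (eps n) * (1 / (of_real x - Complex l (eps n)))) \<longlonglongrightarrow> \<i> * of_real (indicator {l} x)"
    proof (rule AE_I2)
      fix x
      have C: "Complex l (eps n) = of_real l + \<i> * of_real (eps n)" for n by (simp add: complex_eq_iff)
      show "(\<lambda>n. of_real (eps n) * (1 / (of_real x - Complex l (eps n)))) \<longlonglongrightarrow> \<i> * of_real (indicator {l} x)"
      proof (cases "x = l")
        case True
        have "of_real (eps n) * (1 / (of_real x - Complex l (eps n))) = \<i>" for n
          using eps_pos[of n] True unfolding C by (simp add: field_simps)
        thus ?thesis using True by simp
      next
        case False
        have "(\<lambda>n. of_real (eps n) * (1 / (of_real x - Complex l (eps n)))) \<longlonglongrightarrow>
          of_real 0 * (1 / (of_real x - (of_real l + \<i> * of_real 0)))"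
          unfolding C by (intro tendsto_intros eps_tendsto) (use False in auto)
        thus ?thesis using False by simp
      qed
    qed
    show "AE x in M. norm (of_real (eps n) * (1 / (of_real x - Complex l (eps n)))) \<le> 1" for n
    proof (rule AE_I2)
      fix x
      have "cmod (1 / (of_real x - Complex l (eps n))) \<le> 1 / eps n"
        using cauchy_kernel_bound[of "Complex l (eps n)" x] eps_pos[of n] by simp
      hence "eps n * cmod (1 / (of_real x - Complex l (eps n))) \<le> eps n * (1 / eps n)"
        using eps_pos[of n] by (intro mult_left_mono) auto
      thus "norm (of_real (eps n) * (1 / (of_real x - Complex l (eps n)))) \<le> 1"
        using eps_pos[of n] by (simp only: norm_mult norm_of_real) simp
    qed
    show "(\<lambda>x. of_real (eps n) * (1 / (of_real x - Complex l (eps n)))) \<in> borel_measurable M" for n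
    proof -
      have "(\<lambda>x. 1 / (of_real x - Complex l (eps n))) \<in> borel_measurable M"
        using eps_pos[of n] by (intro borel_measurable_integrable integrable_cauchy_kernel) auto
      thus ?thesis by (intro borel_measurable_times borel_measurable_const)
    qed
  qed auto
  thus ?thesis unfolding stieltjes_def
    by (simp only: integral_mult_right_zero integral_of_real Bochner_Integration.integral_indicator space_eq_univ) simp
qed

text \<open>Im H / eps is the integral of 1 / ((x - l)^2 + eps^2), which increases as eps decreases.
  If it stays bounded, there is no atom at \<open>l\<close>, monotone convergence makes 1 / (x -
  l)^2 integrable, and this function dominates the difference quotients in the first-order
  expansion.\<close>

lemma (in real_distribution) stieltjes_boundary_regular:
  "boundary_regular (\<lambda>n. stieltjes M (Complex l (eps n)))" (is "boundary_regular ?H")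
  "mass (\<lambda>n. stieltjes M (Complex l (eps n))) = prob {l}"
proof -
  define g where "g n x = 1 / ((x - l)\<^sup>2 + (eps n)\<^sup>2)" for n x
  have pos: "0 < (x - l)\<^sup>2 + (eps n)\<^sup>2" for n x using eps_pos[of n] by (simp add: add_nonneg_pos)
  have g: "integrable M (g n)" "Im (?H n) / eps n = (\<integral>x. g n x \<partial>M)" for n
  proof -
    have e: "eps n \<noteq> 0" using eps_pos[of n] by simp
    have "integrable M (\<lambda>x. eps n / ((x - l)\<^sup>2 + (eps n)\<^sup>2) / eps n)"
      using Im_stieltjes(2)[of "Complex l (eps n)"] e by (intro Bochner_Integration.integrable_divide) simp
    thus "integrable M (g n)" using e by (simp add: g_def[abs_def])
    show "Im (?H n) / eps n = (\<integral>x. g n x \<partial>M)"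
      using Im_stieltjes(1)[of "Complex l (eps n)"] e
      by (simp add: g_def integral_divide_zero[symmetric] del: integral_divide_zero)
  qed
  have Hpos: "0 < Im (?H n)" for n
  proof -
    have "(\<integral>x. g n x \<partial>M) > 0"
    proof (rule ccontr)
      assume "\<not> ?thesis"
      moreover have "0 \<le> (\<integral>x. g n x \<partial>M)" using pos by (intro Bochner_Integration.integral_nonneg) (simp add: g_def less_imp_le)
      ultimately have "(\<integral>x. g n x \<partial>M) = 0" by linarith
      moreover have "AE x in M. 0 \<le> g n x" using pos by (simp add: g_def less_imp_le)
      ultimately have "AE x in M. g n x = 0"
        using integral_nonneg_eq_0_iff_AE[OF g(1)] by blast
      moreover have "g n x \<noteq> 0" for x using pos[of x n] unfolding g_def by auto
      ultimately have "AE x in M. False" by simp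
      thus False by simp
    qed
    hence "0 < Im (?H n) / eps n" using g(2)[of n] by simp
    thus ?thesis using eps_pos[of n] by (simp only: zero_less_divide_iff) auto
  qed
  have inc: "incseq (\<lambda>n. Im (?H n) / eps n)"
    unfolding g(2)
  proof (rule incseq_SucI, rule integral_mono[OF g(1) g(1)])
    show "g n x \<le> g (Suc n) x" for n x
      unfolding g_def using eps_antimono[of n "Suc n"] eps_pos[of "Suc n"] pos[of x]
      by (intro divide_left_mono add_left_mono power_mono) (auto intro: mult_pos_pos)
  qed
  have atom: "(\<lambda>n. of_real (eps n) * ?H n) \<longlonglongrightarrow> \<i> * of_real (prob {l})" by (rule stieltjes_atom)
  have "(\<lambda>n. eps n * Im (?H n)) \<longlonglongrightarrow> prob {l}" using tendsto_Im[OF atom] by simp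
  thus mass: "mass ?H = prob {l}" unfolding mass_def by (rule limI)
  have "\<exists>r a. (\<lambda>n. (?H n - of_real r) / of_real (eps n)) \<longlonglongrightarrow> \<i> * of_real a" if fin: "slope_finite ?H"
  proof -
    obtain B :: nat where B: "\<And>n. Im (?H n) / eps n \<le> B" using fin by (auto simp: slope_finite_def)
    have "prob {l} = 0"
    proof -
      have "prob {l} \<le> 0"
      proof (rule LIMSEQ_le[OF \<open>(\<lambda>n. eps n * Im (?H n)) \<longlonglongrightarrow> prob {l}\<close>])
        show "(\<lambda>n. eps n * eps n * B) \<longlonglongrightarrow> 0"
          using tendsto_mult[OF tendsto_mult[OF eps_tendsto eps_tendsto] tendsto_const[of "real B"]] by simp
        have "eps n * Im (?H n) \<le> eps n * eps n * B" for n
          using B[of n] eps_pos[of n] by (simp add: field_simps)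
        thus "\<exists>N. \<forall>n\<ge>N. eps n * Im (?H n) \<le> eps n * eps n * B" by blast
      qed
      thus ?thesis by (simp add: measure_le_0_iff)
    qed
    hence AE_l: "AE x in M. x \<noteq> l"
      using AE_iff_measurable[of "{l}" M "\<lambda>x. x \<noteq> l"] by (simp add: emeasure_eq_measure)
    define u where "u x = 1 / (x - l)\<^sup>2" for x
    have "convergent (\<lambda>n. \<integral>x. g n x \<partial>M)"
      using inc B unfolding g(2) by (metis incseq_convergent convergentI)
    then obtain a where a: "(\<lambda>n. \<integral>x. g n x \<partial>M) \<longlonglongrightarrow> a" by (auto simp: convergent_def)
    have u: "integrable M u"
    proof (rule integrable_monotone_convergence[OF g(1) _ _ a])
      show "AE x in M. mono (\<lambda>n. g n x)"
      proof (rule AE_I2, rule incseq_SucI)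
        show "g n x \<le> g (Suc n) x" for n x
          unfolding g_def using eps_antimono[of n "Suc n"] eps_pos[of "Suc n"] pos[of x]
          by (intro divide_left_mono add_left_mono power_mono) (auto intro: mult_pos_pos)
      qed
      show "AE x in M. (\<lambda>n. g n x) \<longlonglongrightarrow> u x"
        using AE_l
      proof eventually_elim
        case (elim x)
        have "(\<lambda>n. g n x) \<longlonglongrightarrow> 1 / ((x - l)\<^sup>2 + 0\<^sup>2)"
          unfolding g_def by (intro tendsto_intros eps_tendsto) (use elim in auto)
        thus ?case by (simp add: u_def)
      qed
      show "u \<in> borel_measurable M" unfolding u_def[abs_def] by measurable
    qed
    have v: "integrable M (\<lambda>x. 1 / (x - l))"
    proof (rule Bochner_Integration.integrable_bound[of M "\<lambda>x. 1 + u x"])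
      show "AE x in M. norm (1 / (x - l)) \<le> norm (1 + u x)"
      proof (rule AE_I2)
        fix x
        have "\<bar>v\<bar> \<le> 1 + v\<^sup>2" for v :: real
        proof -
          have "0 \<le> (\<bar>v\<bar> - 1)\<^sup>2" by simp
          hence "2 * \<bar>v\<bar> \<le> 1 + v\<^sup>2" by (simp add: power2_diff)
          thus ?thesis by linarith
        qed
        from this[of "1 / (x - l)"] have "\<bar>1 / (x - l)\<bar> \<le> 1 + (1 / (x - l))\<^sup>2" .
        moreover have "0 \<le> 1 + u x" by (simp add: u_def)
        ultimately show "norm (1 / (x - l)) \<le> norm (1 + u x)" by (simp add: u_def power_divide)
      qed
    qed (use u in auto)
    define r where "r = (\<integral>x. 1 / (x - l) \<partial>M)"
    have vc: "integrable M (\<lambda>x. complex_of_real (1 / (x - l)))" by (rule integrable_of_real[OF v])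
    have r: "of_real r = (\<integral>x. complex_of_real (1 / (x - l)) \<partial>M)" unfolding r_def by (rule integral_of_real[OF v, symmetric])
    define F where "F n x = (1 / (of_real x - Complex l (eps n)) - of_real (1 / (x - l))) / of_real (eps n)" for n x
    have F_meas: "F n \<in> borel_measurable M" for n
    proof -
      have "integrable M (\<lambda>x. 1 / (of_real x - Complex l (eps n)))"
        using eps_pos[of n] by (intro integrable_cauchy_kernel) auto
      thus ?thesis unfolding F_def using vc by (intro borel_measurable_integrable Bochner_Integration.integrable_divide Bochner_Integration.integrable_diff)
    qed
    have F_eq: "F n x = \<i> / ((of_real x - (of_real l + \<i> * of_real (eps n))) * of_real (x - l))" if "x \<noteq> l" for n x
    proof -
      have C: "Complex l (eps n) = of_real l + \<i> * of_real (eps n)" by (simp add: complex_eq_iff)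
      define p where "p = complex_of_real x - (of_real l + \<i> * of_real (eps n))"
      define q where "q = complex_of_real (x - l)"
      have nz: "p \<noteq> 0" "q \<noteq> 0" "complex_of_real (eps n) \<noteq> 0"
        using that eps_pos[of n] by (auto simp: complex_eq_iff p_def q_def)
      have "q - p = \<i> * of_real (eps n)" by (simp add: p_def q_def)
      moreover have "F n x = (1 / p - 1 / q) / of_real (eps n)" unfolding F_def C p_def q_def by simp
      moreover have "1 / p - 1 / q = (q - p) / (p * q)" using nz by (simp add: diff_frac_eq)
      ultimately have "F n x = \<i> / (p * q)" using nz by simp
      thus ?thesis unfolding p_def q_def .
    qed
    have "(\<lambda>n. \<integral>x. F n x \<partial>M) \<longlonglongrightarrow> (\<integral>x. \<i> * of_real (u x) \<partial>M)"
    proof (rule integral_dominated_convergence[where w=u])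
      show "(\<lambda>x. \<i> * complex_of_real (u x)) \<in> borel_measurable M" unfolding u_def by measurable
      show "AE x in M. (\<lambda>n. F n x) \<longlonglongrightarrow> \<i> * of_real (u x)"
        using AE_l
      proof eventually_elim
        case (elim x)
        have "(\<lambda>n. F n x) \<longlonglongrightarrow> \<i> / ((of_real x - (of_real l + \<i> * of_real 0)) * of_real (x - l))"
          unfolding F_eq[OF elim] by (intro tendsto_intros eps_tendsto) (use elim in auto)
        thus ?case using elim by (simp add: u_def power2_eq_square)
      qed
      show "AE x in M. norm (F n x) \<le> u x" for n
        using AE_l
      proof eventually_elim
        case (elim x)
        have "\<bar>x - l\<bar> \<le> cmod (of_real x - (of_real l + \<i> * of_real (eps n)))"
          using abs_Re_le_cmod[of "of_real x - (of_real l + \<i> * of_real (eps n))"] by simp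
        hence "cmod (F n x) \<le> 1 / (\<bar>x - l\<bar> * \<bar>x - l\<bar>)"
          unfolding F_eq[OF elim] norm_divide norm_mult norm_of_real using elim
          by (intro frac_le mult_right_mono) (auto simp flip: power2_eq_square)
        thus ?case by (simp add: u_def power2_eq_square)
      qed
    qed (use F_meas u in auto)
    moreover have "(\<integral>x. F n x \<partial>M) = (?H n - of_real r) / of_real (eps n)" for n
    proof -
      have "integrable M (\<lambda>x. 1 / (of_real x - Complex l (eps n)))"
        using eps_pos[of n] by (intro integrable_cauchy_kernel) auto
      thus ?thesis unfolding F_def stieltjes_def r integral_divide_zero using vc
        by (subst Bochner_Integration.integral_diff) auto
    qed
    moreover have "(\<integral>x. \<i> * of_real (u x) \<partial>M) = \<i> * of_real (\<integral>x. u x \<partial>M)"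
      using u by (simp only: integral_mult_right_zero integral_of_real)
    ultimately show ?thesis by auto
  qed
  thus "boundary_regular ?H" unfolding boundary_regular_def using Hpos inc atom by blast
qed

lemma neg_inverse_ii: "- 1 / (\<i> * complex_of_real m) = \<i> * of_real (1 / m)"
  by (cases "m = 0") (simp_all add: field_simps)

lemma ii_of_real_nz: "0 < m \<Longrightarrow> \<i> * complex_of_real m \<noteq> 0"
  by simp

section \<open>One step of the resolvent recursion at a real boundary point\<close>

locale boundary_recursion =
  fixes g :: "nat \<Rightarrow> nat \<Rightarrow> complex" and k :: nat and H :: "nat \<Rightarrow> complex" and l :: real
  assumes g: "\<And>i. i < k \<Longrightarrow> boundary_regular (g i)"
    and H: "boundary_regular H"
    and rec: "\<And>n. H n = - 1 / (Complex l (eps n) + (\<Sum>i<k. g i n))"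
begin

lemma Complex_eps: "Complex l (eps n) = of_real l + \<i> * of_real (eps n)"
  by (simp add: complex_eq_iff)

lemma Complex_eps_tendsto: "(\<lambda>n. Complex l (eps n)) \<longlonglongrightarrow> of_real l"
  using tendsto_add[OF tendsto_const tendsto_mult[OF tendsto_const tendsto_of_real[OF eps_tendsto]], of "of_real l" \<i>]
  by (simp add: Complex_eps)

abbreviation w :: "nat \<Rightarrow> complex" where "w n \<equiv> Complex l (eps n) + (\<Sum>i<k. g i n)"

lemma Im_w: "Im (w n) = eps n + (\<Sum>i<k. Im (g i n))" by simp

lemma Im_g_nonneg: "0 \<le> (\<Sum>i<k. Im (g i n))"
  by (intro sum_nonneg less_imp_le boundary_regular_Im g) auto

lemma w_nz: "w n \<noteq> 0"
proof -
  have "0 < Im (w n)" using eps_pos[of n] Im_g_nonneg[of n] unfolding Im_w by linarith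
  thus ?thesis by (metis less_irrefl zero_complex.simps(2))
qed

lemma w_H: "w n = - 1 / H n"
  using w_nz[of n] by (simp add: rec)

lemma H_nz: "H n \<noteq> 0"
  using boundary_regular_Im[OF H, of n] by (metis less_irrefl zero_complex.simps(2))

lemma Im_H: "Im (H n) / eps n = (cmod (H n))\<^sup>2 * (1 + (\<Sum>i<k. Im (g i n) / eps n))"
proof -
  have "Im (H n) = (cmod (H n))\<^sup>2 * Im (w n)" unfolding rec by (rule Im_neg_inverse_cmod)
  thus ?thesis using eps_pos[of n] unfolding Im_w
    by (simp add: add_divide_distrib sum_divide_distrib[symmetric] distrib_left)
qed

lemma w_mass: "(\<lambda>n. of_real (eps n) * w n) \<longlonglongrightarrow> \<i> * of_real (\<Sum>i<k. mass (g i))"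
proof -
  have "(\<lambda>n. of_real (eps n) * Complex l (eps n) + (\<Sum>i<k. of_real (eps n) * g i n)) \<longlonglongrightarrow>
      of_real 0 * of_real l + (\<Sum>i<k. \<i> * of_real (mass (g i)))"
    by (intro tendsto_add tendsto_mult tendsto_of_real eps_tendsto Complex_eps_tendsto tendsto_sum
        boundary_regular_mass g) auto
  thus ?thesis by (simp add: distrib_left sum_distrib_left)
qed

text \<open>A massive child makes the denominator grow like i M / eps, where M is the total mass of
  the children; so H behaves like i eps / M.\<close>

lemma plus_child:
  assumes M: "0 < (\<Sum>i<k. mass (g i))"
  shows "slope_finite H" "bval H = 0" "slope H = 1 / (\<Sum>i<k. mass (g i))" "mass H = 0"
proof -
  let ?M = "\<Sum>i<k. mass (g i)"
  have "(\<lambda>n. - 1 / (of_real (eps n) * w n)) \<longlonglongrightarrow> - 1 / (\<i> * of_real ?M)"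
    by (intro tendsto_divide tendsto_const w_mass ii_of_real_nz M)
  moreover have "- 1 / (of_real (eps n) * w n) = H n / of_real (eps n)" for n
    unfolding rec by simp
  ultimately have L: "(\<lambda>n. H n / of_real (eps n)) \<longlonglongrightarrow> \<i> * of_real (1 / ?M)"
    by (simp only: neg_inverse_ii)
  have "(\<lambda>n. Im (H n) / eps n) \<longlonglongrightarrow> 1 / ?M" using tendsto_Im[OF L] by (simp only: Im_divide_of_real) simp
  from slope_finiteI[OF H this] show sf: "slope_finite H" "slope H = 1 / ?M" .
  show "mass H = 0" using boundary_regular_slope_finite(5)[OF H sf(1)] .
  have "H \<longlonglongrightarrow> 0" using tendsto_mult_eps[OF L] .
  hence "of_real (bval H) = (0::complex)"
    using boundary_regular_slope_finite(2)[OF H sf(1)] LIMSEQ_unique by blast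
  thus "bval H = 0" by simp
qed

lemma bounded_slope_imp_children:
  assumes "(\<lambda>n. 1 + (\<Sum>i<k. Im (g i n) / eps n)) \<longlonglongrightarrow> b" "i < k"
  shows "slope_finite (g i)"
proof -
  obtain B where B: "\<And>n. norm (1 + (\<Sum>i<k. Im (g i n) / eps n)) \<le> B"
    using convergent_imp_Bseq[OF convergentI[OF assms(1)]] by (auto simp: Bseq_def)
  obtain N :: nat where N: "B \<le> N" using real_arch_simple by blast
  have "Im (g i n) / eps n \<le> N" for n
  proof -
    have nn: "0 \<le> Im (g j n) / eps n" if "j < k" for j
      using boundary_regular_Im[OF g[OF that], of n] eps_pos[of n] by simp
    have "Im (g i n) / eps n \<le> (\<Sum>i<k. Im (g i n) / eps n)"
      by (rule member_le_sum) (use assms(2) nn in auto)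
    also have "\<dots> \<le> B" using B[of n] by simp
    finally show ?thesis using N by linarith
  qed
  thus ?thesis by (auto simp: slope_finite_def)
qed

lemma children_slopes:
  assumes "\<And>i. i < k \<Longrightarrow> slope_finite (g i)"
  shows "(\<lambda>n. 1 + (\<Sum>i<k. Im (g i n) / eps n)) \<longlonglongrightarrow> 1 + (\<Sum>i<k. slope (g i))"
    "w \<longlonglongrightarrow> of_real (l + (\<Sum>i<k. bval (g i)))"
    "(\<lambda>n. (w n - of_real (l + (\<Sum>i<k. bval (g i)))) / of_real (eps n)) \<longlonglongrightarrow> \<i> * of_real (1 + (\<Sum>i<k. slope (g i)))"
    "(\<Sum>i<k. mass (g i)) = 0" "0 \<le> (\<Sum>i<k. slope (g i))"
proof -
  have sg: "(\<lambda>n. (g i n - of_real (bval (g i))) / of_real (eps n)) \<longlonglongrightarrow> \<i> * of_real (slope (g i))"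
    "g i \<longlonglongrightarrow> of_real (bval (g i))" "(\<lambda>n. Im (g i n) / eps n) \<longlonglongrightarrow> slope (g i)"
    "0 < slope (g i)" "mass (g i) = 0" if "i < k" for i
    using boundary_regular_slope_finite[OF g[OF that] assms[OF that]] by auto
  show "(\<lambda>n. 1 + (\<Sum>i<k. Im (g i n) / eps n)) \<longlonglongrightarrow> 1 + (\<Sum>i<k. slope (g i))"
    by (intro tendsto_intros sg) auto
  have "w \<longlonglongrightarrow> of_real l + (\<Sum>i<k. of_real (bval (g i)))"
    by (intro tendsto_intros Complex_eps_tendsto sg) auto
  thus "w \<longlonglongrightarrow> of_real (l + (\<Sum>i<k. bval (g i)))" by simp
  have "(\<lambda>n. \<i> + (\<Sum>i<k. (g i n - of_real (bval (g i))) / of_real (eps n))) \<longlonglongrightarrow> \<i> + (\<Sum>i<k. \<i> * of_real (slope (g i)))"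
    by (intro tendsto_intros sg) auto
  moreover have "\<i> + (\<Sum>i<k. (g i n - of_real (bval (g i))) / of_real (eps n)) =
      (w n - of_real (l + (\<Sum>i<k. bval (g i)))) / of_real (eps n)" for n
    using eps_pos[of n] by (simp add: Complex_eps sum_divide_distrib[symmetric] sum_subtractf add_divide_distrib diff_divide_distrib)
  ultimately show "(\<lambda>n. (w n - of_real (l + (\<Sum>i<k. bval (g i)))) / of_real (eps n)) \<longlonglongrightarrow> \<i> * of_real (1 + (\<Sum>i<k. slope (g i)))"
    by (simp add: distrib_left sum_distrib_left)
  show "(\<Sum>i<k. mass (g i)) = 0" using sg by (intro sum.neutral) auto
  show "0 \<le> (\<Sum>i<k. slope (g i))" using sg by (intro sum_nonneg) (auto intro: less_imp_le)
qed

text \<open>The boundary value of H cannot be 0: then H would be O(eps) while eps * w tends to 0,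
  against w * H = -1. Once it is non-zero, \<open>Im_H\<close> can be divided by |H|^2, which
  isolates the slopes of the children.\<close>

lemma slope_finite_children:
  assumes M: "(\<Sum>i<k. mass (g i)) = 0" and sf: "slope_finite H"
  shows "\<And>i. i < k \<Longrightarrow> slope_finite (g i)" "l + (\<Sum>i<k. bval (g i)) \<noteq> 0"
    "bval H = - 1 / (l + (\<Sum>i<k. bval (g i)))"
    "slope H = (bval H)\<^sup>2 * (1 + (\<Sum>i<k. slope (g i)))"
proof -
  note HH = boundary_regular_slope_finite[OF H sf]
  have r: "bval H \<noteq> 0"
  proof
    assume "bval H = 0"
    hence "(\<lambda>n. H n / of_real (eps n)) \<longlonglongrightarrow> \<i> * of_real (slope H)" using HH(1) by simp
    hence "(\<lambda>n. (of_real (eps n) * w n) * (H n / of_real (eps n))) \<longlonglongrightarrow> (\<i> * of_real 0) * (\<i> * of_real (slope H))"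
      by (rule tendsto_mult[OF w_mass[unfolded M]])
    moreover have "(of_real (eps n) * w n) * (H n / of_real (eps n)) = - 1" for n
      using eps_pos[of n] H_nz[of n] unfolding w_H by simp
    ultimately have "(\<lambda>n. - 1) \<longlonglongrightarrow> (0::complex)" by (simp only:) simp
    thus False using LIMSEQ_unique[OF tendsto_const[of "- 1 :: complex"]] by fastforce
  qed
  have "(\<lambda>n. (Im (H n) / eps n) / (cmod (H n))\<^sup>2) \<longlonglongrightarrow> slope H / (cmod (of_real (bval H)))\<^sup>2"
    using r by (intro tendsto_intros HH) auto
  hence lim: "(\<lambda>n. 1 + (\<Sum>i<k. Im (g i n) / eps n)) \<longlonglongrightarrow> slope H / (bval H)\<^sup>2"
    unfolding Im_H using H_nz by simp
  show sg: "\<And>i. i < k \<Longrightarrow> slope_finite (g i)" by (rule bounded_slope_imp_children[OF lim])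
  from children_slopes(1)[OF this] have "slope H / (bval H)\<^sup>2 = 1 + (\<Sum>i<k. slope (g i))"
    using lim LIMSEQ_unique by blast
  thus "slope H = (bval H)\<^sup>2 * (1 + (\<Sum>i<k. slope (g i)))" using r by (simp add: field_simps)
  have "(\<lambda>n. w n * H n) \<longlonglongrightarrow> of_real (l + (\<Sum>i<k. bval (g i))) * of_real (bval H)"
    by (intro tendsto_mult HH children_slopes sg)
  moreover have "w n * H n = - 1" for n unfolding w_H using H_nz by simp
  ultimately have "(\<lambda>n. - 1) \<longlonglongrightarrow> complex_of_real ((l + (\<Sum>i<k. bval (g i))) * bval H)"
    by (simp only: of_real_mult)
  hence "complex_of_real ((l + (\<Sum>i<k. bval (g i))) * bval H) = - 1"
    using LIMSEQ_unique[OF tendsto_const[of "- 1 :: complex"]] by metis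
  hence e: "(l + (\<Sum>i<k. bval (g i))) * bval H = - 1"
    by (metis of_real_eq_iff of_real_minus of_real_1)
  thus "l + (\<Sum>i<k. bval (g i)) \<noteq> 0" by auto
  with e show "bval H = - 1 / (l + (\<Sum>i<k. bval (g i)))" by (simp add: field_simps)
qed

lemma children_slope_finite:
  assumes sg: "\<And>i. i < k \<Longrightarrow> slope_finite (g i)" and nz: "l + (\<Sum>i<k. bval (g i)) \<noteq> 0"
  shows "slope_finite H"
proof -
  have "H \<longlonglongrightarrow> - 1 / of_real (l + (\<Sum>i<k. bval (g i)))"
    unfolding rec using nz by (intro tendsto_intros children_slopes(2)[OF sg]) (auto simp del: of_real_add)
  hence "(\<lambda>n. Im (H n) / eps n) \<longlonglongrightarrow> (cmod (- 1 / of_real (l + (\<Sum>i<k. bval (g i)))))\<^sup>2 * (1 + (\<Sum>i<k. slope (g i)))"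
    unfolding Im_H by (intro tendsto_mult tendsto_power tendsto_norm children_slopes(1) sg)
  thus ?thesis by (rule slope_finiteI(1)[OF H])
qed

text \<open>An atom means that eps * H tends to i m, so w / eps tends to i / m. The denominator thus
  vanishes to first order, and its imaginary part collects the slopes.\<close>

lemma mass_pos_imp:
  assumes m: "0 < mass H"
  shows "\<And>i. i < k \<Longrightarrow> slope_finite (g i)" "l + (\<Sum>i<k. bval (g i)) = 0"
    "mass H = 1 / (1 + (\<Sum>i<k. slope (g i)))"
proof -
  have nz: "\<i> * of_real (mass H) \<noteq> 0" using m by simp
  have "(\<lambda>n. - 1 / (of_real (eps n) * H n)) \<longlonglongrightarrow> - 1 / (\<i> * of_real (mass H))"
    by (intro tendsto_divide tendsto_const boundary_regular_mass(1)[OF H] nz)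
  moreover have "- 1 / (of_real (eps n) * H n) = w n / of_real (eps n)" for n
    unfolding w_H by simp
  ultimately have L: "(\<lambda>n. w n / of_real (eps n)) \<longlonglongrightarrow> \<i> * of_real (1 / mass H)"
    by (simp only: neg_inverse_ii)
  have "Im (w n / of_real (eps n)) = 1 + (\<Sum>i<k. Im (g i n) / eps n)" for n
    using eps_pos[of n] by (simp only: Im_divide_of_real Im_w) (simp add: add_divide_distrib sum_divide_distrib)
  hence lim: "(\<lambda>n. 1 + (\<Sum>i<k. Im (g i n) / eps n)) \<longlonglongrightarrow> 1 / mass H"
    using tendsto_Im[OF L] by simp
  show sg: "\<And>i. i < k \<Longrightarrow> slope_finite (g i)" by (rule bounded_slope_imp_children[OF lim])
  have "1 / mass H = 1 + (\<Sum>i<k. slope (g i))"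
    using lim children_slopes(1)[OF sg] LIMSEQ_unique by blast
  thus "mass H = 1 / (1 + (\<Sum>i<k. slope (g i)))" by (metis div_by_1 divide_divide_eq_right mult_1)
  have "complex_of_real (l + (\<Sum>i<k. bval (g i))) = 0"
    using tendsto_mult_eps[OF L] children_slopes(2)[OF sg] LIMSEQ_unique by blast
  thus "l + (\<Sum>i<k. bval (g i)) = 0" by (simp only: of_real_eq_0_iff)
qed

lemma mass_posI:
  assumes sg: "\<And>i. i < k \<Longrightarrow> slope_finite (g i)" and z: "l + (\<Sum>i<k. bval (g i)) = 0"
  shows "0 < mass H"
proof -
  let ?a = "1 + (\<Sum>i<k. slope (g i))"
  have a: "0 < ?a" using children_slopes(5)[OF sg] by linarith
  have "(\<lambda>n. w n / of_real (eps n)) \<longlonglongrightarrow> \<i> * of_real ?a"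
    using children_slopes(3)[OF sg] z by (simp del: of_real_add)
  hence "(\<lambda>n. - 1 / (w n / of_real (eps n))) \<longlonglongrightarrow> - 1 / (\<i> * of_real ?a)"
    by (intro tendsto_divide tendsto_const ii_of_real_nz a)
  moreover have "- 1 / (w n / of_real (eps n)) = of_real (eps n) * H n" for n
    using H_nz[of n] eps_pos[of n] unfolding w_H by simp
  ultimately have "- 1 / (\<i> * of_real ?a) = \<i> * of_real (mass H)"
    using boundary_regular_mass(1)[OF H] LIMSEQ_unique by fastforce
  hence "\<i> * of_real (1 / ?a) = \<i> * of_real (mass H)" by (simp only: neg_inverse_ii)
  hence "1 / ?a = mass H" by (simp only: mult_cancel_left of_real_eq_iff complex_i_not_zero) simp
  moreover have "0 < 1 / ?a" using a by simp
  ultimately show ?thesis by simp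
qed

end

section \<open>Adjacency operators of bounded degree\<close>

definition nrm2 :: "'v set \<Rightarrow> ('v \<Rightarrow> complex) \<Rightarrow> real" where
  "nrm2 V f = (\<Sum>\<^sub>\<infinity>x\<in>V. (cmod (f x))\<^sup>2)"

lemma ell2_norm_nrm2: "ell2_norm V f = sqrt (nrm2 V f)"
  by (simp add: ell2_norm_def nrm2_def)

lemma nrm2_nonneg: "0 \<le> nrm2 V f"
  unfolding nrm2_def by (rule infsum_nonneg) simp

lemma ell2_summable: "f \<in> ell2 V \<Longrightarrow> (\<lambda>x. (cmod (f x))\<^sup>2) summable_on V"
  by (simp add: ell2_def)

lemma ell2_outside: "f \<in> ell2 V \<Longrightarrow> x \<notin> V \<Longrightarrow> f x = 0"
  by (simp add: ell2_def)

lemma nrm2_finite_le: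
  assumes f: "f \<in> ell2 V" and F: "finite F"
  shows "(\<Sum>x\<in>F. (cmod (f x))\<^sup>2) \<le> nrm2 V f"
proof -
  have "(\<Sum>x\<in>F. (cmod (f x))\<^sup>2) = (\<Sum>x\<in>F \<inter> V. (cmod (f x))\<^sup>2)"
    using F ell2_outside[OF f] by (intro sum.mono_neutral_right) auto
  also have "\<dots> \<le> nrm2 V f" unfolding nrm2_def
    by (rule finite_sum_le_infsum[OF ell2_summable[OF f]]) (use F in auto)
  finally show ?thesis .
qed

lemma ell2I_finite:
  assumes "\<And>x. x \<notin> V \<Longrightarrow> f x = 0"
    and "\<And>F. finite F \<Longrightarrow> F \<subseteq> V \<Longrightarrow> (\<Sum>x\<in>F. (cmod (f x))\<^sup>2) \<le> B"
  shows "f \<in> ell2 V" "nrm2 V f \<le> B"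
proof -
  have s: "(\<lambda>x. (cmod (f x))\<^sup>2) summable_on V"
    by (rule nonneg_bdd_above_summable_on) (use assms(2) in \<open>auto intro!: bdd_aboveI2[where M=B]\<close>)
  thus "f \<in> ell2 V" using assms(1) by (simp add: ell2_def)
  show "nrm2 V f \<le> B" unfolding nrm2_def by (rule infsum_le_finite_sums[OF s]) (use assms in auto)
qed

lemma ell2_finite_support:
  assumes "\<And>x. x \<notin> V \<Longrightarrow> f x = 0" "finite {x. f x \<noteq> 0}"
  shows "f \<in> ell2 V"
proof (rule ell2I_finite[OF assms(1)])
  fix F assume "finite F" "F \<subseteq> V"
  have "(\<Sum>x\<in>F. (cmod (f x))\<^sup>2) = (\<Sum>x\<in>F \<inter> {x. f x \<noteq> 0}. (cmod (f x))\<^sup>2)"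
    using \<open>finite F\<close> by (intro sum.mono_neutral_right) auto
  also have "\<dots> \<le> (\<Sum>x\<in>{x. f x \<noteq> 0}. (cmod (f x))\<^sup>2)"
    using assms by (intro sum_mono2) auto
  finally show "(\<Sum>x\<in>F. (cmod (f x))\<^sup>2) \<le> (\<Sum>x\<in>{x. f x \<noteq> 0}. (cmod (f x))\<^sup>2)" .
qed auto

lemma cmod_add_sq_le: "(cmod (a + b))\<^sup>2 \<le> 2 * (cmod a)\<^sup>2 + 2 * (cmod b)\<^sup>2"
proof -
  have "(cmod (a + b))\<^sup>2 \<le> (cmod a + cmod b)\<^sup>2" by (intro power_mono norm_triangle_ineq) auto
  also have "\<dots> \<le> 2 * (cmod a)\<^sup>2 + 2 * (cmod b)\<^sup>2"
    using sum_squares_bound[of "cmod a" "cmod b"] by (simp add: power2_sum)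
  finally show ?thesis .
qed

lemma ell2_lincomb:
  assumes f: "f \<in> ell2 V" and g: "g \<in> ell2 V"
  shows "(\<lambda>x. a * f x + b * g x) \<in> ell2 V"
proof (rule ell2I_finite(1)[where B = "2 * ((cmod a)\<^sup>2 * nrm2 V f) + 2 * ((cmod b)\<^sup>2 * nrm2 V g)"])
  fix F :: "'a set" assume F: "finite F"
  have "(\<Sum>x\<in>F. (cmod (a * f x + b * g x))\<^sup>2) \<le> (\<Sum>x\<in>F. 2 * (cmod (a * f x))\<^sup>2 + 2 * (cmod (b * g x))\<^sup>2)"
    by (intro sum_mono cmod_add_sq_le)
  also have "\<dots> = 2 * ((cmod a)\<^sup>2 * (\<Sum>x\<in>F. (cmod (f x))\<^sup>2)) + 2 * ((cmod b)\<^sup>2 * (\<Sum>x\<in>F. (cmod (g x))\<^sup>2))"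
    by (simp add: norm_mult power_mult_distrib sum.distrib sum_distrib_left)
  also have "\<dots> \<le> 2 * ((cmod a)\<^sup>2 * nrm2 V f) + 2 * ((cmod b)\<^sup>2 * nrm2 V g)"
    by (intro add_mono mult_left_mono nrm2_finite_le f g F) auto
  finally show "(\<Sum>x\<in>F. (cmod (a * f x + b * g x))\<^sup>2) \<le> 2 * ((cmod a)\<^sup>2 * nrm2 V f) + 2 * ((cmod b)\<^sup>2 * nrm2 V g)" .
qed (use ell2_outside[OF f] ell2_outside[OF g] in auto)

lemma ell2_diff: "f \<in> ell2 V \<Longrightarrow> g \<in> ell2 V \<Longrightarrow> (\<lambda>x. f x - g x) \<in> ell2 V"
  using ell2_lincomb[of f V g 1 "-1"] by simp

lemma nrm2_eq_0: "f \<in> ell2 V \<Longrightarrow> nrm2 V f = 0 \<Longrightarrow> f = (\<lambda>x. 0)"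
  using nrm2_finite_le[of f V "{x}" for x] by fastforce

lemma ell2_norm_tendsto_pointwise:
  assumes "\<And>n. (\<lambda>x. F n x - f x) \<in> ell2 V" "(\<lambda>n. ell2_norm V (\<lambda>x. F n x - f x)) \<longlonglongrightarrow> 0"
  shows "(\<lambda>n. F n x) \<longlonglongrightarrow> f x"
proof -
  have "norm (F n x - f x) \<le> ell2_norm V (\<lambda>x. F n x - f x)" for n
    using nrm2_finite_le[OF assms(1), of "{x}" n] by (simp add: ell2_norm_nrm2 real_le_rsqrt)
  hence "(\<lambda>n. F n x - f x) \<longlonglongrightarrow> 0"
    by (intro Lim_null_comparison[OF _ assms(2)]) auto
  thus ?thesis by (simp add: Lim_null[symmetric])
qed

lemma ell2_truncate:
  assumes f: "f \<in> ell2 V" and e: "0 < e"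
  shows "\<exists>S. finite S \<and> S \<subseteq> V \<and> nrm2 V (\<lambda>x. (if x \<in> S then f x else 0) - f x) \<le> e"
proof -
  have "((\<lambda>x. (cmod (f x))\<^sup>2) has_sum nrm2 V f) V"
    unfolding nrm2_def using ell2_summable[OF f] by simp
  hence "eventually (\<lambda>S. dist (\<Sum>x\<in>S. (cmod (f x))\<^sup>2) (nrm2 V f) < e) (finite_subsets_at_top V)"
    unfolding has_sum_def using e by (rule tendstoD)
  then obtain S where S: "finite S" "S \<subseteq> V" "nrm2 V f - (\<Sum>x\<in>S. (cmod (f x))\<^sup>2) < e"
    unfolding eventually_finite_subsets_at_top by (auto simp: dist_real_def)
  have "nrm2 V (\<lambda>x. (if x \<in> S then f x else 0) - f x) \<le> e"
  proof (rule ell2I_finite(2))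
    fix F assume F: "finite F" "F \<subseteq> V"
    have "(\<Sum>x\<in>F. (cmod ((if x \<in> S then f x else 0) - f x))\<^sup>2) = (\<Sum>x\<in>F - S. (cmod (f x))\<^sup>2)"
      using F by (intro sum.mono_neutral_cong_right) auto
    also have "\<dots> = (\<Sum>x\<in>F \<union> S. (cmod (f x))\<^sup>2) - (\<Sum>x\<in>S. (cmod (f x))\<^sup>2)"
      using F S by (subst sum_diff[symmetric]) (auto intro: sum.cong)
    also have "\<dots> \<le> e" using nrm2_finite_le[OF f, of "F \<union> S"] F S by auto
    finally show "(\<Sum>x\<in>F. (cmod ((if x \<in> S then f x else 0) - f x))\<^sup>2) \<le> e" .
  qed (use ell2_outside[OF f] in auto)
  with S show ?thesis by blast
qed

locale bounded_graph =
  fixes V :: "'v set" and nb :: "'v \<Rightarrow> 'v set" and D :: nat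
  assumes nb_finite: "finite (nb x)" and nb_card: "card (nb x) \<le> D"
    and nb_sym: "y \<in> nb x \<Longrightarrow> x \<in> nb y" and nb_V: "nb x \<subseteq> V"
begin

definition adj :: "('v \<Rightarrow> complex) \<Rightarrow> 'v \<Rightarrow> complex" where
  "adj f x = (\<Sum>y\<in>nb x. f y)"

lemma adj_outside: "x \<notin> V \<Longrightarrow> adj f x = 0"
  using nb_sym nb_V unfolding adj_def by (intro sum.neutral) blast

lemma adj_diff: "adj (\<lambda>x. f x - g x) x = adj f x - adj g x"
  by (simp add: adj_def sum_subtractf)

lemma nb_double_sum:
  assumes F: "finite F" and f: "f \<in> ell2 V"
  shows "(\<Sum>x\<in>F. \<Sum>y\<in>nb x. (cmod (f y))\<^sup>2) \<le> real D * nrm2 V f"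
proof -
  define W where "W = (\<Union>x\<in>F. nb x)"
  have W: "finite W" using F nb_finite by (simp add: W_def)
  have "(\<Sum>x\<in>F. \<Sum>y\<in>nb x. (cmod (f y))\<^sup>2) = (\<Sum>x\<in>F. \<Sum>y\<in>{y\<in>W. y \<in> nb x}. (cmod (f y))\<^sup>2)"
    by (intro sum.cong refl) (auto simp: W_def)
  also have "\<dots> = (\<Sum>y\<in>W. \<Sum>x\<in>{x\<in>F. y \<in> nb x}. (cmod (f y))\<^sup>2)"
    by (rule sum.swap_restrict[OF F W])
  also have "\<dots> \<le> (\<Sum>y\<in>W. real D * (cmod (f y))\<^sup>2)"
  proof (rule sum_mono)
    fix y
    have "card {x\<in>F. y \<in> nb x} \<le> card (nb y)" using nb_sym nb_finite by (intro card_mono) auto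
    hence "card {x\<in>F. y \<in> nb x} \<le> D" using nb_card[of y] by linarith
    thus "(\<Sum>x\<in>{x\<in>F. y \<in> nb x}. (cmod (f y))\<^sup>2) \<le> real D * (cmod (f y))\<^sup>2"
      by (simp add: mult_right_mono)
  qed
  also have "\<dots> \<le> real D * nrm2 V f"
    unfolding sum_distrib_left[symmetric] by (intro mult_left_mono nrm2_finite_le f W) auto
  finally show ?thesis .
qed

text \<open>One factor D comes from Cauchy-Schwarz over the neighbours of a vertex, the other from
  counting how often a vertex occurs as a neighbour.\<close>

lemma adj_bounded:
  assumes f: "f \<in> ell2 V"
  shows "adj f \<in> ell2 V" "nrm2 V (adj f) \<le> (real D)\<^sup>2 * nrm2 V f"
proof -
  have "(\<Sum>x\<in>F. (cmod (adj f x))\<^sup>2) \<le> (real D)\<^sup>2 * nrm2 V f" if F: "finite F" for F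
  proof -
    have "(cmod (adj f x))\<^sup>2 \<le> real D * (\<Sum>y\<in>nb x. (cmod (f y))\<^sup>2)" for x
    proof -
      have "cmod (adj f x) \<le> (\<Sum>y\<in>nb x. cmod (f y))" unfolding adj_def by (rule norm_sum)
      hence "(cmod (adj f x))\<^sup>2 \<le> (\<Sum>y\<in>nb x. 1 * cmod (f y))\<^sup>2" by (intro power_mono) auto
      also have "\<dots> \<le> (\<Sum>y\<in>nb x. 1\<^sup>2) * (\<Sum>y\<in>nb x. (cmod (f y))\<^sup>2)" by (rule Cauchy_Schwarz_ineq_sum)
      also have "\<dots> \<le> real D * (\<Sum>y\<in>nb x. (cmod (f y))\<^sup>2)"
        using nb_card[of x] by (intro mult_right_mono sum_nonneg) auto
      finally show ?thesis .
    qed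
    hence "(\<Sum>x\<in>F. (cmod (adj f x))\<^sup>2) \<le> real D * (\<Sum>x\<in>F. \<Sum>y\<in>nb x. (cmod (f y))\<^sup>2)"
      unfolding sum_distrib_left by (intro sum_mono) (auto simp: sum_distrib_left)
    also have "\<dots> \<le> real D * (real D * nrm2 V f)" by (intro mult_left_mono nb_double_sum F f) auto
    finally show ?thesis by (simp add: power2_eq_square mult.assoc)
  qed
  note fin = this
  show "adj f \<in> ell2 V" by (rule ell2I_finite(1)[OF adj_outside fin])
  show "nrm2 V (adj f) \<le> (real D)\<^sup>2 * nrm2 V f" by (rule ell2I_finite(2)[OF adj_outside fin])
qed

text \<open>Exchange of two infinite sums. The kernel is absolutely summable since |f x| |g y| \<le>
  |f x|^2 + |g y|^2 and every vertex has at most D neighbours.\<close>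

lemma adj_symmetric:
  assumes f: "f \<in> ell2 V" and g: "g \<in> ell2 V"
  shows "ell2_inner V f (adj g) = ell2_inner V (adj f) g"
proof -
  define K where "K x y = (if y \<in> nb x then cnj (f x) * g y else 0)" for x y
  have Kbound: "(\<Sum>(x,y)\<in>F. cmod (K x y)) \<le> real D * nrm2 V f + real D * nrm2 V g"
    if F: "finite F" for F
  proof -
    define A where "A = fst ` F" define B where "B = snd ` F"
    have AB: "finite A" "finite B" "F \<subseteq> A \<times> B" using F by (force simp: A_def B_def)+
    have "(\<Sum>(x,y)\<in>F. cmod (K x y)) \<le> (\<Sum>(x,y)\<in>A \<times> B. cmod (K x y))"
      using AB by (intro sum_mono2) auto
    also have "\<dots> = (\<Sum>x\<in>A. \<Sum>y\<in>B. cmod (K x y))" by (simp add: sum.cartesian_product)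
    also have "\<dots> \<le> (\<Sum>x\<in>A. \<Sum>y\<in>B. if y \<in> nb x then (cmod (f x))\<^sup>2 + (cmod (g y))\<^sup>2 else 0)"
    proof (intro sum_mono)
      fix x y
      have "cmod (f x) * cmod (g y) \<le> (cmod (f x))\<^sup>2 + (cmod (g y))\<^sup>2"
      proof -
        have "0 \<le> cmod (f x) * cmod (g y)" by simp
        thus ?thesis using sum_squares_bound[of "cmod (f x)" "cmod (g y)"] by linarith
      qed
      thus "cmod (K x y) \<le> (if y \<in> nb x then (cmod (f x))\<^sup>2 + (cmod (g y))\<^sup>2 else 0)"
        by (simp add: K_def norm_mult)
    qed
    also have "\<dots> = (\<Sum>x\<in>A. \<Sum>y\<in>B. if y \<in> nb x then (cmod (f x))\<^sup>2 else 0) +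
        (\<Sum>x\<in>A. \<Sum>y\<in>B. if y \<in> nb x then (cmod (g y))\<^sup>2 else 0)"
      unfolding sum.distrib[symmetric] by (intro sum.cong) auto
    also have "(\<Sum>x\<in>A. \<Sum>y\<in>B. if y \<in> nb x then (cmod (f x))\<^sup>2 else 0) =
        (\<Sum>y\<in>B. \<Sum>x\<in>A. if y \<in> nb x then (cmod (f x))\<^sup>2 else 0)" by (rule sum.swap)
    also have "\<dots> \<le> (\<Sum>y\<in>B. \<Sum>x\<in>nb y. (cmod (f x))\<^sup>2)"
    proof (intro sum_mono)
      fix y
      have "(\<Sum>x\<in>A. if y \<in> nb x then (cmod (f x))\<^sup>2 else 0) = (\<Sum>x\<in>{x\<in>A. y \<in> nb x}. (cmod (f x))\<^sup>2)"
        using AB by (subst sum.inter_filter) auto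
      also have "\<dots> \<le> (\<Sum>x\<in>nb y. (cmod (f x))\<^sup>2)" using nb_sym nb_finite by (intro sum_mono2) auto
      finally show "(\<Sum>x\<in>A. if y \<in> nb x then (cmod (f x))\<^sup>2 else 0) \<le> (\<Sum>x\<in>nb y. (cmod (f x))\<^sup>2)" .
    qed
    also have "\<dots> \<le> real D * nrm2 V f" by (rule nb_double_sum[OF AB(2) f])
    also have "(\<Sum>x\<in>A. \<Sum>y\<in>B. if y \<in> nb x then (cmod (g y))\<^sup>2 else 0) \<le> (\<Sum>x\<in>A. \<Sum>y\<in>nb x. (cmod (g y))\<^sup>2)"
    proof (intro sum_mono)
      fix x
      have "(\<Sum>y\<in>B. if y \<in> nb x then (cmod (g y))\<^sup>2 else 0) = (\<Sum>y\<in>{y\<in>B. y \<in> nb x}. (cmod (g y))\<^sup>2)"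
        using AB by (subst sum.inter_filter) auto
      also have "\<dots> \<le> (\<Sum>y\<in>nb x. (cmod (g y))\<^sup>2)" using nb_finite by (intro sum_mono2) auto
      finally show "(\<Sum>y\<in>B. if y \<in> nb x then (cmod (g y))\<^sup>2 else 0) \<le> (\<Sum>y\<in>nb x. (cmod (g y))\<^sup>2)" .
    qed
    also have "\<dots> \<le> real D * nrm2 V g" by (rule nb_double_sum[OF AB(1) g])
    finally show ?thesis by simp
  qed
  have "(\<lambda>p. norm (case p of (x,y) \<Rightarrow> K x y)) summable_on V \<times> V"
    by (rule nonneg_bdd_above_summable_on)
       (use Kbound in \<open>auto simp: case_prod_unfold intro!: bdd_aboveI2[where M="real D * nrm2 V f + real D * nrm2 V g"]\<close>)
  hence "(\<lambda>(x,y). K x y) summable_on V \<times> V" by (rule Infinite_Sum.abs_summable_summable)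
  hence swap: "(\<Sum>\<^sub>\<infinity>x\<in>V. \<Sum>\<^sub>\<infinity>y\<in>V. K x y) = (\<Sum>\<^sub>\<infinity>y\<in>V. \<Sum>\<^sub>\<infinity>x\<in>V. K x y)" by (rule infsum_swap_banach)
  have 1: "(\<Sum>\<^sub>\<infinity>y\<in>V. K x y) = cnj (f x) * adj g x" for x
  proof -
    have "(\<Sum>\<^sub>\<infinity>y\<in>V. K x y) = (\<Sum>\<^sub>\<infinity>y\<in>nb x. K x y)"
      using nb_V by (intro infsum_cong_neutral) (auto simp: K_def)
    thus ?thesis using nb_finite by (simp add: K_def adj_def sum_distrib_left)
  qed
  have 2: "(\<Sum>\<^sub>\<infinity>x\<in>V. K x y) = cnj (adj f y) * g y" for y
  proof -
    have "(\<Sum>\<^sub>\<infinity>x\<in>V. K x y) = (\<Sum>\<^sub>\<infinity>x\<in>nb y. K x y)"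
      using nb_V nb_sym by (intro infsum_cong_neutral) (auto simp: K_def)
    also have "\<dots> = (\<Sum>x\<in>nb y. cnj (f x) * g y)"
      using nb_finite nb_sym by (auto simp: K_def intro!: sum.cong)
    finally show ?thesis by (simp add: adj_def sum_distrib_right)
  qed
  show ?thesis using swap unfolding 1 2 by (simp add: ell2_inner_def)
qed

definition adj_finite :: "'v operator" where
  "adj_finite = {(f, adj f) | f. (\<forall>x. x \<notin> V \<longrightarrow> f x = 0) \<and> finite {y. f y \<noteq> 0}}"

text \<open>Norm limits are pointwise limits and \<open>adj\<close> is a finite sum at each vertex,
  so the closure can contain nothing else; truncations of \<open>f\<close>, with the boundedness of
  \<open>adj\<close>, reach every vector.\<close>

lemma closure_adj_finite: "op_closure V adj_finite = {(f, adj f) | f. f \<in> ell2 V}"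
proof (intro set_eqI iffI)
  fix p assume "p \<in> op_closure V adj_finite"
  then obtain f g F G where p: "p = (f, g)" and fg: "f \<in> ell2 V" "g \<in> ell2 V"
    and FG: "\<And>n. (F n, G n) \<in> adj_finite"
    and lim: "(\<lambda>n. ell2_norm V (\<lambda>x. F n x - f x)) \<longlonglongrightarrow> 0" "(\<lambda>n. ell2_norm V (\<lambda>x. G n x - g x)) \<longlonglongrightarrow> 0"
    by (auto simp: op_closure_def)
  have F: "F n \<in> ell2 V" "G n = adj (F n)" for n
    using FG[of n] by (auto simp: adj_finite_def intro: ell2_finite_support)
  have G: "G n \<in> ell2 V" for n using adj_bounded(1)[OF F(1)] F(2) by simp
  have Ff: "(\<lambda>n. F n x) \<longlonglongrightarrow> f x" for x
    by (rule ell2_norm_tendsto_pointwise[OF ell2_diff[OF F(1) fg(1)] lim(1)])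
  have "(\<lambda>n. G n x) \<longlonglongrightarrow> g x" for x
    by (rule ell2_norm_tendsto_pointwise[OF ell2_diff[OF G fg(2)] lim(2)])
  moreover have "(\<lambda>n. G n x) \<longlonglongrightarrow> adj f x" for x
    unfolding F(2) adj_def by (intro tendsto_sum Ff)
  ultimately have "g = adj f" using LIMSEQ_unique by blast
  thus "p \<in> {(f, adj f) | f. f \<in> ell2 V}" using p fg by auto
next
  fix p assume "p \<in> {(f, adj f) | f. f \<in> ell2 V}"
  then obtain f where p: "p = (f, adj f)" and f: "f \<in> ell2 V" by auto
  have "\<forall>n. \<exists>S. finite S \<and> S \<subseteq> V \<and> nrm2 V (\<lambda>x. (if x \<in> S then f x else 0) - f x) \<le> 1 / real (Suc n)"
    by (intro allI ell2_truncate f) auto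
  then obtain S where S: "\<And>n. finite (S n)" "\<And>n. S n \<subseteq> V"
    "\<And>n. nrm2 V (\<lambda>x. (if x \<in> S n then f x else 0) - f x) \<le> 1 / real (Suc n)" by metis
  define F where "F n x = (if x \<in> S n then f x else 0)" for n x
  have Fa: "(F n, adj (F n)) \<in> adj_finite" for n
    unfolding adj_finite_def using S(1,2)[of n] by (auto simp: F_def intro: finite_subset[of _ "S n"])
  have Fe: "F n \<in> ell2 V" for n
    by (rule ell2_finite_support) (use Fa[of n] in \<open>auto simp: adj_finite_def\<close>)
  have n0: "(\<lambda>n. nrm2 V (\<lambda>x. F n x - f x)) \<longlonglongrightarrow> 0"
    by (rule tendsto_sandwich[OF _ _ tendsto_const LIMSEQ_Suc[OF lim_1_over_n]])
       (use S nrm2_nonneg[of V] in \<open>auto simp: F_def\<close>)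
  have lim1: "(\<lambda>n. ell2_norm V (\<lambda>x. F n x - f x)) \<longlonglongrightarrow> 0"
    using tendsto_real_sqrt[OF n0] by (simp add: ell2_norm_nrm2)
  have "(\<lambda>n. nrm2 V (\<lambda>x. adj (F n) x - adj f x)) \<longlonglongrightarrow> 0"
  proof (rule tendsto_sandwich[OF _ _ tendsto_const])
    show "eventually (\<lambda>n. 0 \<le> nrm2 V (\<lambda>x. adj (F n) x - adj f x)) sequentially" by (simp add: nrm2_nonneg)
    show "eventually (\<lambda>n. nrm2 V (\<lambda>x. adj (F n) x - adj f x) \<le> (real D)\<^sup>2 * nrm2 V (\<lambda>x. F n x - f x)) sequentially"
      using adj_bounded(2)[OF ell2_diff[OF Fe f]] unfolding adj_diff[abs_def] by simp
    show "(\<lambda>n. (real D)\<^sup>2 * nrm2 V (\<lambda>x. F n x - f x)) \<longlonglongrightarrow> 0" using tendsto_mult[OF tendsto_const n0] by simp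
  qed
  hence lim2: "(\<lambda>n. ell2_norm V (\<lambda>x. adj (F n) x - adj f x)) \<longlonglongrightarrow> 0"
    using tendsto_real_sqrt by (force simp: ell2_norm_nrm2)
  have "\<exists>F G. (\<forall>n. (F n, G n) \<in> adj_finite) \<and> (\<lambda>n. ell2_norm V (\<lambda>x. F n x - f x)) \<longlonglongrightarrow> 0 \<and>
      (\<lambda>n. ell2_norm V (\<lambda>x. G n x - adj f x)) \<longlonglongrightarrow> 0"
    by (rule exI[of _ F], rule exI[of _ "\<lambda>n. adj (F n)"]) (simp add: Fa lim1 lim2)
  thus "p \<in> op_closure V adj_finite"
    unfolding op_closure_def p using f adj_bounded(1)[OF f] by simp
qed

lemma inner_basis_right:
  assumes "x \<in> V"
  shows "ell2_inner V f (basis_vec x) = cnj (f x)"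
proof -
  have "ell2_inner V f (basis_vec x) = (\<Sum>\<^sub>\<infinity>y\<in>{x}. cnj (f y) * basis_vec x y)"
    unfolding ell2_inner_def using assms by (intro infsum_cong_neutral) (auto simp: basis_vec_def)
  thus ?thesis by (simp add: basis_vec_def)
qed

lemma inner_basis_left:
  assumes "x \<in> V"
  shows "ell2_inner V (basis_vec x) f = f x"
proof -
  have "ell2_inner V (basis_vec x) f = (\<Sum>\<^sub>\<infinity>y\<in>{x}. cnj (basis_vec x y) * f y)"
    unfolding ell2_inner_def using assms by (intro infsum_cong_neutral) (auto simp: basis_vec_def)
  thus ?thesis by (simp add: basis_vec_def)
qed

text \<open>Everywhere defined and symmetric gives one inclusion; testing against
  \<open>basis_vec x\<close> identifies each pair of the adjoint coordinate by coordinate.\<close>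

lemma self_adjoint_closure: "essentially_self_adjoint V adj_finite"
  unfolding essentially_self_adjoint_def self_adjoint_def closure_adj_finite
proof (intro set_eqI iffI)
  fix p assume "p \<in> op_adjoint V {(f, adj f) | f. f \<in> ell2 V}"
  then obtain f g where p: "p = (f, g)" and fg: "f \<in> ell2 V" "g \<in> ell2 V"
    and sym: "\<And>h. h \<in> ell2 V \<Longrightarrow> ell2_inner V f (adj h) = ell2_inner V g h"
    by (auto simp: op_adjoint_def)
  have "g x = adj f x" for x
  proof (cases "x \<in> V")
    case True
    have b: "basis_vec x \<in> ell2 V"
      by (rule ell2_finite_support) (use True in \<open>auto simp: basis_vec_def\<close>)
    have "cnj (g x) = ell2_inner V f (adj (basis_vec x))"
      using sym[OF b] inner_basis_right[OF True, of g] by simp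
    also have "\<dots> = ell2_inner V (adj f) (basis_vec x)" by (rule adj_symmetric[OF fg(1) b])
    finally show ?thesis using inner_basis_right[OF True, of "adj f"] by (metis complex_cnj_cancel_iff)
  next
    case False
    thus ?thesis using ell2_outside[OF fg(2)] adj_outside by simp
  qed
  thus "p \<in> {(f, adj f) | f. f \<in> ell2 V}" using p fg by auto
next
  fix p assume "p \<in> {(f, adj f) | f. f \<in> ell2 V}"
  thus "p \<in> op_adjoint V {(f, adj f) | f. f \<in> ell2 V}"
    by (auto simp: op_adjoint_def adj_bounded adj_symmetric)
qed

lemma inner_self:
  assumes "f \<in> ell2 V"
  shows "ell2_inner V f f = of_real (nrm2 V f)"
proof -
  have "((\<lambda>x. complex_of_real ((cmod (f x))\<^sup>2)) has_sum of_real (nrm2 V f)) V"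
    unfolding has_sum_of_real_iff nrm2_def using ell2_summable[OF assms] by simp
  moreover have "complex_of_real ((cmod (f x))\<^sup>2) = cnj (f x) * f x" for x
    using complex_norm_square[of "f x"] by (simp add: mult.commute)
  ultimately show ?thesis unfolding ell2_inner_def by (intro infsumI) simp
qed

text \<open>Symmetry forces eigenvalues to be real. This provides the uniqueness that the
  \<open>THE\<close> in \<open>resolvent\<close> asks for.\<close>

lemma eigen_zero:
  assumes f: "f \<in> ell2 V" and z: "Im z \<noteq> 0" and eq: "\<And>x. adj f x = z * f x"
  shows "f = (\<lambda>x. 0)"
proof -
  have adj: "adj f = (\<lambda>x. z * f x)" using eq by (rule ext)
  have "ell2_inner V f (adj f) = z * ell2_inner V f f"
    unfolding adj ell2_inner_def by (simp add: mult.left_commute infsum_cmult_right')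
  moreover have "ell2_inner V (adj f) f = cnj z * ell2_inner V f f"
    unfolding adj ell2_inner_def by (simp add: mult.assoc infsum_cmult_right')
  ultimately have "nrm2 V f = 0 \<or> z = cnj z"
    using adj_symmetric[OF f f] inner_self[OF f] by auto
  hence "nrm2 V f = 0" using z by (auto simp: complex_eq_iff)
  thus ?thesis using nrm2_eq_0[OF f] by simp
qed

lemma resolvent_closure:
  assumes f: "f \<in> ell2 V" and z: "Im z \<noteq> 0" and eq: "\<And>x. adj f x = b x + z * f x"
  shows "resolvent (op_closure V adj_finite) z b = f"
  unfolding resolvent_def closure_adj_finite
proof (rule the_equality)
  show "(f, \<lambda>x. b x + z * f x) \<in> {(f, adj f) | f. f \<in> ell2 V}" using f eq by (auto intro!: exI[of _ f])
  fix g assume "(g, \<lambda>x. b x + z * g x) \<in> {(f, adj f) | f. f \<in> ell2 V}"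
  hence g: "g \<in> ell2 V" "adj g = (\<lambda>x. b x + z * g x)" by auto
  have "(\<lambda>x. g x - f x) = (\<lambda>x. 0)"
    by (rule eigen_zero[OF ell2_diff[OF g(1) f] z]) (simp add: adj_diff eq g(2) right_diff_distrib)
  thus "g = f" by (metis eq_iff_diff_eq_0 ext)
qed

end

section \<open>The spectral measure of a tree\<close>

lemma Nil_in_tree [simp]: "[] \<in> tree_of_offspring c"
  by (simp add: tree_of_offspring_def)

lemma Cons_in_tree: "i # w \<in> tree_of_offspring c \<longleftrightarrow> i < c [] \<and> w \<in> tree_of_offspring (subtree c i)"
proof
  assume a: "i # w \<in> tree_of_offspring c"
  have 1: "\<And>u j v. i # w = u @ [j] @ v \<Longrightarrow> j < c u" using a unfolding tree_of_offspring_def by blast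
  have "i < c []" using 1[of "[]" i w] by simp
  moreover have "j < c (i # u)" if "w = u @ [j] @ v" for u j v using 1[of "i # u" j v] that by simp
  ultimately show "i < c [] \<and> w \<in> tree_of_offspring (subtree c i)"
    by (auto simp: tree_of_offspring_def subtree_def)
next
  assume a: "i < c [] \<and> w \<in> tree_of_offspring (subtree c i)"
  show "i # w \<in> tree_of_offspring c"
    unfolding tree_of_offspring_def
  proof (intro CollectI allI impI)
    fix u j v assume e: "i # w = u @ [j] @ v"
    show "j < c u"
    proof (cases u)
      case Nil
      then show ?thesis using a e by simp
    next
      case (Cons i' u')
      then show ?thesis using a e by (auto simp: tree_of_offspring_def subtree_def)
    qed
  qed
qed

lemma snoc_in_tree: "v @ [i] \<in> tree_of_offspring c \<longleftrightarrow> v \<in> tree_of_offspring c \<and> i < c v"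
proof (induction v arbitrary: c)
  case Nil
  then show ?case by (simp add: Cons_in_tree)
next
  case (Cons j v)
  then show ?case by (auto simp: Cons_in_tree subtree_def)
qed

definition tree_children :: "offspring \<Rightarrow> nat list \<Rightarrow> nat list set" where
  "tree_children c v = (\<lambda>i. v @ [i]) ` {..<c v}"

definition tree_nb :: "offspring \<Rightarrow> nat list \<Rightarrow> nat list set" where
  "tree_nb c v = (if v \<in> tree_of_offspring c
     then (if v = [] then {} else {butlast v}) \<union> tree_children c v else {})"

lemma tree_nb_iff: "y \<in> tree_nb c x \<longleftrightarrow>
    x \<in> tree_of_offspring c \<and> y \<in> tree_of_offspring c \<and> ((\<exists>i. y = x @ [i]) \<or> (\<exists>i. x = y @ [i]))"
proof (cases x rule: rev_exhaust)
  case Nil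
  then show ?thesis by (auto simp: tree_nb_def tree_children_def snoc_in_tree Cons_in_tree)
next
  case (snoc w j)
  then show ?thesis
    using snoc_in_tree[of "w @ [j]" _ c] by (auto simp: tree_nb_def tree_children_def snoc_in_tree)
qed

lemma tree_edge_iff: "{x, y} \<in> snd (tree_graph (tree_of_offspring c)) \<longleftrightarrow> y \<in> tree_nb c x"
proof -
  have *: "u @ [i] \<in> tree_of_offspring c \<Longrightarrow> u \<in> tree_of_offspring c" for u i
    by (simp add: snoc_in_tree)
  show ?thesis unfolding tree_nb_iff tree_graph_def
    by (auto simp: doubleton_eq_iff dest: *)
qed

lemma bounded_graph_tree:
  assumes c: "\<And>u. c u \<le> d"
  shows "bounded_graph (tree_of_offspring c) (tree_nb c) (Suc d)"
proof
  fix x y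
  show "finite (tree_nb c x)" by (simp add: tree_nb_def tree_children_def)
  have "card (tree_children c x) \<le> d"
    using card_image_le[of "{..<c x}" "\<lambda>i. x @ [i]"] c[of x] by (simp add: tree_children_def)
  thus "card (tree_nb c x) \<le> Suc d"
    using card_Un_le[of "if x = [] then {} else {butlast x}" "tree_children c x"]
    by (auto simp: tree_nb_def)
  show "y \<in> tree_nb c x \<Longrightarrow> x \<in> tree_nb c y" by (auto simp: tree_nb_iff)
  show "tree_nb c x \<subseteq> tree_of_offspring c" by (auto simp: tree_nb_iff)
qed

lemma tree_nb_sum:
  assumes "v \<in> tree_of_offspring c"
  shows "(\<Sum>y\<in>tree_nb c v. f y) = (if v = [] then 0 else f (butlast v)) + (\<Sum>i<c v. f (v @ [i]) :: complex)"
proof -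
  have disj: "(if v = [] then {} else {butlast v}) \<inter> tree_children c v = {}"
    by (auto simp: tree_children_def dest: arg_cong[where f=length])
  have "(\<Sum>y\<in>tree_children c v. f y) = (\<Sum>i<c v. f (v @ [i]))"
    unfolding tree_children_def by (subst sum.reindex) (auto simp: inj_on_def)
  moreover have "(\<Sum>y\<in>tree_nb c v. f y) = (\<Sum>y\<in>(if v = [] then {} else {butlast v}). f y) + (\<Sum>y\<in>tree_children c v. f y)"
    unfolding tree_nb_def using assms disj
    by (simp only: if_True, subst sum.union_disjoint) (auto simp: tree_children_def)
  ultimately show ?thesis by auto
qed

lemma adjacency_tree:
  assumes c: "\<And>u. c u \<le> d"
  shows "adjacency (tree_graph (tree_of_offspring c)) =
    bounded_graph.adj_finite (tree_of_offspring c) (tree_nb c)"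
proof -
  interpret bounded_graph "tree_of_offspring c" "tree_nb c" "Suc d" by (rule bounded_graph_tree[OF c])
  have "(\<Sum>y | f y \<noteq> 0. (if {x, y} \<in> snd (tree_graph (tree_of_offspring c)) then 1 else 0) * f y) = adj f x"
    if "finite {y. f y \<noteq> 0}" for f :: "nat list \<Rightarrow> complex" and x
    unfolding tree_edge_iff adj_def using that nb_finite[of x]
    by (intro sum.mono_neutral_cong) auto
  thus ?thesis
    unfolding adjacency_def adj_finite_def by (auto simp: case_prod_unfold tree_graph_def fun_eq_iff)
qed

section \<open>The Green function from the root\<close>

context degree_bound
begin

text \<open>The resolvent entry between the root and a vertex, factorized along the path: each step
  down contributes minus the root entry of the branch being left.\<close>

primrec green :: "complex \<Rightarrow> nat list \<Rightarrow> offspring \<Rightarrow> complex" where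
  "green z [] c = h c z"
| "green z (i # w) c = - h c z * green z w (subtree c i)"

definition green_fn :: "complex \<Rightarrow> offspring \<Rightarrow> nat list \<Rightarrow> complex" where
  "green_fn z c v = (if v \<in> tree_of_offspring c then green z v c else 0)"

lemma h_rec':
  assumes z: "0 < Im z" and c: "\<And>u. c u \<le> d"
  shows "h c z * (z + (\<Sum>i<c []. h (subtree c i) z)) = - 1"
proof -
  have k: "rdeg c = c []" using c by (simp add: rdeg_def)
  have "h c z \<noteq> 0" using h_Im_pos[OF z, of c] by auto
  thus ?thesis using h_rec[OF z, of c] unfolding k by (auto simp: divide_simps split: if_splits)
qed

text \<open>The equation (A - z) G = e_root, by induction along the path. Inside the branch of child
  \<open>i\<close> it is the equation of that branch scaled by \<open>- h c z\<close>; at the child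
  itself the scaled source term of the branch cancels the contribution of the parent.\<close>

lemma green_eq:
  assumes z: "0 < Im z" and c: "\<And>u. c u \<le> d" and v: "v \<in> tree_of_offspring c"
  shows "(if v = [] then 0 else green z (butlast v) c) + (\<Sum>i<c v. green z (v @ [i]) c) =
    (if v = [] then 1 else 0) + z * green z v c"
  using c v
proof (induction v arbitrary: c)
  case Nil
  have "(\<Sum>i<c []. green z ([] @ [i]) c) = - h c z * (\<Sum>i<c []. h (subtree c i) z)"
    by (simp add: sum_distrib_left)
  moreover have "z * h c z + h c z * (\<Sum>i<c []. h (subtree c i) z) = - 1"
    using h_rec'[of z c, OF z Nil(1)] by (simp add: distrib_left mult.commute)
  hence "h c z * (\<Sum>i<c []. h (subtree c i) z) = - 1 - z * h c z"
    by (simp only: eq_diff_eq add.commute)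
  ultimately show ?case by (simp only: mult_minus_left) simp
next
  case (Cons i w)
  have c': "\<And>u. subtree c i u \<le> d" using Cons.prems(1) by (simp add: subtree_def)
  have w: "w \<in> tree_of_offspring (subtree c i)" using Cons.prems(2) by (simp add: Cons_in_tree)
  note IH = Cons.IH[OF c' w]
  have s: "(\<Sum>j<c (i # w). green z ((i # w) @ [j]) c) = - h c z * (\<Sum>j<subtree c i w. green z (w @ [j]) (subtree c i))"
    by (simp add: sum_distrib_left subtree_def)
  show ?case
  proof (cases "w = []")
    case True
    then show ?thesis using IH unfolding s by (simp add: algebra_simps)
  next
    case False
    then have "green z (butlast (i # w)) c = - h c z * green z (butlast w) (subtree c i)" by simp
    moreover have "green z (butlast w) (subtree c i) + (\<Sum>j<subtree c i w. green z (w @ [j]) (subtree c i)) =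
        z * green z w (subtree c i)" using IH False by simp
    hence "- h c z * green z (butlast w) (subtree c i) + - h c z * (\<Sum>j<subtree c i w. green z (w @ [j]) (subtree c i)) =
        z * green z (i # w) c" by (simp only: distrib_left[symmetric] green.simps mult.left_commute)
    ultimately show ?thesis unfolding s by simp
  qed
qed

definition tree_level :: "nat \<Rightarrow> offspring \<Rightarrow> nat list set" where
  "tree_level n c = {v \<in> tree_of_offspring c. length v < n}"

lemma tree_level_Suc:
  "tree_level (Suc n) c = insert [] (\<Union>i<c []. (#) i ` tree_level n (subtree c i))"
proof -
  have "v \<in> tree_level (Suc n) c \<longleftrightarrow> v \<in> insert [] (\<Union>i<c []. (#) i ` tree_level n (subtree c i))" for v
    by (cases v) (auto simp: tree_level_def Cons_in_tree)
  thus ?thesis by blast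
qed

lemma finite_tree_level: "finite (tree_level n c)"
proof (induction n arbitrary: c)
  case 0
  then show ?case by (simp add: tree_level_def)
next
  case (Suc n)
  then show ?case by (simp add: tree_level_Suc)
qed

text \<open>A truncated Ward identity: the recursion gives Im h = |h|^2 * (Im z + sum of Im h over
  the children), which is what the induction over levels reproduces. The bound puts the Green
  function into \<open>ell2\<close>.\<close>

lemma green_level_bound:
  assumes z: "0 < Im z" and c: "\<And>u. c u \<le> d"
  shows "(\<Sum>v\<in>tree_level n c. (cmod (green z v c))\<^sup>2) \<le> Im (h c z) / Im z"
  using c
proof (induction n arbitrary: c)
  case 0
  then show ?case using h_Im_pos[OF z, of c] z by (simp add: tree_level_def)
next
  case (Suc n)
  have k: "rdeg c = c []" using Suc.prems by (simp add: rdeg_def)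
  have c': "\<And>i u. subtree c i u \<le> d" using Suc.prems by (simp add: subtree_def)
  have "(\<Sum>v\<in>tree_level (Suc n) c. (cmod (green z v c))\<^sup>2) =
      (cmod (h c z))\<^sup>2 + (\<Sum>v\<in>(\<Union>i<c []. (#) i ` tree_level n (subtree c i)). (cmod (green z v c))\<^sup>2)"
    unfolding tree_level_Suc by (subst sum.insert) (auto simp: finite_tree_level)
  also have "(\<Sum>v\<in>(\<Union>i<c []. (#) i ` tree_level n (subtree c i)). (cmod (green z v c))\<^sup>2) =
      (\<Sum>i<c []. \<Sum>v\<in>(#) i ` tree_level n (subtree c i). (cmod (green z v c))\<^sup>2)"
    by (rule sum.UNION_disjoint) (auto simp: finite_tree_level)
  also have "\<dots> = (\<Sum>i<c []. (cmod (h c z))\<^sup>2 * (\<Sum>w\<in>tree_level n (subtree c i). (cmod (green z w (subtree c i)))\<^sup>2))"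
    by (intro sum.cong refl, subst sum.reindex) (auto simp: norm_mult power_mult_distrib sum_distrib_left)
  also have "(cmod (h c z))\<^sup>2 + \<dots> \<le> (cmod (h c z))\<^sup>2 + (\<Sum>i<c []. (cmod (h c z))\<^sup>2 * (Im (h (subtree c i) z) / Im z))"
    by (intro add_left_mono sum_mono mult_left_mono Suc.IH c') auto
  also have "\<dots> = (cmod (h c z))\<^sup>2 * Im (z + (\<Sum>i<c []. h (subtree c i) z)) / Im z"
    using z by (simp add: sum_distrib_left[symmetric] sum_divide_distrib[symmetric] distrib_left add_divide_distrib)
  also have "\<dots> = Im (h c z) / Im z"
    using h_rec[OF z, of c] Im_neg_inverse_cmod[of "z + (\<Sum>i<c []. h (subtree c i) z)"] unfolding k by simp
  finally show ?case .
qed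

lemma green_fn_ell2:
  assumes z: "0 < Im z" and c: "\<And>u. c u \<le> d"
  shows "green_fn z c \<in> ell2 (tree_of_offspring c)"
proof (rule ell2I_finite(1))
  show "green_fn z c x = 0" if "x \<notin> tree_of_offspring c" for x using that by (simp add: green_fn_def)
  fix F assume F: "finite F" "F \<subseteq> tree_of_offspring c"
  obtain n where n: "\<And>v. v \<in> F \<Longrightarrow> length v < n"
    using F(1) finite_nat_set_iff_bounded[of "length ` F"] by auto
  have "(\<Sum>x\<in>F. (cmod (green_fn z c x))\<^sup>2) = (\<Sum>x\<in>F. (cmod (green z x c))\<^sup>2)"
    using F by (intro sum.cong) (auto simp: green_fn_def)
  also have "\<dots> \<le> (\<Sum>x\<in>tree_level n c. (cmod (green z x c))\<^sup>2)"
    using F n by (intro sum_mono2) (auto simp: finite_tree_level, auto simp: tree_level_def)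
  also have "\<dots> \<le> Im (h c z) / Im z" by (rule green_level_bound[OF z c])
  finally show "(\<Sum>x\<in>F. (cmod (green_fn z c x))\<^sup>2) \<le> Im (h c z) / Im z" .
qed

lemma resolvent_tree:
  assumes z: "0 < Im z" and c: "\<And>u. c u \<le> d"
  defines "V \<equiv> tree_of_offspring c"
  shows "ell2_inner V (basis_vec []) (resolvent (op_closure V (adjacency (tree_graph V))) z (basis_vec [])) = h c z"
    "ell2_inner V (basis_vec []) (resolvent (op_closure V (adjacency (tree_graph V))) (cnj z) (basis_vec [])) = cnj (h c z)"
proof -
  interpret bounded_graph "tree_of_offspring c" "tree_nb c" "Suc d" by (rule bounded_graph_tree[OF c])
  let ?f = "green_fn z c"
  have f: "?f \<in> ell2 V" unfolding V_def by (rule green_fn_ell2[OF z c])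
  have eq: "adj ?f x = basis_vec [] x + z * ?f x" for x
  proof (cases "x \<in> tree_of_offspring c")
    case True
    have "(if x = [] then 0 else ?f (butlast x)) = (if x = [] then 0 else green z (butlast x) c)"
      using True by (cases x rule: rev_exhaust) (auto simp: green_fn_def snoc_in_tree)
    moreover have "(\<Sum>i<c x. ?f (x @ [i])) = (\<Sum>i<c x. green z (x @ [i]) c)"
      using True by (intro sum.cong) (auto simp: green_fn_def snoc_in_tree)
    ultimately have "adj ?f x = (if x = [] then 0 else green z (butlast x) c) + (\<Sum>i<c x. green z (x @ [i]) c)"
      unfolding adj_def tree_nb_sum[OF True] by simp
    also have "\<dots> = (if x = [] then 1 else 0) + z * green z x c"
      by (rule green_eq[OF z c True])
    finally show ?thesis using True by (simp add: green_fn_def basis_vec_def)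
  next
    case False
    hence "x \<noteq> []" by auto
    thus ?thesis using False adj_outside[OF False] by (simp add: green_fn_def basis_vec_def)
  qed
  have r: "resolvent (op_closure V (adjacency (tree_graph V))) z (basis_vec []) = ?f"
    unfolding V_def adjacency_tree[OF c]
    by (rule resolvent_closure) (use f z eq in \<open>auto simp: V_def\<close>)
  show "ell2_inner V (basis_vec []) (resolvent (op_closure V (adjacency (tree_graph V))) z (basis_vec [])) = h c z"
    unfolding r unfolding V_def by (subst inner_basis_left) (auto simp: green_fn_def)
  let ?g = "\<lambda>x. cnj (green_fn z c x)"
  have g: "?g \<in> ell2 V" using f by (simp add: ell2_def)
  have eq': "adj ?g x = basis_vec [] x + cnj z * ?g x" for x
  proof -
    have "adj ?g x = cnj (adj ?f x)" by (simp add: adj_def)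
    thus ?thesis unfolding eq by (simp add: basis_vec_def)
  qed
  have r': "resolvent (op_closure V (adjacency (tree_graph V))) (cnj z) (basis_vec []) = ?g"
    unfolding V_def adjacency_tree[OF c]
    by (rule resolvent_closure) (use g z eq' in \<open>auto simp: V_def\<close>)
  show "ell2_inner V (basis_vec []) (resolvent (op_closure V (adjacency (tree_graph V))) (cnj z) (basis_vec [])) = cnj (h c z)"
    unfolding r' unfolding V_def by (subst inner_basis_left) (auto simp: green_fn_def)
qed

text \<open>The Green function identifies the root resolvent entry with \<open>h\<close> in the
  upper half-plane and conjugation treats the lower one; \<open>stieltjes_unique\<close> justifies
  the \<open>THE\<close>.\<close>

lemma spectral_measure_tree:
  assumes c: "\<And>u. c u \<le> d" and M: "real_distribution M" "\<And>z. 0 < Im z \<Longrightarrow> h c z = stieltjes M z"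
  shows "spectral_measure (tree_graph (tree_of_offspring c)) [] = M"
proof -
  let ?V = "tree_of_offspring c"
  interpret bounded_graph "tree_of_offspring c" "tree_nb c" "Suc d" by (rule bounded_graph_tree[OF c])
  have sa: "self_adjoint_graph (tree_graph ?V)"
    unfolding self_adjoint_graph_def adjacency_tree[OF c] using self_adjoint_closure
    by (simp add: tree_graph_def)
  have V: "fst (tree_graph ?V) = ?V" by (simp add: tree_graph_def)
  have res: "ell2_inner ?V (basis_vec []) (resolvent (op_closure ?V (adjacency (tree_graph ?V))) z (basis_vec [])) =
      stieltjes M z" if z: "z \<notin> \<real>" for z
  proof (cases "0 < Im z")
    case True
    then show ?thesis using resolvent_tree(1)[OF True c] M(2) by simp
  next
    case False
    hence z': "0 < Im (cnj z)" using z by (auto simp: complex_is_Real_iff)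
    have "cnj (stieltjes M (cnj z)) = stieltjes M z" by (simp add: stieltjes_cnj)
    then show ?thesis using resolvent_tree(2)[OF z' c] M(2)[OF z'] by simp
  qed
  show ?thesis
    unfolding spectral_measure_def V using sa
  proof (simp, intro the_equality conjI allI impI)
    show "prob_space M" "sets M = sets borel"
      using M(1) by (auto simp: real_distribution_def real_distribution_axioms_def)
    show "ell2_inner ?V (basis_vec []) (resolvent (op_closure ?V (adjacency (tree_graph ?V))) z (basis_vec [])) =
        (\<integral>\<xi>. 1 / (complex_of_real \<xi> - z) \<partial>M)" if "z \<notin> \<real>" for z
      using res[OF that] by (simp add: stieltjes_def)
    fix N assume N: "prob_space N \<and> sets N = sets borel \<and> (\<forall>z. z \<notin> \<real> \<longrightarrow>
       ell2_inner ?V (basis_vec []) (resolvent (op_closure ?V (adjacency (tree_graph ?V))) z (basis_vec [])) =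
        (\<integral>\<xi>. 1 / (complex_of_real \<xi> - z) \<partial>N))"
    show "N = M"
    proof (rule stieltjes_unique)
      show "real_distribution N" using N by (simp add: real_distribution_def real_distribution_axioms_def)
      fix z :: complex assume "0 < Im z"
      hence "z \<notin> \<real>" by (auto simp: complex_is_Real_iff)
      thus "stieltjes N z = stieltjes M z" using N res by (simp add: stieltjes_def)
    qed (rule M(1))
  qed
qed

definition hseq :: "real \<Rightarrow> offspring \<Rightarrow> nat \<Rightarrow> complex" where
  "hseq l c n = h c (Complex l (eps n))"

lemma hseq_regular: "boundary_regular (hseq l c)"
proof -
  obtain M where M: "real_distribution M" "\<And>z. 0 < Im z \<Longrightarrow> h c z = stieltjes M z"
    using h_measure_exists by blast
  have "hseq l c = (\<lambda>n. stieltjes M (Complex l (eps n)))"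
    by (rule ext) (simp add: hseq_def M(2) eps_pos)
  thus ?thesis using real_distribution.stieltjes_boundary_regular(1)[OF M(1)] by simp
qed

lemma spectral_measure_atom:
  assumes c: "\<And>u. c u \<le> d"
  shows "emeasure (spectral_measure (tree_graph (tree_of_offspring c)) []) {l} = ennreal (mass (hseq l c))"
proof -
  obtain M where M: "real_distribution M" "\<And>z. 0 < Im z \<Longrightarrow> h c z = stieltjes M z"
    using h_measure_exists by blast
  interpret real_distribution M by (rule M(1))
  have "hseq l c = (\<lambda>n. stieltjes M (Complex l (eps n)))"
    by (rule ext) (simp add: hseq_def M(2) eps_pos)
  hence "mass (hseq l c) = prob {l}" using stieltjes_boundary_regular(2)[of l] by simp
  thus ?thesis using spectral_measure_tree[OF c M] by (simp add: emeasure_eq_measure)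
qed

lemma hseq_recursion:
  "boundary_recursion (\<lambda>i. hseq l (subtree c i)) (rdeg c) (hseq l c) l"
proof
  show "hseq l c n = - 1 / (Complex l (eps n) + (\<Sum>i<rdeg c. hseq l (subtree c i) n))" for n
    unfolding hseq_def by (rule h_rec) (simp add: eps_pos)
qed (rule hseq_regular)+

end

section \<open>Blocks and frontier\<close>

definition graft :: "nat \<Rightarrow> (nat \<Rightarrow> offspring) \<Rightarrow> nat list \<Rightarrow> nat" where
  "graft k s u = (case u of [] \<Rightarrow> k | i # w \<Rightarrow> s i w)"

lemma graft_simps [simp]: "graft k s [] = k" "subtree (graft k s) i = s i"
  by (auto simp: graft_def subtree_def)

definition skip :: "nat \<Rightarrow> nat \<Rightarrow> nat" where
  "skip i j = (if j < i then j else Suc j)"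

lemma bij_betw_skip: "i < k \<Longrightarrow> bij_betw (skip i) {..<k - 1} ({..<k} - {i})"
proof (rule bij_betwI')
  assume "i < k"
  show "\<exists>x\<in>{..<k - 1}. y = skip i x" if "y \<in> {..<k} - {i}" for y
    using that \<open>i < k\<close> by (intro bexI[of _ "if y < i then y else y - 1"]) (auto simp: skip_def)
qed (auto simp: skip_def)

lemma sum_skip: "i < k \<Longrightarrow> (\<Sum>j<k - 1. f (skip i j)) = (\<Sum>j\<in>{..<k} - {i}. f j)"
  by (rule sum.reindex_bij_betw[OF bij_betw_skip])

text \<open>\<open>prune c i\<close> and \<open>subtree c i\<close> are the two trees left when the
  edge from the root to child \<open>i\<close> is cut. The other children are renumbered so that
  they stay consecutive.\<close>

definition prune :: "offspring \<Rightarrow> nat \<Rightarrow> offspring" where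
  "prune c i = graft (c [] - 1) (\<lambda>j. subtree c (skip i j))"

section \<open>Rational functions attached to finite blocks\<close>

fun continued_sum :: "(real poly \<times> real poly) list \<Rightarrow> real poly \<times> real poly" where
  "continued_sum [] = ([:0, 1:], 1)"
| "continued_sum (p # xs) =
    (fst (continued_sum xs) * snd p - fst p * snd (continued_sum xs), snd (continued_sum xs) * snd p)"

text \<open>The fraction represents x - sum of P/Q without reduction. The growth of the degree keeps
  the numerator from being the zero polynomial, so that only finitely many points are excluded per
  list.\<close>

lemma continued_sum_degree:
  assumes "\<And>P Q. (P, Q) \<in> set xs \<Longrightarrow> Q \<noteq> 0 \<and> degree P \<le> degree Q"
  shows "snd (continued_sum xs) \<noteq> 0 \<and> degree (snd (continued_sum xs)) < degree (fst (continued_sum xs))"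
  using assms
proof (induction xs)
  case (Cons p xs)
  obtain P Q where p: "p = (P, Q)" by (cases p)
  define U V where "U = fst (continued_sum xs)" and "V = snd (continued_sum xs)"
  have UV: "V \<noteq> 0" "degree V < degree U" using Cons.IH Cons.prems by (auto simp: U_def V_def)
  have PQ: "Q \<noteq> 0" "degree P \<le> degree Q" using Cons.prems by (auto simp: p)
  have "U \<noteq> 0" using UV by auto
  hence 1: "degree (U * Q) = degree U + degree Q" using PQ by (simp add: degree_mult_eq)
  have "degree (P * V) \<le> degree P + degree V" by (rule degree_mult_le)
  hence "degree (P * V) < degree (U * Q)" using 1 UV PQ by linarith
  hence "degree (U * Q - P * V) = degree (U * Q)"
    by (metis degree_add_eq_left degree_minus diff_conv_add_uminus)
  moreover have "degree (V * Q) < degree (U * Q)" using 1 UV PQ by (simp add: degree_mult_eq)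
  ultimately show ?case using UV PQ by (simp add: p U_def V_def)
qed simp

lemma continued_sum_value:
  assumes "\<And>p. p \<in> set xs \<Longrightarrow> poly (snd p) x \<noteq> 0"
  shows "poly (snd (continued_sum xs)) x \<noteq> 0 \<and>
    x + (\<Sum>p\<leftarrow>xs. - poly (fst p) x / poly (snd p) x) = poly (fst (continued_sum xs)) x / poly (snd (continued_sum xs)) x"
  using assms
proof (induction xs)
  case (Cons p xs)
  define U V where "U = poly (fst (continued_sum xs)) x" and "V = poly (snd (continued_sum xs)) x"
  define s where "s = (\<Sum>q\<leftarrow>xs. - poly (fst q) x / poly (snd q) x)"
  have IH: "V \<noteq> 0" "x + s = U / V"
    unfolding U_def V_def s_def using Cons.IH Cons.prems by simp_all
  have Q: "poly (snd p) x \<noteq> 0" using Cons.prems by simp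
  have "x + (- poly (fst p) x / poly (snd p) x + s) = U / V - poly (fst p) x / poly (snd p) x"
    using IH(2) by simp
  also have "\<dots> = (U * poly (snd p) x - poly (fst p) x * V) / (V * poly (snd p) x)"
    by (rule diff_frac_eq[OF IH(1) Q])
  finally show ?case using IH(1) Q by (simp add: U_def V_def s_def)
qed simp

context degree_bound
begin

text \<open>The boundary values of finite blocks of depth at most \<open>D\<close>, as rational functions
  \<open>-P/Q\<close> of the spectral parameter.\<close>

primrec block_values :: "nat \<Rightarrow> (real poly \<times> real poly) set" where
  "block_values 0 = {(0, 1)}"
| "block_values (Suc D) = insert (0, 1)
    ((\<lambda>xs. (snd (continued_sum xs), fst (continued_sum xs))) ` {xs. set xs \<subseteq> block_values D \<and> length xs \<le> d})"

text \<open>A root is massive only where the spectral parameter plus the boundary values of its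
  children vanishes, hence at a zero of such a numerator. The pair \<open>(0, 1)\<close> stands for
  a child on the frontier, whose boundary value is 0.\<close>

definition block_eigenvalues :: "nat \<Rightarrow> real set" where
  "block_eigenvalues D = (\<Union>xs\<in>{xs. set xs \<subseteq> block_values D \<and> length xs \<le> d}. {x. poly (fst (continued_sum xs)) x = 0})"

lemma finite_block_values: "finite (block_values D)"
  by (induction D) (auto intro: finite_lists_length_le)

lemma block_values_degree: "(P, Q) \<in> block_values D \<Longrightarrow> Q \<noteq> 0 \<and> degree P \<le> degree Q"
proof (induction D arbitrary: P Q)
  case (Suc D)
  show ?case
  proof (cases "(P, Q) = (0, 1)")
    case False
    then obtain xs where xs: "set xs \<subseteq> block_values D" "P = snd (continued_sum xs)" "Q = fst (continued_sum xs)"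
      using Suc.prems by auto
    thus ?thesis using continued_sum_degree[of xs] Suc.IH by fastforce
  qed auto
qed auto

lemma finite_block_eigenvalues: "finite (block_eigenvalues D)"
  unfolding block_eigenvalues_def
proof (intro finite_UN_I finite_lists_length_le finite_block_values)
  fix xs assume "xs \<in> {xs. set xs \<subseteq> block_values D \<and> length xs \<le> d}"
  hence "fst (continued_sum xs) \<noteq> 0"
    using continued_sum_degree[of xs] block_values_degree by fastforce
  thus "finite {x. poly (fst (continued_sum xs)) x = 0}" by (rule poly_roots_finite)
qed

end

locale spectral_point = degree_bound d for d :: nat +
  fixes l :: real
begin

definition mu :: "offspring \<Rightarrow> real" where "mu c = mass (hseq l c)"
definition sf :: "offspring \<Rightarrow> bool" where "sf c \<longleftrightarrow> slope_finite (hseq l c)"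
definition sl :: "offspring \<Rightarrow> real" where "sl c = slope (hseq l c)"
definition bv :: "offspring \<Rightarrow> real" where "bv c = bval (hseq l c)"
text \<open>The masses are those of the children in their own branches, not inside \<open>c\<close>.
  By \<open>cmass_pos\<close> a positive value forces the boundary value 0 at the root, the mark of
  a frontier vertex.\<close>

definition cmass :: "offspring \<Rightarrow> real" where
  "cmass c = (\<Sum>i<rdeg c. mu (subtree c i))"

lemma mu_nonneg: "0 \<le> mu c"
  unfolding mu_def by (rule boundary_regular_mass(2)[OF hseq_regular])

lemma sf_imp: "sf c \<Longrightarrow> 0 < sl c" "sf c \<Longrightarrow> mu c = 0"
  unfolding sf_def sl_def mu_def using boundary_regular_slope_finite[OF hseq_regular] by auto

lemma cmass_nonneg: "0 \<le> cmass c"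
  unfolding cmass_def by (intro sum_nonneg mu_nonneg)

lemma cmass_pos:
  assumes "0 < cmass c"
  shows "sf c" "bv c = 0" "sl c = 1 / cmass c" "mu c = 0"
  using boundary_recursion.plus_child[OF hseq_recursion[of l c]] assms
  by (simp_all add: mu_def sf_def sl_def bv_def cmass_def)

lemma cmass_zero_sf:
  assumes "cmass c = 0" "sf c"
  shows "\<And>i. i < rdeg c \<Longrightarrow> sf (subtree c i)" "l + (\<Sum>i<rdeg c. bv (subtree c i)) \<noteq> 0"
    "bv c = - 1 / (l + (\<Sum>i<rdeg c. bv (subtree c i)))"
    "sl c = (bv c)\<^sup>2 * (1 + (\<Sum>i<rdeg c. sl (subtree c i)))"
  using boundary_recursion.slope_finite_children[OF hseq_recursion[of l c]] assms
  by (simp_all add: mu_def sf_def sl_def bv_def cmass_def)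

lemma sf_children_zero_mass: "(\<And>i. i < rdeg c \<Longrightarrow> sf (subtree c i)) \<Longrightarrow> cmass c = 0"
  unfolding cmass_def by (intro sum.neutral) (auto dest: sf_imp(2))

lemma sf_children:
  assumes "\<And>i. i < rdeg c \<Longrightarrow> sf (subtree c i)" "l + (\<Sum>i<rdeg c. bv (subtree c i)) \<noteq> 0"
  shows "sf c"
  using boundary_recursion.children_slope_finite[OF hseq_recursion[of l c]] assms
  by (simp add: sf_def bv_def)

lemma mu_pos:
  assumes "0 < mu c"
  shows "\<And>i. i < rdeg c \<Longrightarrow> sf (subtree c i)" "l + (\<Sum>i<rdeg c. bv (subtree c i)) = 0"
    "mu c = 1 / (1 + (\<Sum>i<rdeg c. sl (subtree c i)))"
  using boundary_recursion.mass_pos_imp[OF hseq_recursion[of l c]] assms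
  by (simp_all add: mu_def sf_def sl_def bv_def)

lemma mu_posI:
  assumes "\<And>i. i < rdeg c \<Longrightarrow> sf (subtree c i)" "l + (\<Sum>i<rdeg c. bv (subtree c i)) = 0"
  shows "0 < mu c"
  using boundary_recursion.mass_posI[OF hseq_recursion[of l c]] assms
  by (simp add: mu_def sf_def bv_def)

text \<open>Transport along an edge whose endpoints carry the trees \<open>t\<close> and \<open>t'\<close>; \<open>linked\<close> says that both
  endpoints carry mass at \<open>l\<close> in the joined tree and lie in the same block.\<close>

definition frontier_flow :: "offspring \<Rightarrow> offspring \<Rightarrow> real" where
  "frontier_flow t t' = (if 0 < cmass t \<and> 0 < mu t' then mu t' / (cmass t + mu t') else 0)"

definition linked :: "offspring \<Rightarrow> offspring \<Rightarrow> bool" where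
  "linked t t' \<longleftrightarrow> cmass t = 0 \<and> cmass t' = 0 \<and> sf t \<and> sf t' \<and> bv t * bv t' = 1"

definition block_flow :: "offspring \<Rightarrow> offspring \<Rightarrow> real" where
  "block_flow t t' = (if linked t t' then sl t / (sl t + (bv t)\<^sup>2 * sl t') else 0)"

text \<open>The part of a block contained in the branch: vertices on the first \<open>K\<close>
  levels that are reached without meeting the frontier. The cut-off keeps it finite on infinite
  blocks.\<close>

primrec bsize :: "nat \<Rightarrow> offspring \<Rightarrow> real" where
  "bsize 0 c = 0"
| "bsize (Suc K) c = (if 0 < cmass c then 0 else 1 + (\<Sum>i<rdeg c. bsize K (subtree c i)))"

definition size_flow :: "nat \<Rightarrow> offspring \<Rightarrow> offspring \<Rightarrow> real" where
  "size_flow K t t' = (if linked t t' then bsize K t / (bsize K t + bsize K t') else 0)"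

lemma linked_sym: "linked t t' = linked t' t"
  by (auto simp: linked_def mult.commute)

lemma bsize_nonneg: "0 \<le> bsize K c"
  by (induction K arbitrary: c) (auto intro!: sum_nonneg add_nonneg_nonneg)

lemma bsize_mono: "bsize K c \<le> bsize (Suc K) c"
proof (induction K arbitrary: c)
  case 0
  show ?case using bsize_nonneg[of "Suc 0" c] by (simp del: bsize.simps(2))
next
  case (Suc K)
  show ?case using Suc.IH by (auto intro!: sum_mono)
qed

lemma bsize_ge_1: "cmass c = 0 \<Longrightarrow> 1 \<le> bsize (Suc K) c"
  using bsize_nonneg by (auto intro: sum_nonneg)

text \<open>On a linked edge the two boundary values are reciprocal, which turns the opposite flow
  into the complementary fraction.\<close>

lemma block_flow_swap: "block_flow t t' + block_flow t' t = (if linked t t' then 1 else 0)"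
proof (cases "linked t t'")
  case True
  hence b: "bv t * bv t' = 1" and s: "0 < sl t" "0 < sl t'" by (auto simp: linked_def sf_imp)
  have bt: "bv t \<noteq> 0" using b by auto
  hence b': "bv t' = 1 / bv t" using b by (simp add: field_simps)
  have pos: "0 < sl t + (bv t)\<^sup>2 * sl t'" using s bt by (simp add: add_pos_pos)
  have "sl t' / (sl t' + (bv t')\<^sup>2 * sl t) = (bv t)\<^sup>2 * sl t' / (sl t + (bv t)\<^sup>2 * sl t')"
    using s bt pos by (simp add: b' power_divide divide_simps) (simp add: algebra_simps)
  thus ?thesis using True pos linked_sym[of t t']
    by (simp add: block_flow_def add_divide_distrib[symmetric])
qed (use linked_sym[of t t'] in \<open>simp add: block_flow_def\<close>)

text \<open>At depth 0 both sizes are 0 and the quotient is the default 0; from depth 1 on a linked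
  endpoint counts at least itself. The sum agrees with that of \<open>block_flow\<close>, which will
  make the two interchangeable in expectation.\<close>

lemma size_flow_swap: "size_flow (Suc K) t t' + size_flow (Suc K) t' t = (if linked t t' then 1 else 0)"
proof (cases "linked t t'")
  case True
  hence "1 \<le> bsize (Suc K) t" "1 \<le> bsize (Suc K) t'" by (auto simp: linked_def simp del: bsize.simps intro: bsize_ge_1)
  thus ?thesis using True linked_sym[of t t']
    by (simp add: size_flow_def add_divide_distrib[symmetric] add.commute del: bsize.simps)
qed (use linked_sym[of t t'] in \<open>simp add: size_flow_def\<close>)

text \<open>The frontier condition at the root. A single massive child branch is not enough: seen
  from that child, the rest of the tree has \<open>cmass\<close> 0 and no frontier flow crosses the
  edge.\<close>

definition two_massive :: "offspring \<Rightarrow> bool" where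
  "two_massive c \<longleftrightarrow> (\<exists>i<c []. \<exists>j<c []. i \<noteq> j \<and> 0 < mu (subtree c i) \<and> 0 < mu (subtree c j))"

context
  fixes c :: offspring
  assumes c: "c [] \<le> d"
begin

lemma rdeg_c: "rdeg c = c []" using c by (simp add: rdeg_def)

lemma rdeg_prune: "rdeg (prune c i) = c [] - 1" using c by (simp add: rdeg_def prune_def)

lemma sum_prune: "i < c [] \<Longrightarrow> (\<Sum>j<rdeg (prune c i). f (subtree (prune c i) j)) = (\<Sum>j\<in>{..<c []} - {i}. f (subtree c j))"
  unfolding rdeg_prune using sum_skip[of i "c []" "\<lambda>j. f (subtree c j)"] by (simp add: prune_def)

lemma sum_remove: "i < c [] \<Longrightarrow> (\<Sum>j<c []. f (subtree c j)) = f (subtree c i) + (\<Sum>j\<in>{..<c []} - {i}. f (subtree c j))"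
  for f :: "offspring \<Rightarrow> real"
  by (simp add: sum.remove)

lemma prune_children:
  assumes i: "i < c []"
  shows "(\<forall>j<rdeg (prune c i). P (subtree (prune c i) j)) \<longleftrightarrow> (\<forall>j<c []. j \<noteq> i \<longrightarrow> P (subtree c j))"
proof -
  have "(\<forall>j<rdeg (prune c i). P (subtree (prune c i) j)) \<longleftrightarrow> (\<forall>j\<in>{..<c [] - 1}. P (subtree c (skip i j)))"
    unfolding rdeg_prune by (auto simp: prune_def)
  also have "\<dots> \<longleftrightarrow> (\<forall>j\<in>skip i ` {..<c [] - 1}. P (subtree c j))" by simp
  also have "skip i ` {..<c [] - 1} = {..<c []} - {i}" using bij_betw_skip[OF i] by (simp add: bij_betw_def)
  finally show ?thesis by auto
qed

text \<open>At a massive root, \<open>l\<close> plus the boundary values of the children is 0; the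
  term of child \<open>i\<close> is moved to the other side. If it is 0, the child is on the
  frontier and \<open>prune c i\<close> is itself massive. Otherwise \<open>prune c i\<close> has
  the reciprocal boundary value and the edge is linked. In both cases the flow is the slope of the
  child times the mass of the root.\<close>

lemma massive_child:
  assumes m: "0 < mu c" and i: "i < c []"
  shows "0 < cmass (subtree c i) \<Longrightarrow> frontier_flow (subtree c i) (prune c i) = sl (subtree c i) * mu c"
    "0 < cmass (subtree c i) \<Longrightarrow> \<not> linked (subtree c i) (prune c i)"
    "cmass (subtree c i) = 0 \<Longrightarrow> linked (subtree c i) (prune c i)"
    "cmass (subtree c i) = 0 \<Longrightarrow> block_flow (subtree c i) (prune c i) = sl (subtree c i) * mu c"
    "cmass (prune c i) = 0"
proof -
  let ?t = "subtree c i" and ?p = "prune c i"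
  define A where "A = (\<Sum>j\<in>{..<c []} - {i}. sl (subtree c j))"
  define B where "B = (\<Sum>j\<in>{..<c []} - {i}. bv (subtree c j))"
  have sf: "\<And>j. j < c [] \<Longrightarrow> sf (subtree c j)" using mu_pos(1)[OF m] unfolding rdeg_c .
  have bsum: "l + (bv ?t + B) = 0"
    using mu_pos(2)[OF m] unfolding rdeg_c sum_remove[OF i] B_def .
  have mu: "mu c = 1 / (1 + (sl ?t + A))"
    using mu_pos(3)[OF m] unfolding rdeg_c sum_remove[OF i] A_def .
  have A: "0 \<le> A" unfolding A_def using sf sf_imp by (intro sum_nonneg) (auto intro: less_imp_le)
  have slt: "0 < sl ?t" using sf[OF i] sf_imp by blast
  have sfp: "\<And>j. j < rdeg ?p \<Longrightarrow> sf (subtree ?p j)"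
    using prune_children[OF i, of sf] sf by blast
  have sums: "(\<Sum>j<rdeg ?p. bv (subtree ?p j)) = B" "(\<Sum>j<rdeg ?p. sl (subtree ?p j)) = A"
    unfolding A_def B_def by (rule sum_prune[OF i])+
  show cm: "cmass ?p = 0" by (rule sf_children_zero_mass[OF sfp])
  {
    assume M: "0 < cmass ?t"
    note t = cmass_pos[OF M]
    have b0: "l + (\<Sum>j<rdeg ?p. bv (subtree ?p j)) = 0" using bsum t unfolding sums by simp
    have mp: "0 < mu ?p" by (rule mu_posI[OF sfp b0])
    have "mu ?p = 1 / (1 + A)" using mu_pos(3)[OF mp] unfolding sums .
    moreover have "1 / (1 + A) / (cmass ?t + 1 / (1 + A)) = 1 / cmass ?t * (1 / (1 + (1 / cmass ?t + A)))"
      using M A by (simp add: divide_simps add_nonneg_eq_0_iff) (simp add: algebra_simps)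
    ultimately show "frontier_flow ?t ?p = sl ?t * mu c"
      using M mp unfolding mu t(3) by (simp add: frontier_flow_def)
    show "\<not> linked ?t ?p" using M by (simp add: linked_def)
  next
    assume M: "cmass ?t = 0"
    have r0: "bv ?t \<noteq> 0" using cmass_zero_sf(2,3)[OF M sf[OF i]] by simp
    have lB: "l + B = - bv ?t" using bsum by linarith
    have nz: "l + (\<Sum>j<rdeg ?p. bv (subtree ?p j)) \<noteq> 0" using r0 unfolding sums lB by simp
    have sp: "sf ?p" by (rule sf_children[OF sfp nz])
    note p = cmass_zero_sf(3,4)[OF cm sp, unfolded sums lB]
    have bp: "bv ?p = 1 / bv ?t" using p(1) by simp
    show lk: "linked ?t ?p" unfolding linked_def using M cm sf[OF i] sp bp r0 by simp
    have "(bv ?t)\<^sup>2 * sl ?p = 1 + A" using p(2) r0 unfolding bp by (simp add: power_divide)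
    thus "block_flow ?t ?p = sl ?t * mu c" using lk unfolding block_flow_def mu by (simp add: add_ac)
  }
qed

text \<open>Either kind of flow would give all children finite slopes and a vanishing denominator at
  the root, which is the criterion \<open>mu_posI\<close> for mass.\<close>

lemma massless_flow:
  assumes m: "mu c = 0" and i: "i < c []"
  shows "frontier_flow (subtree c i) (prune c i) = 0" "\<not> linked (subtree c i) (prune c i)"
proof -
  let ?t = "subtree c i" and ?p = "prune c i"
  have no: False if sf: "sf ?t" "\<And>j. j < rdeg ?p \<Longrightarrow> sf (subtree ?p j)"
      and b: "l + (\<Sum>j<rdeg ?p. bv (subtree ?p j)) = - bv ?t"
  proof -
    have "\<forall>j<c []. j \<noteq> i \<longrightarrow> sf (subtree c j)" using prune_children[OF i, of sf] sf(2) by blast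
    hence "\<And>j. j < rdeg c \<Longrightarrow> sf (subtree c j)" using sf(1) unfolding rdeg_c by metis
    moreover have "l + (\<Sum>j<rdeg c. bv (subtree c j)) = 0"
      unfolding rdeg_c sum_remove[OF i] using b unfolding sum_prune[OF i] by linarith
    ultimately have "0 < mu c" by (rule mu_posI)
    thus False using m by simp
  qed
  show "frontier_flow ?t ?p = 0"
  proof (rule ccontr)
    assume "frontier_flow ?t ?p \<noteq> 0"
    hence M: "0 < cmass ?t" and mp: "0 < mu ?p" by (auto simp: frontier_flow_def split: if_splits)
    show False using no[OF cmass_pos(1)[OF M] mu_pos(1)[OF mp]] mu_pos(2)[OF mp] cmass_pos(2)[OF M] by simp
  qed
  show "\<not> linked ?t ?p"
  proof
    assume "linked ?t ?p"
    hence lk: "cmass ?p = 0" "sf ?t" "sf ?p" "bv ?t * bv ?p = 1" by (auto simp: linked_def)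
    note p = cmass_zero_sf[OF lk(1,3)]
    have "l + (\<Sum>j<rdeg ?p. bv (subtree ?p j)) = - bv ?t"
      using p(2) lk(4) unfolding p(3) by (simp add: field_simps)
    thus False using no[OF lk(2) p(1)] by simp
  qed
qed

text \<open>At a massive root, mu = 1 / (1 + S) with S the sum of the child slopes, so 1 - mu = S *
  mu; by \<open>massive_child\<close> each summand is the frontier or block flow of one
  child.\<close>

lemma mass_balance:
  "mu c = (if 0 < mu c then 1 else 0) - (\<Sum>i<c []. frontier_flow (subtree c i) (prune c i))
     - (\<Sum>i<c []. block_flow (subtree c i) (prune c i))"
proof (cases "0 < mu c")
  case True
  have "frontier_flow (subtree c i) (prune c i) + block_flow (subtree c i) (prune c i) = sl (subtree c i) * mu c"
    if "i < c []" for i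
  proof (cases "0 < cmass (subtree c i)")
    case pos: True
    have "block_flow (subtree c i) (prune c i) = 0" using massive_child(2)[OF True that pos] by (simp add: block_flow_def)
    thus ?thesis using massive_child(1)[OF True that pos] by simp
  next
    case False
    hence z: "cmass (subtree c i) = 0" using cmass_nonneg[of "subtree c i"] by simp
    have "frontier_flow (subtree c i) (prune c i) = 0" using z by (simp add: frontier_flow_def)
    thus ?thesis using massive_child(4)[OF True that z] by simp
  qed
  hence "(\<Sum>i<c []. frontier_flow (subtree c i) (prune c i)) + (\<Sum>i<c []. block_flow (subtree c i) (prune c i)) =
      (\<Sum>i<c []. sl (subtree c i)) * mu c"
    by (simp add: sum.distrib[symmetric] sum_distrib_right)
  moreover have "1 - mu c = (\<Sum>i<c []. sl (subtree c i)) * mu c"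
  proof -
    define S where "S = (\<Sum>i<c []. sl (subtree c i))"
    have "mu c = 1 / (1 + S)" using mu_pos(3)[OF True] unfolding rdeg_c S_def .
    moreover from this have "1 + S \<noteq> 0" using True by auto
    ultimately have "mu c * (1 + S) = 1" by simp
    thus ?thesis unfolding S_def[symmetric] by (simp add: algebra_simps)
  qed
  ultimately show ?thesis using True by simp
next
  case False
  hence "mu c = 0" using mu_nonneg[of c] by simp
  thus ?thesis using massless_flow by (simp add: block_flow_def)
qed

text \<open>Here the root plays the frontier vertex. The denominator
  \<open>cmass (prune c i) + mu (subtree c i)\<close> is the same total for every \<open>i\<close>,
  so the flows are shares of it and add up to 1.\<close>

lemma reverse_frontier_flow:
  "(\<Sum>i<c []. frontier_flow (prune c i) (subtree c i)) = (if two_massive c then 1 else 0)"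
proof -
  define S where "S = (\<Sum>j<c []. mu (subtree c j))"
  have cm: "cmass (prune c i) + mu (subtree c i) = S" if "i < c []" for i
    unfolding cmass_def sum_prune[OF that] S_def sum_remove[OF that] by simp
  have iff: "(0 < cmass (prune c i)) = (\<exists>j<c []. j \<noteq> i \<and> 0 < mu (subtree c j))" if "i < c []" for i
  proof -
    have "0 < cmass (prune c i) \<longleftrightarrow> \<not> (\<forall>j\<in>{..<c []} - {i}. mu (subtree c j) = 0)"
      unfolding cmass_def sum_prune[OF that]
      using sum_nonneg_eq_0_iff[of "{..<c []} - {i}" "\<lambda>j. mu (subtree c j)"] mu_nonneg
        sum_nonneg[of "{..<c []} - {i}" "\<lambda>j. mu (subtree c j)"] by (metis finite_Diff finite_lessThan less_eq_real_def less_irrefl)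
    thus ?thesis using mu_nonneg by (auto simp: less_le)
  qed
  show ?thesis
  proof (cases "two_massive c")
    case True
    then obtain i0 where i0: "i0 < c []" "0 < mu (subtree c i0)" by (auto simp: two_massive_def)
    have "mu (subtree c i0) \<le> S" unfolding S_def by (rule member_le_sum) (use i0 mu_nonneg in auto)
    hence S: "0 < S" using i0 by linarith
    have "frontier_flow (prune c i) (subtree c i) = mu (subtree c i) / S" if i: "i < c []" for i
    proof (cases "0 < mu (subtree c i)")
      case pos: True
      have "\<exists>j<c []. j \<noteq> i \<and> 0 < mu (subtree c j)" using True unfolding two_massive_def by metis
      thus ?thesis using pos cm[OF i] iff[OF i] by (simp add: frontier_flow_def)
    next
      case False
      thus ?thesis using mu_nonneg[of "subtree c i"] by (simp add: frontier_flow_def)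
    qed
    hence "(\<Sum>i<c []. frontier_flow (prune c i) (subtree c i)) = (\<Sum>i<c []. mu (subtree c i)) / S"
      by (simp add: sum_divide_distrib)
    also have "\<dots> = 1" using S unfolding S_def by simp
    finally show ?thesis using True by simp
  next
    case False
    have "frontier_flow (prune c i) (subtree c i) = 0" if i: "i < c []" for i
      using False i iff[OF i] unfolding two_massive_def frontier_flow_def by auto
    thus ?thesis using False by simp
  qed
qed

text \<open>In a finite block of N vertices, without cut-off, the flow of a child would be its part
  of the block divided by N, and the sum (N - 1) / N. With the cut-off the root side sees the other
  children one level less deep, so each denominator is still at most 1 plus the sum of all child
  sizes.\<close>

lemma size_flow_massive:
  assumes m: "0 < mu c"
  shows "1 - 1 / (1 + (\<Sum>i<c []. bsize (Suc K) (subtree c i))) \<le> (\<Sum>i<c []. size_flow (Suc K) (subtree c i) (prune c i))"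
proof -
  define S where "S = (\<Sum>i<c []. bsize (Suc K) (subtree c i))"
  have S: "0 \<le> S" unfolding S_def by (intro sum_nonneg bsize_nonneg)
  have "bsize (Suc K) (subtree c i) / (1 + S) \<le> size_flow (Suc K) (subtree c i) (prune c i)" if i: "i < c []" for i
  proof (cases "0 < cmass (subtree c i)")
    case True
    thus ?thesis using massive_child(2)[OF m i] by (simp add: size_flow_def)
  next
    case False
    hence z: "cmass (subtree c i) = 0" using cmass_nonneg[of "subtree c i"] by simp
    have lk: "linked (subtree c i) (prune c i)" by (rule massive_child(3)[OF m i z])
    have "bsize (Suc K) (prune c i) = 1 + (\<Sum>j\<in>{..<c []} - {i}. bsize K (subtree c j))"
      using massive_child(5)[OF m i] sum_prune[OF i, of "bsize K"] by simp
    also have "\<dots> \<le> 1 + (\<Sum>j\<in>{..<c []} - {i}. bsize (Suc K) (subtree c j))"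
      by (intro add_left_mono sum_mono bsize_mono)
    finally have "bsize (Suc K) (subtree c i) + bsize (Suc K) (prune c i) \<le> 1 + S"
      unfolding S_def sum_remove[OF i] by linarith
    moreover have "1 \<le> bsize (Suc K) (subtree c i)" by (rule bsize_ge_1[OF z])
    moreover have "0 \<le> bsize (Suc K) (prune c i)" by (rule bsize_nonneg)
    ultimately show ?thesis using lk unfolding size_flow_def
      by (simp only: if_True) (intro divide_left_mono mult_pos_pos, linarith+)
  qed
  hence "(\<Sum>i<c []. bsize (Suc K) (subtree c i) / (1 + S)) \<le> (\<Sum>i<c []. size_flow (Suc K) (subtree c i) (prune c i))"
    by (intro sum_mono) auto
  moreover have "(\<Sum>i<c []. bsize (Suc K) (subtree c i) / (1 + S)) = S / (1 + S)"
    unfolding sum_divide_distrib[symmetric] S_def ..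
  moreover have "S / (1 + S) = 1 - 1 / (1 + S)" using S by (simp add: field_simps)
  ultimately show ?thesis unfolding S_def by simp
qed

end

section \<open>Finite blocks and their eigenvalues\<close>

primrec shallow :: "nat \<Rightarrow> offspring \<Rightarrow> bool" where
  "shallow 0 c \<longleftrightarrow> 0 < cmass c"
| "shallow (Suc D) c \<longleftrightarrow> 0 < cmass c \<or> (\<forall>i<rdeg c. shallow D (subtree c i))"

text \<open>Failure of \<open>shallow D\<close> yields a downward path of \<open>D + 1\<close>
  vertices that avoids the frontier, and \<open>bsize\<close> counts them all.\<close>

lemma bsize_not_shallow: "\<not> shallow D c \<Longrightarrow> real (Suc D) \<le> bsize (Suc D) c"
proof (induction D arbitrary: c)
  case 0
  then show ?case by simp
next
  case (Suc D)
  then obtain i where i: "i < rdeg c" "\<not> shallow D (subtree c i)" and z: "\<not> 0 < cmass c" by auto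
  have "real (Suc D) \<le> bsize (Suc D) (subtree c i)" by (rule Suc.IH[OF i(2)])
  also have "\<dots> \<le> (\<Sum>i<rdeg c. bsize (Suc D) (subtree c i))"
    by (rule member_le_sum) (use i bsize_nonneg in \<open>auto simp del: bsize.simps\<close>)
  finally show ?case using z by simp
qed

lemma children_value:
  assumes "\<And>i. i < rdeg c \<Longrightarrow> \<exists>p\<in>block_values D. poly (snd p) l \<noteq> 0 \<and>
      bv (subtree c i) = - poly (fst p) l / poly (snd p) l"
  obtains xs where "set xs \<subseteq> block_values D" "length xs \<le> d" "poly (snd (continued_sum xs)) l \<noteq> 0"
    "l + (\<Sum>i<rdeg c. bv (subtree c i)) = poly (fst (continued_sum xs)) l / poly (snd (continued_sum xs)) l"
proof -
  obtain p where p: "\<And>i. i < rdeg c \<Longrightarrow> p i \<in> block_values D \<and> poly (snd (p i)) l \<noteq> 0 \<and>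
      bv (subtree c i) = - poly (fst (p i)) l / poly (snd (p i)) l" using assms by metis
  define xs where "xs = map p [0..<rdeg c]"
  have xs: "set xs \<subseteq> block_values D" "length xs \<le> d" using p rdeg_le by (auto simp: xs_def)
  have s: "(\<Sum>q\<leftarrow>xs. - poly (fst q) l / poly (snd q) l) = (\<Sum>i<rdeg c. bv (subtree c i))"
    unfolding xs_def using p by (simp add: interv_sum_list_conv_sum_set_nat atLeast0LessThan o_def)
  have nz: "\<And>q. q \<in> set xs \<Longrightarrow> poly (snd q) l \<noteq> 0" using p by (auto simp: xs_def)
  show ?thesis using that[OF xs] continued_sum_value[of xs l, OF nz, unfolded s] by blast
qed

text \<open>The recursion for \<open>bv\<close> is a continued fraction that stops at frontier
  vertices, where the value is 0; finite depth and bounded degree leave finitely many such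
  expressions.\<close>

lemma shallow_value:
  assumes "shallow D c" "sf c"
  shows "\<exists>p\<in>block_values D. poly (snd p) l \<noteq> 0 \<and> bv c = - poly (fst p) l / poly (snd p) l"
  using assms
proof (induction D arbitrary: c)
  case 0
  thus ?case using cmass_pos by simp
next
  case (Suc D)
  show ?case
  proof (cases "0 < cmass c")
    case True
    thus ?thesis using cmass_pos by (intro bexI[of _ "(0,1)"]) auto
  next
    case False
    hence z: "cmass c = 0" using cmass_nonneg[of c] by simp
    note c = cmass_zero_sf[OF z Suc.prems(2)]
    have "\<exists>p\<in>block_values D. poly (snd p) l \<noteq> 0 \<and> bv (subtree c i) = - poly (fst p) l / poly (snd p) l"
      if "i < rdeg c" for i
      using Suc.IH Suc.prems(1) False c(1) that by auto
    from children_value[OF this] obtain xs where xs: "set xs \<subseteq> block_values D" "length xs \<le> d"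
      and v: "poly (snd (continued_sum xs)) l \<noteq> 0"
      "l + (\<Sum>i<rdeg c. bv (subtree c i)) = poly (fst (continued_sum xs)) l / poly (snd (continued_sum xs)) l"
      by metis
    have "poly (fst (continued_sum xs)) l \<noteq> 0" using c(2) v by auto
    moreover have "bv c = - poly (snd (continued_sum xs)) l / poly (fst (continued_sum xs)) l"
      unfolding c(3) v(2) by simp
    ultimately show ?thesis using xs
      by (intro bexI[of _ "(snd (continued_sum xs), fst (continued_sum xs))"]) auto
  qed
qed

lemma shallow_eigenvalue:
  assumes m: "0 < mu c" and sh: "\<And>i. i < rdeg c \<Longrightarrow> shallow D (subtree c i)"
  shows "l \<in> block_eigenvalues D"
proof -
  have "\<exists>p\<in>block_values D. poly (snd p) l \<noteq> 0 \<and> bv (subtree c i) = - poly (fst p) l / poly (snd p) l"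
    if "i < rdeg c" for i
    using shallow_value sh mu_pos(1)[OF m] that by blast
  from children_value[OF this] obtain xs where xs: "set xs \<subseteq> block_values D" "length xs \<le> d"
    and "poly (snd (continued_sum xs)) l \<noteq> 0"
    "l + (\<Sum>i<rdeg c. bv (subtree c i)) = poly (fst (continued_sum xs)) l / poly (snd (continued_sum xs)) l"
    by metis
  hence "poly (fst (continued_sum xs)) l = 0" using mu_pos(2)[OF m] by auto
  thus ?thesis unfolding block_eigenvalues_def using xs by blast
qed

end

section \<open>Branching laws and mass transport\<close>

lemma prod_emb_UNIV:
  assumes "\<And>i. space (M i) = UNIV"
  shows "prod_emb UNIV M J (Pi\<^sub>E J F) = {c. \<forall>j\<in>J. c j \<in> F j}"
  using assms by (auto simp: prod_emb_def PiE_iff)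

lemma emeasure_PiM_cylinder:
  assumes M: "\<And>i. prob_space (M i)" "\<And>i. space (M i) = UNIV"
    and J: "finite J" "\<And>j. j \<in> J \<Longrightarrow> F j \<in> sets (M j)"
  shows "emeasure (Pi\<^sub>M UNIV M) {c. \<forall>j\<in>J. c j \<in> F j} = (\<Prod>j\<in>J. emeasure (M j) (F j))"
    "{c. \<forall>j\<in>J. c j \<in> F j} \<in> sets (Pi\<^sub>M UNIV M)"
proof -
  show "emeasure (Pi\<^sub>M UNIV M) {c. \<forall>j\<in>J. c j \<in> F j} = (\<Prod>j\<in>J. emeasure (M j) (F j))"
    using emeasure_PiM_emb[of UNIV M J F] M J unfolding prod_emb_UNIV[of M, OF M(2)] by simp
  show "{c. \<forall>j\<in>J. c j \<in> F j} \<in> sets (Pi\<^sub>M UNIV M)"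
    using sets_PiM_I[of J UNIV F M] J unfolding prod_emb_UNIV[of M, OF M(2)] by simp
qed

lemma PiM_eq_cylinder:
  assumes M: "\<And>i. prob_space (M i)" "\<And>i. space (M i) = UNIV"
    and N: "sets N = sets (Pi\<^sub>M UNIV M)"
    and eq: "\<And>J F. finite J \<Longrightarrow> (\<And>j. j \<in> J \<Longrightarrow> F j \<in> sets (M j)) \<Longrightarrow>
      emeasure N {c. \<forall>j\<in>J. c j \<in> F j} = (\<Prod>j\<in>J. emeasure (M j) (F j))"
  shows "N = Pi\<^sub>M UNIV M"
proof -
  interpret prob_space "M i" for i by (rule M(1))
  interpret product_prob_space M UNIV ..
  show ?thesis by (rule PiM_eq[OF N]) (use eq prod_emb_UNIV[of M, OF M(2)] in simp)
qed

definition offspring_law :: "nat pmf \<Rightarrow> nat pmf \<Rightarrow> offspring measure" where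
  "offspring_law p q = Pi\<^sub>M UNIV (\<lambda>u. measure_pmf (if u = [] then p else q))"

abbreviation OS :: "offspring measure" where
  "OS \<equiv> Pi\<^sub>M UNIV (\<lambda>_. count_space UNIV)"

lemma sets_offspring_law [measurable_cong]: "sets (offspring_law p q) = sets OS"
  unfolding offspring_law_def by (rule sets_PiM_cong) auto

lemma space_offspring_law [simp]: "space (offspring_law p q) = UNIV"
  by (simp add: offspring_law_def space_PiM)

lemma prob_space_offspring_law: "prob_space (offspring_law p q)"
  unfolding offspring_law_def by (intro prob_space_PiM prob_space_measure_pmf)

abbreviation forest_space :: "(nat \<Rightarrow> offspring) measure" where
  "forest_space \<equiv> Pi\<^sub>M UNIV (\<lambda>_::nat. OS)"

text \<open>Infinitely many independent branches, of which a root of degree \<open>k\<close> uses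
  the first \<open>k\<close>. In this way the forest is independent of the degree.\<close>

definition forest_law :: "nat pmf \<Rightarrow> (nat \<Rightarrow> offspring) measure" where
  "forest_law q = Pi\<^sub>M UNIV (\<lambda>_::nat. offspring_law q q)"

lemma sets_forest_law [measurable_cong]: "sets (forest_law q) = sets forest_space"
  unfolding forest_law_def by (intro sets_PiM_cong refl sets_offspring_law)

lemma space_forest_law [simp]: "space (forest_law q) = UNIV"
  by (simp add: forest_law_def space_PiM)

lemma prob_space_forest_law: "prob_space (forest_law q)"
  unfolding forest_law_def by (intro prob_space_PiM prob_space_offspring_law)

lemma measurable_label [measurable]: "(\<lambda>c. c u) \<in> OS \<rightarrow>\<^sub>M count_space UNIV"
  by (rule measurable_component_singleton) simp

lemma measurable_subtree [measurable]: "(\<lambda>c. subtree c i) \<in> OS \<rightarrow>\<^sub>M OS"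
  unfolding subtree_def by (rule measurable_PiM_single') auto

lemma measurable_tree_component [measurable]: "(\<lambda>s. s i) \<in> forest_space \<rightarrow>\<^sub>M OS"
  by (rule measurable_component_singleton) simp

lemma measurable_graft:
  assumes [measurable]: "f \<in> M \<rightarrow>\<^sub>M count_space UNIV" "g \<in> M \<rightarrow>\<^sub>M forest_space"
  shows "(\<lambda>x. graft (f x) (g x)) \<in> M \<rightarrow>\<^sub>M OS"
proof (rule measurable_PiM_single'[where f="\<lambda>u x. graft (f x) (g x) u", simplified])
  show "(\<lambda>x. graft (f x) (g x) u) \<in> M \<rightarrow>\<^sub>M count_space UNIV" for u
  proof (cases u)
    case (Cons i w)
    have "(\<lambda>x. g x i w) \<in> M \<rightarrow>\<^sub>M count_space UNIV" by measurable
    thus ?thesis by (simp add: graft_def Cons)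
  qed (simp add: graft_def)
qed (auto simp: PiE_iff)

lemma measurable_graft_const [measurable]: "(\<lambda>s. graft k s) \<in> forest_space \<rightarrow>\<^sub>M OS"
  by (rule measurable_graft[OF measurable_const measurable_ident_sets[OF refl], unfolded id_def]) simp

lemma measurable_graft_pair [measurable]:
  "(\<lambda>(k, s). graft k s) \<in> count_space UNIV \<Otimes>\<^sub>M forest_space \<rightarrow>\<^sub>M OS"
  unfolding case_prod_unfold by (rule measurable_graft) measurable

lemma measurable_prune [measurable]: "(\<lambda>c. prune c i) \<in> OS \<rightarrow>\<^sub>M OS"
  unfolding prune_def
proof (rule measurable_graft)
  show "(\<lambda>c j. subtree c (skip i j)) \<in> OS \<rightarrow>\<^sub>M forest_space"
    by (rule measurable_PiM_single'[where f="\<lambda>j c. subtree c (skip i j)", simplified]) (auto simp: space_PiM)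
  show "(\<lambda>c. c [] - 1) \<in> OS \<rightarrow>\<^sub>M count_space UNIV"
    by (rule measurable_compose[OF measurable_label[of "[]"], of "\<lambda>k. k - 1"]) simp
qed

text \<open>Checked on cylinders: sorting the words of a finite set by their first letter splits the
  condition into one on the root label and one on each of finitely many branches.\<close>

lemma offspring_law_branching:
  "distr (measure_pmf p \<Otimes>\<^sub>M forest_law q) OS (\<lambda>(k, s). graft k s) = offspring_law p q"
  unfolding offspring_law_def
proof (rule PiM_eq_cylinder)
  let ?M = "\<lambda>u::nat list. measure_pmf (if u = [] then p else q)"
  interpret F: prob_space "forest_law q" by (rule prob_space_forest_law)
  show "sets (distr (measure_pmf p \<Otimes>\<^sub>M forest_law q) OS (\<lambda>(k, s). graft k s)) = sets (Pi\<^sub>M UNIV ?M)"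
    using sets_offspring_law[of p q] by (simp add: offspring_law_def)
  fix J :: "nat list set" and A :: "nat list \<Rightarrow> nat set"
  assume J: "finite J"
  define I where "I = hd ` (J - {[]})"
  define L where "L i = {w. i # w \<in> J}" for i
  define A0 where "A0 = (if [] \<in> J then A [] else UNIV)"
  define B where "B = {s :: nat \<Rightarrow> offspring. \<forall>i\<in>I. s i \<in> {c. \<forall>w\<in>L i. c w \<in> A (i # w)}}"
  have I: "finite I" using J by (simp add: I_def)
  have L: "finite (L i)" for i
  proof -
    have "L i = (#) i -` J" by (auto simp: L_def)
    thus ?thesis using J by (simp add: finite_vimageI)
  qed
  have Bi: "emeasure (offspring_law q q) {c. \<forall>w\<in>L i. c w \<in> A (i # w)} = (\<Prod>w\<in>L i. emeasure (measure_pmf q) (A (i # w)))"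
    "{c. \<forall>w\<in>L i. c w \<in> A (i # w)} \<in> sets (offspring_law q q)" for i
    unfolding offspring_law_def using emeasure_PiM_cylinder[of "\<lambda>u. measure_pmf (if u = [] then q else q)" "L i" "\<lambda>w. A (i # w)"] L
    by (simp_all add: prob_space_measure_pmf)
  have B: "emeasure (forest_law q) B = (\<Prod>i\<in>I. \<Prod>w\<in>L i. emeasure (measure_pmf q) (A (i # w)))"
    "B \<in> sets (forest_law q)"
    unfolding forest_law_def B_def
    using emeasure_PiM_cylinder[of "\<lambda>_. offspring_law q q" I "\<lambda>i. {c. \<forall>w\<in>L i. c w \<in> A (i # w)}"] I Bi
    by (simp_all add: prob_space_offspring_law)
  have pre: "(\<lambda>(k, s). graft k s) -` {c. \<forall>u\<in>J. c u \<in> A u} \<inter> space (measure_pmf p \<Otimes>\<^sub>M forest_law q) = A0 \<times> B"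
  proof -
    have "(\<forall>u\<in>J. graft k s u \<in> A u) \<longleftrightarrow> k \<in> A0 \<and> s \<in> B" for k s
    proof
      assume a: "\<forall>u\<in>J. graft k s u \<in> A u"
      have "k \<in> A0" using a by (auto simp: A0_def graft_def)
      moreover have "s i w \<in> A (i # w)" if "i # w \<in> J" for i w using a that by (force simp: graft_def)
      ultimately show "k \<in> A0 \<and> s \<in> B" by (auto simp: B_def L_def)
    next
      assume a: "k \<in> A0 \<and> s \<in> B"
      show "\<forall>u\<in>J. graft k s u \<in> A u"
      proof
        fix u assume u: "u \<in> J"
        show "graft k s u \<in> A u"
        proof (cases u)
          case Nil
          thus ?thesis using a u by (simp add: A0_def graft_def)
        next
          case (Cons i w)
          hence "i \<in> I" "w \<in> L i" using u by (force simp: I_def L_def)+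
          thus ?thesis using a by (auto simp: B_def graft_def Cons)
        qed
      qed
    qed
    thus ?thesis by (auto simp: space_pair_measure)
  qed
  have "{c. \<forall>u\<in>J. c u \<in> A u} \<in> sets OS"
    using emeasure_PiM_cylinder(2)[of ?M J A] J sets_offspring_law[of p q]
    by (simp add: prob_space_measure_pmf offspring_law_def)
  hence "emeasure (distr (measure_pmf p \<Otimes>\<^sub>M forest_law q) OS (\<lambda>(k, s). graft k s)) {c. \<forall>u\<in>J. c u \<in> A u} =
      emeasure (measure_pmf p \<Otimes>\<^sub>M forest_law q) (A0 \<times> B)"
    unfolding pre[symmetric] by (subst emeasure_distr) auto
  also have "\<dots> = emeasure (measure_pmf p) A0 * emeasure (forest_law q) B"
    by (rule F.emeasure_pair_measure_Times) (use B in auto)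
  also have "emeasure (forest_law q) B = (\<Prod>u\<in>J - {[]}. emeasure (?M u) (A u))"
  proof -
    have "emeasure (forest_law q) B = (\<Prod>(i, w)\<in>Sigma I L. emeasure (measure_pmf q) (A (i # w)))"
      unfolding B using I L by (intro prod.Sigma) auto
    also have "\<dots> = (\<Prod>u\<in>J - {[]}. emeasure (?M u) (A u))"
    proof (rule prod.reindex_bij_witness[of _ "\<lambda>u. (hd u, tl u)" "\<lambda>(i, w). i # w"])
      show "(\<lambda>u. (hd u, tl u)) u \<in> Sigma I L" if "u \<in> J - {[]}" for u
        using that by (auto simp: I_def L_def)
    qed (auto simp: L_def)
    finally show ?thesis .
  qed
  also have "emeasure (measure_pmf p) A0 * (\<Prod>u\<in>J - {[]}. emeasure (?M u) (A u)) = (\<Prod>u\<in>J. emeasure (?M u) (A u))"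
  proof (cases "[] \<in> J")
    case True
    have "(\<Prod>u\<in>J. emeasure (?M u) (A u)) = emeasure (?M []) (A []) * (\<Prod>u\<in>J - {[]}. emeasure (?M u) (A u))"
      by (rule prod.remove[OF J True])
    thus ?thesis using True by (simp only: A0_def if_True refl)
  next
    case False
    hence "J - {[]} = J" by blast
    thus ?thesis using False measure_pmf.emeasure_space_1[of p] by (simp only: A0_def if_False) simp
  qed
  finally show "emeasure (distr (measure_pmf p \<Otimes>\<^sub>M forest_law q) OS (\<lambda>(k, s). graft k s)) {c. \<forall>u\<in>J. c u \<in> A u} =
      (\<Prod>u\<in>J. emeasure (?M u) (A u))" .
qed (auto simp: prob_space_measure_pmf)

section \<open>Singling out one branch of the forest\<close>

definition insert_at :: "nat \<Rightarrow> 'a \<Rightarrow> (nat \<Rightarrow> 'a) \<Rightarrow> nat \<Rightarrow> 'a" where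
  "insert_at i t s j = (if j = i then t else s (if j < i then j else j - 1))"

lemma insert_at_simps [simp]: "insert_at i t s i = t" "insert_at i t s (skip i j) = s j"
  by (auto simp: insert_at_def skip_def)

lemma measurable_insert_at [measurable]:
  "(\<lambda>(t, s). insert_at i t s) \<in> OS \<Otimes>\<^sub>M forest_space \<rightarrow>\<^sub>M forest_space"
  unfolding case_prod_unfold
proof (rule measurable_PiM_single'[where f="\<lambda>j x. insert_at i (fst x) (snd x) j", simplified])
  show "(\<lambda>x. insert_at i (fst x) (snd x) j) \<in> OS \<Otimes>\<^sub>M forest_space \<rightarrow>\<^sub>M OS" for j
    unfolding insert_at_def by measurable
qed (auto simp: space_PiM)

text \<open>The branches are independent and identically distributed, so after removal of number
  \<open>i\<close> the others, renumbered by \<open>skip\<close>, are again such a forest,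
  independent of the removed branch.\<close>

lemma forest_law_insert_at:
  "distr (offspring_law q q \<Otimes>\<^sub>M forest_law q) forest_space (\<lambda>(t, s). insert_at i t s) = forest_law q"
  unfolding forest_law_def[of q]
proof (rule PiM_eq_cylinder)
  let ?Q = "offspring_law q q"
  interpret Q: prob_space ?Q by (rule prob_space_offspring_law)
  interpret F: prob_space "forest_law q" by (rule prob_space_forest_law)
  show "sets (distr (?Q \<Otimes>\<^sub>M Pi\<^sub>M UNIV (\<lambda>_. ?Q)) forest_space (\<lambda>(t, s). insert_at i t s)) = sets (Pi\<^sub>M UNIV (\<lambda>_::nat. ?Q))"
    using sets_forest_law[of q] by (simp add: forest_law_def)
  fix J :: "nat set" and A :: "nat \<Rightarrow> offspring set"
  assume J: "finite J" and A: "\<And>j. j \<in> J \<Longrightarrow> A j \<in> sets ?Q"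
  define A0 where "A0 = (if i \<in> J then A i else UNIV)"
  define J' where "J' = skip i -` J"
  have inj: "inj (skip i)" by (auto simp: inj_on_def skip_def split: if_splits)
  have J': "finite J'" unfolding J'_def using J inj by (intro finite_vimageI)
  define B where "B = {s :: nat \<Rightarrow> offspring. \<forall>j\<in>J'. s j \<in> A (skip i j)}"
  have B: "emeasure (forest_law q) B = (\<Prod>j\<in>J'. emeasure ?Q (A (skip i j)))" "B \<in> sets (forest_law q)"
    unfolding forest_law_def B_def
    using emeasure_PiM_cylinder[of "\<lambda>_. ?Q" J' "\<lambda>j. A (skip i j)"] J' A
    by (simp_all add: prob_space_offspring_law J'_def)
  have A0: "A0 \<in> sets ?Q" using A sets.top[of ?Q] by (auto simp: A0_def)
  have surj: "\<exists>j'. j = skip i j'" if "j \<noteq> i" for j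
    using that by (intro exI[of _ "if j < i then j else j - 1"]) (auto simp: skip_def)
  have pre: "(\<lambda>(t, s). insert_at i t s) -` {c. \<forall>j\<in>J. c j \<in> A j} \<inter> space (?Q \<Otimes>\<^sub>M forest_law q) = A0 \<times> B"
  proof -
    have "(\<forall>j\<in>J. insert_at i t s j \<in> A j) \<longleftrightarrow> t \<in> A0 \<and> s \<in> B" for t s
    proof
      assume a: "\<forall>j\<in>J. insert_at i t s j \<in> A j"
      have "t \<in> A0" using a by (auto simp: A0_def)
      moreover have "s j \<in> A (skip i j)" if "skip i j \<in> J" for j using a that insert_at_simps(2)[of i t s j] by metis
      ultimately show "t \<in> A0 \<and> s \<in> B" by (auto simp: B_def J'_def)
    next
      assume a: "t \<in> A0 \<and> s \<in> B"
      show "\<forall>j\<in>J. insert_at i t s j \<in> A j"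
      proof
        fix j assume j: "j \<in> J"
        show "insert_at i t s j \<in> A j"
        proof (cases "j = i")
          case True
          thus ?thesis using a j by (simp add: A0_def)
        next
          case False
          then obtain j' where "j = skip i j'" using surj by blast
          thus ?thesis using a j by (auto simp: B_def J'_def)
        qed
      qed
    qed
    thus ?thesis by (auto simp: space_pair_measure)
  qed
  have "{c. \<forall>j\<in>J. c j \<in> A j} \<in> sets forest_space"
    using emeasure_PiM_cylinder(2)[of "\<lambda>_. ?Q" J A] J A sets_forest_law[of q]
    by (simp add: prob_space_offspring_law forest_law_def)
  hence "emeasure (distr (?Q \<Otimes>\<^sub>M forest_law q) forest_space (\<lambda>(t, s). insert_at i t s)) {c. \<forall>j\<in>J. c j \<in> A j} =
      emeasure (?Q \<Otimes>\<^sub>M forest_law q) (A0 \<times> B)"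
    unfolding pre[symmetric] by (subst emeasure_distr) auto
  also have "\<dots> = emeasure ?Q A0 * emeasure (forest_law q) B"
    by (rule F.emeasure_pair_measure_Times[OF A0 B(2)])
  also have "emeasure (forest_law q) B = (\<Prod>j\<in>J - {i}. emeasure ?Q (A j))"
    unfolding B(1)
  proof (rule prod.reindex_bij_betw)
    have "skip i j \<noteq> i" for j by (simp add: skip_def)
    hence "skip i ` J' \<subseteq> J - {i}" by (auto simp: J'_def)
    moreover have "j \<in> skip i ` J'" if j: "j \<in> J - {i}" for j
    proof -
      from j obtain j' where "j = skip i j'" using surj[of j] by auto
      thus ?thesis using j by (auto simp: J'_def)
    qed
    ultimately have "skip i ` J' = J - {i}" by blast
    thus "bij_betw (skip i) J' (J - {i})" using inj by (auto simp: bij_betw_def intro: inj_on_subset)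
  qed
  also have "emeasure ?Q A0 * (\<Prod>j\<in>J - {i}. emeasure ?Q (A j)) = (\<Prod>j\<in>J. emeasure ?Q (A j))"
    using J prod.remove[of J i "\<lambda>j. emeasure ?Q (A j)"] Q.emeasure_space_1
    by (cases "i \<in> J") (simp_all add: A0_def)
  finally show "emeasure (distr (?Q \<Otimes>\<^sub>M Pi\<^sub>M UNIV (\<lambda>_. ?Q)) forest_space (\<lambda>(t, s). insert_at i t s)) {c. \<forall>j\<in>J. c j \<in> A j} =
      (\<Prod>j\<in>J. emeasure ?Q (A j))" by (simp add: forest_law_def)
qed (auto simp: prob_space_offspring_law)

lemma measurable_skip [measurable]: "(\<lambda>s j. s (skip i j)) \<in> forest_space \<rightarrow>\<^sub>M forest_space"
  by (rule measurable_PiM_single'[where f="\<lambda>j s. s (skip i j)", simplified]) (auto simp: space_PiM)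

lemma nn_integral_forest_split:
  assumes [measurable]: "F \<in> borel_measurable (OS \<Otimes>\<^sub>M forest_space)"
  shows "(\<integral>\<^sup>+s. F (s i, \<lambda>j. s (skip i j)) \<partial>forest_law q) = (\<integral>\<^sup>+t. \<integral>\<^sup>+s. F (t, s) \<partial>forest_law q \<partial>offspring_law q q)"
proof -
  interpret F: prob_space "forest_law q" by (rule prob_space_forest_law)
  have "(\<integral>\<^sup>+s. F (s i, \<lambda>j. s (skip i j)) \<partial>forest_law q) =
      (\<integral>\<^sup>+x. F (fst x, snd x) \<partial>(offspring_law q q \<Otimes>\<^sub>M forest_law q))"
    by (subst forest_law_insert_at[of q i, symmetric], subst nn_integral_distr) (auto simp: case_prod_unfold)
  also have "\<dots> = (\<integral>\<^sup>+t. \<integral>\<^sup>+s. F (t, s) \<partial>forest_law q \<partial>offspring_law q q)"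
    by (subst F.nn_integral_fst[symmetric]) auto
  finally show ?thesis .
qed

lemma nn_integral_branching:
  assumes [measurable]: "F \<in> borel_measurable OS"
  shows "(\<integral>\<^sup>+c. F c \<partial>offspring_law p q) = (\<integral>\<^sup>+k. \<integral>\<^sup>+s. F (graft k s) \<partial>forest_law q \<partial>measure_pmf p)"
proof -
  interpret F: prob_space "forest_law q" by (rule prob_space_forest_law)
  have g: "(\<lambda>x. graft (fst x) (snd x)) \<in> measure_pmf p \<Otimes>\<^sub>M forest_law q \<rightarrow>\<^sub>M OS"
    by (rule measurable_graft) measurable
  have "(\<integral>\<^sup>+c. F c \<partial>offspring_law p q) = (\<integral>\<^sup>+c. F c \<partial>distr (measure_pmf p \<Otimes>\<^sub>M forest_law q) OS (\<lambda>x. graft (fst x) (snd x)))"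
    using offspring_law_branching[of p q] by (simp add: case_prod_unfold)
  also have "\<dots> = (\<integral>\<^sup>+x. F (graft (fst x) (snd x)) \<partial>(measure_pmf p \<Otimes>\<^sub>M forest_law q))"
    by (rule nn_integral_distr[OF g]) (simp add: assms)
  also have "\<dots> = (\<integral>\<^sup>+k. \<integral>\<^sup>+s. F (graft (fst (k, s)) (snd (k, s))) \<partial>forest_law q \<partial>measure_pmf p)"
    by (rule F.nn_integral_fst[symmetric]) (rule measurable_compose[OF g assms])
  also have "\<dots> = (\<integral>\<^sup>+k. \<integral>\<^sup>+s. F (graft k s) \<partial>forest_law q \<partial>measure_pmf p)" by simp
  finally show ?thesis .
qed

text \<open>The mass transport principle across a single edge: size-biasing the root degree makes the two
  sides of a uniformly chosen root edge independent copies of the same branching tree.\<close>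

lemma nn_integral_edge:
  fixes p q :: "nat pmf"
  assumes F [measurable]: "F \<in> borel_measurable (OS \<Otimes>\<^sub>M OS)"
    and p: "set_pmf p \<subseteq> {..d}" and m: "0 < m"
    and q: "\<And>k. pmf q k = real (k + 1) * pmf p (k + 1) / m"
  shows "(\<integral>\<^sup>+c. (\<Sum>i<c []. F (subtree c i, prune c i)) \<partial>offspring_law p q) =
    ennreal m * (\<integral>\<^sup>+t. \<integral>\<^sup>+t'. F (t, t') \<partial>offspring_law q q \<partial>offspring_law q q)"
proof -
  interpret F: prob_space "forest_law q" by (rule prob_space_forest_law)
  interpret Q: prob_space "offspring_law q q" by (rule prob_space_offspring_law)
  define g where "g k = (\<integral>\<^sup>+t. \<integral>\<^sup>+s. F (t, graft k s) \<partial>forest_law q \<partial>offspring_law q q)" for k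
  have prune_graft: "prune (graft k s) i = graft (k - 1) (\<lambda>j. s (skip i j))" for k s i
    by (simp add: prune_def)
  have Fk: "(\<lambda>x. F (fst x, graft k (snd x))) \<in> borel_measurable (OS \<Otimes>\<^sub>M forest_space)" for k
    by (intro measurable_compose[OF _ F] measurable_Pair measurable_fst
        measurable_compose[OF measurable_snd measurable_graft_const])
  have Fs: "(\<lambda>s. F (s i, graft k (\<lambda>j. s (skip i j)))) \<in> borel_measurable (forest_law q)" for k i
    unfolding measurable_cong_sets[OF sets_forest_law refl]
    using measurable_compose[OF measurable_Pair[OF measurable_tree_component[of i] measurable_skip[of i]] Fk[of k]]
    by (simp only: fst_conv snd_conv)
  have step: "(\<integral>\<^sup>+s. (\<Sum>i<k. F (s i, graft (k - 1) (\<lambda>j. s (skip i j)))) \<partial>forest_law q) = of_nat k * g (k - 1)" for k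
  proof -
    have "(\<integral>\<^sup>+s. F (s i, graft (k - 1) (\<lambda>j. s (skip i j))) \<partial>forest_law q) = g (k - 1)" for i
      unfolding g_def using nn_integral_forest_split[OF Fk, of q i "k - 1"] by (simp only: fst_conv snd_conv)
    moreover have "(\<integral>\<^sup>+s. (\<Sum>i<k. F (s i, graft (k - 1) (\<lambda>j. s (skip i j)))) \<partial>forest_law q) =
        (\<Sum>i<k. \<integral>\<^sup>+s. F (s i, graft (k - 1) (\<lambda>j. s (skip i j))) \<partial>forest_law q)"
      by (rule nn_integral_sum) (rule Fs)
    ultimately show ?thesis by (simp only: sum_constant card_lessThan)
  qed
  have Fp: "(\<lambda>c. F (subtree c i, prune c i)) \<in> borel_measurable OS" for i
    by (rule measurable_compose[OF measurable_Pair[OF measurable_subtree measurable_prune] F])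
  have meas: "(\<lambda>c. \<Sum>i<c []. F (subtree c i, prune c i)) \<in> borel_measurable OS"
    by (rule measurable_compose_countable[where f="\<lambda>k c. \<Sum>i<k. F (subtree c i, prune c i)" and g="\<lambda>c. c []"])
       (intro borel_measurable_sum Fp measurable_label)+
  have "(\<integral>\<^sup>+c. (\<Sum>i<c []. F (subtree c i, prune c i)) \<partial>offspring_law p q) =
      (\<integral>\<^sup>+k. of_nat k * g (k - 1) \<partial>measure_pmf p)"
    unfolding nn_integral_branching[OF meas] graft_simps prune_graft step ..
  also have "\<dots> = (\<Sum>k\<le>d. of_nat k * g (k - 1) * ennreal (pmf p k))"
    by (rule nn_integral_measure_pmf_support) (use p in auto)
  \<comment> \<open>The term k = 0 vanishes; after the shift the size-biasing relation (k + 1) * p(k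
    + 1) = m * q(k) applies.\<close>
  also have "\<dots> = (\<Sum>k<d. of_nat (k + 1) * g k * ennreal (pmf p (k + 1)))"
    by (subst sum.atMost_shift) simp
  also have "\<dots> = (\<Sum>k<d. ennreal m * (g k * ennreal (pmf q k)))"
  proof (rule sum.cong[OF refl])
    fix k
    have "ennreal m * ennreal (pmf q k) = of_nat (k + 1) * ennreal (pmf p (k + 1))"
    proof -
      have "m * pmf q k = real (k + 1) * pmf p (k + 1)" using m by (simp add: q)
      thus ?thesis using m
        by (simp only: ennreal_of_nat_eq_real_of_nat ennreal_mult'[symmetric] less_imp_le of_nat_0_le_iff)
    qed
    thus "of_nat (k + 1) * g k * ennreal (pmf p (k + 1)) = ennreal m * (g k * ennreal (pmf q k))"
      by (metis mult.assoc mult.commute)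
  qed
  also have "\<dots> = ennreal m * (\<integral>\<^sup>+k. g k \<partial>measure_pmf q)"
  proof -
    have "set_pmf q \<subseteq> {..<d}"
    proof
      fix k assume "k \<in> set_pmf q"
      hence "pmf p (k + 1) \<noteq> 0" using q[of k] m by (auto simp: set_pmf_iff)
      hence "k + 1 \<in> set_pmf p" by (simp add: set_pmf_iff)
      thus "k \<in> {..<d}" using p by auto
    qed
    hence "(\<integral>\<^sup>+k. g k \<partial>measure_pmf q) = (\<Sum>k<d. g k * ennreal (pmf q k))"
      by (intro nn_integral_measure_pmf_support) auto
    thus ?thesis by (simp add: sum_distrib_left)
  qed
  also have "(\<integral>\<^sup>+k. g k \<partial>measure_pmf q) = (\<integral>\<^sup>+t. \<integral>\<^sup>+k. \<integral>\<^sup>+s. F (t, graft k s) \<partial>forest_law q \<partial>measure_pmf q \<partial>offspring_law q q)"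
  proof -
    interpret pair_sigma_finite "measure_pmf q" "offspring_law q q" ..
    have "(\<lambda>x. graft (fst (fst x)) (snd x)) \<in> (measure_pmf q \<Otimes>\<^sub>M offspring_law q q) \<Otimes>\<^sub>M forest_law q \<rightarrow>\<^sub>M OS"
      by (rule measurable_graft) measurable
    moreover have "(\<lambda>x. snd (fst x)) \<in> (measure_pmf q \<Otimes>\<^sub>M offspring_law q q) \<Otimes>\<^sub>M forest_law q \<rightarrow>\<^sub>M OS"
      by measurable
    ultimately have "(\<lambda>x. F (snd (fst x), graft (fst (fst x)) (snd x))) \<in> borel_measurable ((measure_pmf q \<Otimes>\<^sub>M offspring_law q q) \<Otimes>\<^sub>M forest_law q)"
      by (intro measurable_compose[OF measurable_Pair F])
    hence "(\<lambda>(k, t). \<integral>\<^sup>+s. F (t, graft k s) \<partial>forest_law q) \<in> borel_measurable (measure_pmf q \<Otimes>\<^sub>M offspring_law q q)"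
      unfolding case_prod_unfold
      by (intro F.borel_measurable_nn_integral) (simp only: case_prod_unfold)
    thus ?thesis unfolding g_def by (rule Fubini'[symmetric])
  qed
  also have "\<dots> = (\<integral>\<^sup>+t. \<integral>\<^sup>+t'. F (t, t') \<partial>offspring_law q q \<partial>offspring_law q q)"
  proof (rule nn_integral_cong)
    fix t
    have "(\<lambda>t'. F (t, t')) \<in> borel_measurable OS"
      by (rule measurable_compose[OF measurable_Pair1' F]) (simp add: space_PiM)
    from nn_integral_branching[OF this, of q q]
    show "(\<integral>\<^sup>+k. \<integral>\<^sup>+s. F (t, graft k s) \<partial>forest_law q \<partial>measure_pmf q) = (\<integral>\<^sup>+t'. F (t, t') \<partial>offspring_law q q)"
      by simp
  qed
  finally show ?thesis .
qed

section \<open>Expected mass at a point\<close>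

context degree_bound
begin

lemma measurable_rdeg [measurable]: "rdeg \<in> OS \<rightarrow>\<^sub>M count_space UNIV"
  unfolding rdeg_def[abs_def]
  by (rule measurable_compose[OF measurable_label[of "[]"], of "\<lambda>k. min d k"]) simp

lemma measurable_children_sum:
  fixes f :: "offspring \<Rightarrow> 'b::{second_countable_topology, topological_comm_monoid_add}"
  assumes "f \<in> borel_measurable OS"
  shows "(\<lambda>c. \<Sum>i<rdeg c. f (subtree c i)) \<in> borel_measurable OS"
  by (rule measurable_compose_countable[where f="\<lambda>k c. \<Sum>i<k. f (subtree c i)" and g=rdeg])
     (intro borel_measurable_sum measurable_compose[OF measurable_subtree assms] measurable_rdeg)+

lemma measurable_root_sum:
  fixes f :: "offspring \<Rightarrow> 'b::{second_countable_topology, topological_comm_monoid_add}"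
  assumes "f \<in> borel_measurable OS"
  shows "(\<lambda>c. \<Sum>i<c []. f (subtree c i)) \<in> borel_measurable OS"
  by (rule measurable_compose_countable[where f="\<lambda>k c. \<Sum>i<k. f (subtree c i)" and g="\<lambda>c. c []"])
     (intro borel_measurable_sum measurable_compose[OF measurable_subtree assms] measurable_label)+

lemma measurable_hn [measurable]: "(\<lambda>c. hn n c z) \<in> borel_measurable OS"
proof (induction n)
  case (Suc n)
  have "(\<lambda>c. \<Sum>i<rdeg c. hn n (subtree c i) z) \<in> borel_measurable OS"
    by (rule measurable_children_sum[OF Suc])
  thus ?case unfolding hn.simps by (intro borel_measurable_divide borel_measurable_add borel_measurable_const)
qed simp

lemma measurable_h [measurable]: "(\<lambda>c. h c z) \<in> borel_measurable OS"
  unfolding h_def by (rule borel_measurable_lim_metric) (rule measurable_hn)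

lemma measurable_hseq [measurable]: "(\<lambda>c. hseq l c n) \<in> borel_measurable OS"
  unfolding hseq_def by (rule measurable_h)

end

context spectral_point
begin

lemma measurable_Im_hseq: "(\<lambda>c. Im (hseq l c n)) \<in> borel_measurable OS"
  by (rule measurable_compose[OF measurable_hseq borel_measurable_Im])

lemma measurable_mu [measurable]: "mu \<in> borel_measurable OS"
  unfolding mu_def[abs_def] mass_def
  by (intro borel_measurable_lim_metric borel_measurable_times borel_measurable_const measurable_Im_hseq)

lemma measurable_sl [measurable]: "sl \<in> borel_measurable OS"
  unfolding sl_def[abs_def] slope_def
  by (intro borel_measurable_lim_metric borel_measurable_divide borel_measurable_const measurable_Im_hseq)

lemma measurable_bv [measurable]: "bv \<in> borel_measurable OS"
  unfolding bv_def[abs_def] bval_def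
  by (intro borel_measurable_lim_metric measurable_compose[OF measurable_hseq borel_measurable_Re])

lemma measurable_sf [measurable]: "Measurable.pred OS sf"
proof -
  note [measurable] = measurable_Im_hseq
  show ?thesis unfolding sf_def[abs_def] slope_finite_def by measurable
qed

lemma measurable_cmass [measurable]: "cmass \<in> borel_measurable OS"
  unfolding cmass_def[abs_def] by (rule measurable_children_sum[OF measurable_mu])

lemma measurable_bsize [measurable]: "bsize K \<in> borel_measurable OS"
proof (induction K)
  case (Suc K)
  note [measurable] = measurable_children_sum[OF Suc]
  have "(\<lambda>c. if 0 < cmass c then 0 else 1 + (\<Sum>i<rdeg c. bsize K (subtree c i))) \<in> borel_measurable OS"
    by measurable
  thus ?case by (simp cong: measurable_cong)
qed simp

lemma measurable_shallow [measurable]: "Measurable.pred OS (shallow D)"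
proof (induction D)
  case (Suc D)
  have "Measurable.pred OS (\<lambda>c. shallow D (subtree c i))" for i
    by (rule measurable_compose[OF measurable_subtree Suc])
  hence A: "Measurable.pred OS (\<lambda>c. \<forall>i<rdeg c. shallow D (subtree c i))"
    by (intro measurable_compose_countable[where f="\<lambda>k c. \<forall>i<k. shallow D (subtree c i)" and g=rdeg]
        pred_intros_finite measurable_rdeg) auto
  have "Measurable.pred OS (\<lambda>c. 0 < cmass c)" by measurable
  hence "Measurable.pred OS (\<lambda>c. 0 < cmass c \<or> (\<forall>i<rdeg c. shallow D (subtree c i)))"
    by (intro pred_intros_logic A)
  moreover have "shallow (Suc D) = (\<lambda>c. 0 < cmass c \<or> (\<forall>i<rdeg c. shallow D (subtree c i)))"
    by (rule ext) simp
  ultimately show ?case by (simp only:)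
qed simp

lemma measurable_linked [measurable]:
  "Measurable.pred (OS \<Otimes>\<^sub>M OS) (\<lambda>x. linked (fst x) (snd x))"
proof -
  note [measurable] = measurable_compose[OF measurable_fst measurable_cmass] measurable_compose[OF measurable_snd measurable_cmass]
    measurable_compose[OF measurable_fst measurable_sf] measurable_compose[OF measurable_snd measurable_sf]
    measurable_compose[OF measurable_fst measurable_bv] measurable_compose[OF measurable_snd measurable_bv]
  show ?thesis unfolding linked_def by measurable
qed

lemma measurable_frontier_flow [measurable]:
  "(\<lambda>x. frontier_flow (fst x) (snd x)) \<in> borel_measurable (OS \<Otimes>\<^sub>M OS)"
proof -
  note [measurable] = measurable_compose[OF measurable_fst measurable_cmass] measurable_compose[OF measurable_snd measurable_mu]
  show ?thesis unfolding frontier_flow_def by measurable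
qed

lemma measurable_block_flow [measurable]:
  "(\<lambda>x. block_flow (fst x) (snd x)) \<in> borel_measurable (OS \<Otimes>\<^sub>M OS)"
proof -
  note [measurable] = measurable_compose[OF measurable_fst measurable_sl] measurable_compose[OF measurable_snd measurable_sl]
    measurable_compose[OF measurable_fst measurable_bv]
  show ?thesis unfolding block_flow_def by measurable
qed

lemma measurable_size_flow [measurable]:
  "(\<lambda>x. size_flow K (fst x) (snd x)) \<in> borel_measurable (OS \<Otimes>\<^sub>M OS)"
proof -
  note [measurable] = measurable_compose[OF measurable_fst measurable_bsize] measurable_compose[OF measurable_snd measurable_bsize]
  show ?thesis unfolding size_flow_def by measurable
qed

lemma flow_bounds:
  "0 \<le> frontier_flow t t'" "0 \<le> block_flow t t'" "0 \<le> size_flow K t t'"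
  using cmass_nonneg mu_nonneg bsize_nonneg
  by (auto simp: frontier_flow_def block_flow_def size_flow_def linked_def
      intro!: divide_nonneg_nonneg add_nonneg_nonneg mult_nonneg_nonneg dest: sf_imp(1))

end

locale ugw_point = spectral_point d l for d l +
  fixes p q :: "nat pmf" and m :: real
  assumes p_le: "set_pmf p \<subseteq> {..d}" and p1: "pmf p 1 = 0" and m_pos: "0 < m"
    and q_eq: "\<And>k. pmf q k = real (k + 1) * pmf p (k + 1) / m"
begin

abbreviation X where "X \<equiv> offspring_law p q"
abbreviation Q where "Q \<equiv> offspring_law q q"

sublocale X: prob_space X by (rule prob_space_offspring_law)
sublocale Q: prob_space Q by (rule prob_space_offspring_law)

lemma measurable_X: "measurable X M = measurable OS M"
  by (rule measurable_cong_sets[OF sets_offspring_law refl])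

section \<open>Expected flows across the root edges\<close>

definition edge_sum :: "(offspring \<Rightarrow> offspring \<Rightarrow> real) \<Rightarrow> ennreal" where
  "edge_sum F = (\<integral>\<^sup>+c. (\<Sum>i<c []. ennreal (F (subtree c i) (prune c i))) \<partial>X)"

lemma edge_sum_eq:
  assumes "(\<lambda>x. F (fst x) (snd x)) \<in> borel_measurable (OS \<Otimes>\<^sub>M OS)"
  shows "edge_sum F = ennreal m * (\<integral>\<^sup>+t. \<integral>\<^sup>+t'. ennreal (F t t') \<partial>Q \<partial>Q)"
  unfolding edge_sum_def
  using nn_integral_edge[OF measurable_compose[OF assms measurable_ennreal] p_le m_pos q_eq] by simp

text \<open>By \<open>edge_sum_eq\<close> the two sides of a root edge are independent with the same
  law, so what the root sends on average equals what it receives.\<close>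

lemma edge_sum_swap:
  assumes F: "(\<lambda>x. F (fst x) (snd x)) \<in> borel_measurable (OS \<Otimes>\<^sub>M OS)"
  shows "edge_sum F = edge_sum (\<lambda>t t'. F t' t)"
proof -
  interpret pair_sigma_finite Q Q ..
  have F': "(\<lambda>x. F (snd x) (fst x)) \<in> borel_measurable (OS \<Otimes>\<^sub>M OS)"
    using measurable_compose[OF measurable_pair_swap' F] by (simp add: case_prod_unfold)
  have "(\<lambda>x. ennreal (F (snd x) (fst x))) \<in> borel_measurable (Q \<Otimes>\<^sub>M Q)"
    using measurable_compose[OF F' measurable_ennreal]
    by (simp only: measurable_cong_sets[OF sets_pair_measure_cong[OF sets_offspring_law sets_offspring_law] refl])
  hence "(\<integral>\<^sup>+t. \<integral>\<^sup>+t'. ennreal (F t t') \<partial>Q \<partial>Q) = (\<integral>\<^sup>+t. \<integral>\<^sup>+t'. ennreal (F t' t) \<partial>Q \<partial>Q)"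
    using Fubini'[of "\<lambda>t t'. ennreal (F t' t)"] by (simp add: case_prod_unfold)
  thus ?thesis unfolding edge_sum_eq[OF F] using edge_sum_eq[of "\<lambda>t t'. F t' t", OF F'] by simp
qed

lemma edge_sum_measurable:
  assumes "(\<lambda>x. F (fst x) (snd x)) \<in> borel_measurable (OS \<Otimes>\<^sub>M OS)"
  shows "(\<lambda>c. \<Sum>i<c []. ennreal (F (subtree c i) (prune c i))) \<in> borel_measurable OS"
proof -
  have "(\<lambda>c. ennreal (F (subtree c i) (prune c i))) \<in> borel_measurable OS" for i
    using measurable_compose[OF measurable_Pair[OF measurable_subtree measurable_prune] measurable_compose[OF assms measurable_ennreal], of i i]
    by simp
  thus ?thesis
    by (intro measurable_compose_countable[where f="\<lambda>k c. \<Sum>i<k. ennreal (F (subtree c i) (prune c i))" and g="\<lambda>c. c []"]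
        borel_measurable_sum measurable_label)
qed

lemma edge_sum_add:
  assumes F: "(\<lambda>x. F (fst x) (snd x)) \<in> borel_measurable (OS \<Otimes>\<^sub>M OS)"
    and G: "(\<lambda>x. G (fst x) (snd x)) \<in> borel_measurable (OS \<Otimes>\<^sub>M OS)"
    and nn: "\<And>t t'. 0 \<le> F t t'" "\<And>t t'. 0 \<le> G t t'"
  shows "edge_sum F + edge_sum G = edge_sum (\<lambda>t t'. F t t' + G t t')"
proof -
  have "edge_sum F + edge_sum G = (\<integral>\<^sup>+c. (\<Sum>i<c []. ennreal (F (subtree c i) (prune c i))) +
      (\<Sum>i<c []. ennreal (G (subtree c i) (prune c i))) \<partial>X)"
    unfolding edge_sum_def
    by (rule nn_integral_add[symmetric]; unfold measurable_X) (rule edge_sum_measurable[OF F] edge_sum_measurable[OF G])+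
  also have "\<dots> = edge_sum (\<lambda>t t'. F t t' + G t t')"
    unfolding edge_sum_def sum.distrib[symmetric] ennreal_plus[OF nn] ..
  finally show ?thesis .
qed

text \<open>The expectation depends only on which edges are linked, not on how the unit of an edge
  is divided. This is what lets \<open>size_flow\<close> take the place of
  \<open>block_flow\<close>.\<close>

lemma edge_sum_half:
  assumes F: "(\<lambda>x. F (fst x) (snd x)) \<in> borel_measurable (OS \<Otimes>\<^sub>M OS)"
    and nn: "\<And>t t'. 0 \<le> F t t'" and sw: "\<And>t t'. F t t' + F t' t = (if linked t t' then 1 else 0)"
  shows "2 * edge_sum F = edge_sum (\<lambda>t t'. if linked t t' then 1 else 0)"
proof -
  have F': "(\<lambda>x. F (snd x) (fst x)) \<in> borel_measurable (OS \<Otimes>\<^sub>M OS)"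
    using measurable_compose[OF measurable_pair_swap' F] by (simp add: case_prod_unfold)
  have "2 * edge_sum F = edge_sum F + edge_sum (\<lambda>t t'. F t' t)"
    using edge_sum_swap[OF F] by (simp add: mult_2)
  also have "\<dots> = edge_sum (\<lambda>t t'. F t t' + F t' t)"
    by (rule edge_sum_add[OF F _ nn nn]) (rule F')
  finally show ?thesis unfolding sw .
qed

text \<open>Finiteness permits cancelling the common edge sum from an inequality in
  \<open>ennreal\<close>.\<close>

lemma edge_sum_linked_finite: "edge_sum (\<lambda>t t'. if linked t t' then 1 else 0) < \<infinity>"
proof -
  have "(\<integral>\<^sup>+t. \<integral>\<^sup>+t'. ennreal (if linked t t' then 1 else 0) \<partial>Q \<partial>Q) \<le> (\<integral>\<^sup>+t. \<integral>\<^sup>+t'. 1 \<partial>Q \<partial>Q)"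
    by (intro nn_integral_mono) auto
  also have "\<dots> = 1" using Q.emeasure_space_1 by simp
  finally have "(\<integral>\<^sup>+t. \<integral>\<^sup>+t'. ennreal (if linked t t' then 1 else 0) \<partial>Q \<partial>Q) < \<infinity>"
    using le_less_trans[OF _ ennreal_one_less_top] by simp
  moreover have "(\<lambda>x. if linked (fst x) (snd x) then 1 else 0 :: real) \<in> borel_measurable (OS \<Otimes>\<^sub>M OS)"
    by (rule measurable_If[OF measurable_const measurable_const measurable_linked[unfolded pred_def]]) auto
  note edge_sum_eq[OF this]
  ultimately show ?thesis by (simp add: ennreal_mult_less_top)
qed

lemma AE_labels: "AE c in X. \<forall>u. c u \<le> d" "AE c in Q. \<forall>u. c u \<le> d"
proof -
  have "set_pmf q \<subseteq> {..d}"
  proof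
    fix k assume "k \<in> set_pmf q"
    hence "pmf p (k + 1) \<noteq> 0" using q_eq[of k] m_pos by (auto simp: set_pmf_iff)
    hence "k + 1 \<in> set_pmf p" by (simp add: set_pmf_iff)
    thus "k \<in> {..d}" using p_le by auto
  qed
  hence "AE c in offspring_law r q. \<forall>u. c u \<le> d" if "set_pmf r \<subseteq> {..d}" for r
    unfolding AE_all_countable offspring_law_def using that
    by (intro allI AE_PiM_component) (auto simp: prob_space_measure_pmf AE_measure_pmf_iff)
  thus "AE c in X. \<forall>u. c u \<le> d" "AE c in Q. \<forall>u. c u \<le> d" using p_le \<open>set_pmf q \<subseteq> {..d}\<close> by auto
qed

lemma AE_root: "AE c in X. c [] \<noteq> 1"
  unfolding offspring_law_def using p1
  by (intro AE_PiM_component[where i="[]" and P="\<lambda>k. k \<noteq> 1"])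
     (auto simp: prob_space_measure_pmf AE_measure_pmf_iff set_pmf_iff)

lemma measurable_two_massive: "Measurable.pred OS two_massive"
proof -
  note [measurable] = measurable_compose[OF measurable_subtree measurable_mu]
  have "Measurable.pred OS (\<lambda>c. \<exists>i<k. \<exists>j<k. i \<noteq> j \<and> 0 < mu (subtree c i) \<and> 0 < mu (subtree c j))" for k
    by measurable
  thus ?thesis unfolding two_massive_def[abs_def]
    by (intro measurable_compose_countable[where g="\<lambda>c. c []" and
        f="\<lambda>k c. \<exists>i<k. \<exists>j<k. i \<noteq> j \<and> 0 < mu (subtree c i) \<and> 0 < mu (subtree c j)"] measurable_label)
qed

text \<open>The density of blocks is estimated by distributing each block's unit evenly over its vertices.\<close>

lemma expected_mass_balance:
  "(\<integral>\<^sup>+c. ennreal (mu c) \<partial>X) + (\<integral>\<^sup>+c. ennreal (if two_massive c then 1 else 0) \<partial>X) \<le>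
    (\<integral>\<^sup>+c. ennreal (if 0 < mu c then 1 / (1 + (\<Sum>i<c []. bsize (Suc K) (subtree c i))) else 0) \<partial>X)"
    (is "?A + ?T \<le> ?R")
proof -
  let ?one = "\<lambda>c. ennreal (if 0 < mu c then 1 else 0)"
  have mu: "(\<lambda>c. ennreal (mu c)) \<in> borel_measurable X"
    unfolding measurable_X by (rule measurable_compose[OF measurable_mu measurable_ennreal])
  have fr: "(\<lambda>c. \<Sum>i<c []. ennreal (frontier_flow (subtree c i) (prune c i))) \<in> borel_measurable X"
    "(\<lambda>c. \<Sum>i<c []. ennreal (block_flow (subtree c i) (prune c i))) \<in> borel_measurable X"
    "(\<lambda>c. \<Sum>i<c []. ennreal (size_flow (Suc K) (subtree c i) (prune c i))) \<in> borel_measurable X"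
    unfolding measurable_X
    by (rule edge_sum_measurable, rule measurable_frontier_flow measurable_block_flow measurable_size_flow)+
  have "?A + edge_sum frontier_flow + edge_sum block_flow = (\<integral>\<^sup>+c. ?one c \<partial>X)"
  proof -
    have "?A + edge_sum frontier_flow + edge_sum block_flow =
      (\<integral>\<^sup>+c. ennreal (mu c) + (\<Sum>i<c []. ennreal (frontier_flow (subtree c i) (prune c i))) +
         (\<Sum>i<c []. ennreal (block_flow (subtree c i) (prune c i))) \<partial>X)"
      unfolding edge_sum_def
      by (subst nn_integral_add[OF borel_measurable_add[OF mu fr(1)] fr(2)], subst nn_integral_add[OF mu fr(1)]) (rule refl)
    also have "\<dots> = (\<integral>\<^sup>+c. ?one c \<partial>X)"
    proof (rule nn_integral_cong_AE)
      show "AE c in X. ennreal (mu c) + (\<Sum>i<c []. ennreal (frontier_flow (subtree c i) (prune c i))) +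
         (\<Sum>i<c []. ennreal (block_flow (subtree c i) (prune c i))) = ?one c"
        using AE_labels(1)
      proof eventually_elim
        case (elim c)
        have "mu c + (\<Sum>i<c []. frontier_flow (subtree c i) (prune c i)) +
            (\<Sum>i<c []. block_flow (subtree c i) (prune c i)) = (if 0 < mu c then 1 else 0)"
          using mass_balance[of c] elim by auto
        thus ?case
          by (subst (1 2) sum_ennreal) (auto simp: flow_bounds mu_nonneg sum_nonneg ennreal_plus[symmetric] simp del: ennreal_plus)
      qed
    qed
    finally show ?thesis .
  qed
  moreover have "edge_sum frontier_flow = ?T"
  proof -
    have "edge_sum frontier_flow = edge_sum (\<lambda>t t'. frontier_flow t' t)"
      by (rule edge_sum_swap[OF measurable_frontier_flow])
    also have "\<dots> = ?T"
      unfolding edge_sum_def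
    proof (rule nn_integral_cong_AE)
      show "AE c in X. (\<Sum>i<c []. ennreal (frontier_flow (prune c i) (subtree c i))) = ennreal (if two_massive c then 1 else 0)"
        using AE_labels(1)
      proof eventually_elim
        case (elim c)
        thus ?case using reverse_frontier_flow[of c] by (subst sum_ennreal) (auto simp: flow_bounds)
      qed
    qed
    finally show ?thesis .
  qed
  moreover have "2 * edge_sum block_flow = 2 * edge_sum (size_flow (Suc K))"
    using edge_sum_half[OF measurable_block_flow flow_bounds(2) block_flow_swap]
      edge_sum_half[OF measurable_size_flow flow_bounds(3) size_flow_swap, of K] by simp
  hence "edge_sum block_flow = edge_sum (size_flow (Suc K))"
    by (simp add: ennreal_mult_cancel_left)
  moreover have "(\<integral>\<^sup>+c. ?one c \<partial>X) \<le> edge_sum (size_flow (Suc K)) + ?R"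
  proof -
    have R: "(\<lambda>c. ennreal (if 0 < mu c then 1 / (1 + (\<Sum>i<c []. bsize (Suc K) (subtree c i))) else 0)) \<in> borel_measurable X"
    proof -
      note [measurable] = measurable_root_sum[OF measurable_bsize[of "Suc K"]]
      show ?thesis unfolding measurable_X by measurable
    qed
    have "(\<integral>\<^sup>+c. ?one c \<partial>X) \<le> (\<integral>\<^sup>+c. (\<Sum>i<c []. ennreal (size_flow (Suc K) (subtree c i) (prune c i))) +
        ennreal (if 0 < mu c then 1 / (1 + (\<Sum>i<c []. bsize (Suc K) (subtree c i))) else 0) \<partial>X)"
    proof (rule nn_integral_mono_AE)
      show "AE c in X. ?one c \<le> (\<Sum>i<c []. ennreal (size_flow (Suc K) (subtree c i) (prune c i))) +
        ennreal (if 0 < mu c then 1 / (1 + (\<Sum>i<c []. bsize (Suc K) (subtree c i))) else 0)"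
        using AE_labels(1)
      proof eventually_elim
        case (elim c)
        define S where "S = (\<Sum>i<c []. bsize (Suc K) (subtree c i))"
        define W where "W = (\<Sum>i<c []. size_flow (Suc K) (subtree c i) (prune c i))"
        have S: "0 \<le> S" unfolding S_def by (intro sum_nonneg bsize_nonneg)
        have W: "0 \<le> W" unfolding W_def by (intro sum_nonneg flow_bounds)
        have Weq: "(\<Sum>i<c []. ennreal (size_flow (Suc K) (subtree c i) (prune c i))) = ennreal W"
          unfolding W_def by (rule sum_ennreal) (rule flow_bounds)
        show ?case
        proof (cases "0 < mu c")
          case True
          have "1 \<le> W + 1 / (1 + S)"
            using size_flow_massive[of c K] elim True unfolding S_def W_def by simp
          thus ?thesis unfolding Weq S_def[symmetric] using True S W
            by (simp add: ennreal_plus[symmetric] ennreal_leI ennreal_1[symmetric] del: ennreal_plus ennreal_1)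
        qed simp
      qed
    qed
    also have "\<dots> = edge_sum (size_flow (Suc K)) + ?R"
      unfolding edge_sum_def by (rule nn_integral_add[OF fr(3) R])
    finally show ?thesis .
  qed
  ultimately have "edge_sum (size_flow (Suc K)) + (?A + ?T) \<le> edge_sum (size_flow (Suc K)) + ?R"
    by (simp only: add_ac)
  moreover have "edge_sum (size_flow (Suc K)) < \<infinity>"
  proof (rule le_less_trans)
    show "edge_sum (size_flow (Suc K)) \<le> 2 * edge_sum (size_flow (Suc K))" by (simp add: mult_2)
    show "2 * edge_sum (size_flow (Suc K)) < \<infinity>"
      using edge_sum_half[OF measurable_size_flow flow_bounds(3) size_flow_swap, of K] edge_sum_linked_finite by simp
  qed
  ultimately show ?thesis
    using ennreal_add_left_cancel_le[of "edge_sum (size_flow (Suc K))" "?A + ?T" ?R] by auto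
qed

end

section \<open>Finiteness of the pure-point support\<close>

context ugw_point
begin

lemma space_OS: "space OS = UNIV"
  by (simp add: space_PiM)

lemma pred_sets: "Measurable.pred OS P \<Longrightarrow> {c. P c} \<in> sets (offspring_law t q)"
  unfolding sets_offspring_law by (simp add: pred_def space_OS)

text \<open>Given the root degree \<open>k\<close>, the branches with index in \<open>I k\<close>
  are independent with law \<open>Q\<close>, even those with index beyond \<open>k\<close>, since
  the forest is infinite.\<close>

lemma emeasure_children:
  assumes P: "Measurable.pred OS P" and I: "\<And>k. finite (I k)"
  shows "emeasure (offspring_law t q) {c. R (c []) \<and> (\<forall>i\<in>I (c []). P (subtree c i))} =
      (\<integral>\<^sup>+k. (if R k then ennreal (Q.prob {c. P c} ^ card (I k)) else 0) \<partial>measure_pmf t)" (is "_ = ?rhs")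
    "Measurable.pred OS (\<lambda>c. R (c []) \<and> (\<forall>i\<in>I (c []). P (subtree c i)))"
proof -
  interpret F: prob_space "forest_law q" by (rule prob_space_forest_law)
  have "Measurable.pred OS (\<lambda>c. P (subtree c i))" for i
    by (rule measurable_compose[OF measurable_subtree P])
  thus M: "Measurable.pred OS (\<lambda>c. R (c []) \<and> (\<forall>i\<in>I (c []). P (subtree c i)))"
    by (intro measurable_compose_countable[where f="\<lambda>k c. R k \<and> (\<forall>i\<in>I k. P (subtree c i))" and g="\<lambda>c. c []"]
        pred_intros_logic pred_intros_finite I measurable_label) auto
  let ?B = "{c. R (c []) \<and> (\<forall>i\<in>I (c []). P (subtree c i))}"
  have "emeasure (offspring_law t q) ?B = (\<integral>\<^sup>+c. indicator ?B c \<partial>offspring_law t q)"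
    using pred_sets[OF M] by simp
  also have "\<dots> = (\<integral>\<^sup>+k. \<integral>\<^sup>+s. indicator ?B (graft k s) \<partial>forest_law q \<partial>measure_pmf t)"
    by (rule nn_integral_branching) (use pred_sets[OF M] in \<open>simp add: sets_offspring_law\<close>)
  also have "\<dots> = ?rhs"
  proof (rule nn_integral_cong)
    fix k
    have cyl: "emeasure (forest_law q) {s. \<forall>i\<in>I k. s i \<in> {c. P c}} = emeasure Q {c. P c} ^ card (I k)"
      "{s. \<forall>i\<in>I k. s i \<in> {c. P c}} \<in> sets (forest_law q)"
      unfolding forest_law_def
      using emeasure_PiM_cylinder[of "\<lambda>_. Q" "I k" "\<lambda>_. {c. P c}"] I pred_sets[OF P]
      by (simp_all add: prob_space_offspring_law)
    have "(\<integral>\<^sup>+s. indicator ?B (graft k s) \<partial>forest_law q) =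
        (\<integral>\<^sup>+s. (if R k then indicator {s. \<forall>i\<in>I k. s i \<in> {c. P c}} s else 0) \<partial>forest_law q)"
      by (intro nn_integral_cong) (auto simp: indicator_def)
    also have "\<dots> = (if R k then emeasure Q {c. P c} ^ card (I k) else 0)"
      using cyl by (cases "R k") simp_all
    also have "emeasure Q {c. P c} ^ card (I k) = ennreal (Q.prob {c. P c} ^ card (I k))"
      by (simp add: Q.emeasure_eq_measure ennreal_power)
    finally show "(\<integral>\<^sup>+s. indicator ?B (graft k s) \<partial>forest_law q) = (if R k then ennreal (Q.prob {c. P c} ^ card (I k)) else 0)" .
  qed
  finally show "emeasure (offspring_law t q) ?B = ?rhs" .
qed

section \<open>Probabilities of shallow and of massive branches\<close>

definition r :: "nat \<Rightarrow> real" where "r K = Q.prob {c. shallow K c}"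
definition pm :: real where "pm = Q.prob {c. 0 < mu c}"

lemma r_bounds: "0 \<le> r K" "r K \<le> 1"
  by (simp_all add: r_def)

lemma q0: "pmf q 0 = 0"
  using q_eq[of 0] p1 by simp

lemma pred_mu: "Measurable.pred OS (\<lambda>c. 0 < mu c)"
  by measurable

lemma shallow_root_bound:
  "emeasure X {c. 2 \<le> c [] \<and> (\<forall>i\<in>{..<c []}. shallow K (subtree c i))} \<le> ennreal ((r K)\<^sup>2)"
proof -
  have "emeasure X {c. 2 \<le> c [] \<and> (\<forall>i\<in>{..<c []}. shallow K (subtree c i))} =
      (\<integral>\<^sup>+k. (if 2 \<le> k then ennreal (r K ^ card {..<k}) else 0) \<partial>measure_pmf p)"
    unfolding r_def by (rule emeasure_children(1)[OF measurable_shallow]) simp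
  also have "\<dots> \<le> (\<integral>\<^sup>+k. ennreal ((r K)\<^sup>2) \<partial>measure_pmf p)"
    using r_bounds[of K] by (intro nn_integral_mono) (auto intro!: ennreal_leI power_decreasing)
  finally show ?thesis by (simp add: measure_pmf.emeasure_space_1)
qed

text \<open>A shallow branch has its root on the frontier or only shallow children. Since
  \<open>pmf q 0 = 0\<close> there is at least one child; degree 1 contributes \<open>r K\<close>,
  and larger degrees at most its square by independence.\<close>

lemma r_Suc: "r (Suc K) \<le> r 0 + (r K)\<^sup>2 + (r K - (r K)\<^sup>2) * pmf q 1"
proof -
  let ?B = "{c. True \<and> (\<forall>i\<in>{..<c []}. shallow K (subtree c i))}"
  have B: "?B \<in> sets Q"
    by (rule pred_sets, rule emeasure_children(2)[OF measurable_shallow]) simp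
  have rr: "(r K)\<^sup>2 \<le> r K" using r_bounds[of K] by (simp add: power2_eq_square mult_left_le)
  have "emeasure Q {c. shallow (Suc K) c} \<le> emeasure Q ({c. shallow 0 c} \<union> ?B)"
  proof (rule emeasure_mono_AE)
    show "AE c in Q. c \<in> {c. shallow (Suc K) c} \<longrightarrow> c \<in> {c. shallow 0 c} \<union> ?B"
      using AE_labels(2)
    proof eventually_elim
      case (elim c)
      have "rdeg c = c []" using elim by (simp add: rdeg_def)
      thus ?case by auto
    qed
  qed (use B pred_sets[OF measurable_shallow[of 0]] in blast)
  also have "\<dots> \<le> emeasure Q {c. shallow 0 c} + emeasure Q ?B"
    by (rule emeasure_subadditive) (use B pred_sets[OF measurable_shallow[of 0]] in auto)
  also have "emeasure Q ?B = (\<integral>\<^sup>+k. (if True then ennreal (r K ^ card {..<k}) else 0) \<partial>measure_pmf q)"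
    unfolding r_def by (rule emeasure_children(1)[OF measurable_shallow]) simp
  also have "\<dots> \<le> (\<integral>\<^sup>+k. (ennreal ((r K)\<^sup>2) + ennreal (r K - (r K)\<^sup>2) * indicator {1} k) \<partial>measure_pmf q)"
  proof (rule nn_integral_mono_AE)
    have "AE k in measure_pmf q. k \<noteq> 0" using q0 by (auto simp: AE_measure_pmf_iff set_pmf_iff intro: gr0I)
    thus "AE k in measure_pmf q. (if True then ennreal (r K ^ card {..<k}) else 0) \<le>
        ennreal ((r K)\<^sup>2) + ennreal (r K - (r K)\<^sup>2) * indicator {1} k"
    proof eventually_elim
      case (elim k)
      show ?case
      proof (cases "k = 1")
        case True
        thus ?thesis using rr r_bounds[of K] by (simp add: ennreal_plus[symmetric] del: ennreal_plus)
      next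
        case False
        hence "2 \<le> k" using elim by simp
        thus ?thesis using False r_bounds[of K] by (auto intro!: ennreal_leI power_decreasing)
      qed
    qed
  qed
  also have "\<dots> = ennreal ((r K)\<^sup>2) + ennreal (r K - (r K)\<^sup>2) * ennreal (pmf q 1)"
    by (subst nn_integral_add) (auto simp: nn_integral_cmult_indicator emeasure_pmf_single measure_pmf.emeasure_space_1)
  finally have "ennreal (r (Suc K)) \<le> ennreal (r 0) + (ennreal ((r K)\<^sup>2) + ennreal (r K - (r K)\<^sup>2) * ennreal (pmf q 1))"
    unfolding r_def Q.emeasure_eq_measure by (simp add: add_left_mono)
  also have "\<dots> = ennreal (r 0 + (r K)\<^sup>2 + (r K - (r K)\<^sup>2) * pmf q 1)"
    using rr r_bounds[of 0] r_bounds[of K]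
    by (simp add: ennreal_plus[symmetric] ennreal_mult[symmetric] add.assoc del: ennreal_plus)
  finally show ?thesis
    using rr r_bounds[of 0] by (subst (asm) ennreal_le_iff) auto
qed

text \<open>The tree is then a deterministic ray, equal to its own subtree. Positive
  \<open>cmass\<close> would force mass 0 at the root, hence at its child, and so
  \<open>cmass\<close> 0.\<close>

lemma r0_line:
  assumes "pmf q 1 = 1"
  shows "r 0 = 0"
proof -
  define one :: "nat list \<Rightarrow> nat" where "one = (\<lambda>_. 1)"
  have "AE k in measure_pmf q. k \<in> {1}"
    by (rule measure_pmf.AE_prob_1) (use assms in \<open>simp add: measure_pmf_single\<close>)
  hence "AE c in Q. \<forall>u. c u = 1"
    unfolding AE_all_countable offspring_law_def
    by (intro allI AE_PiM_component) (auto simp: prob_space_measure_pmf)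
  hence one: "AE c in Q. c = one" by (simp add: one_def fun_eq_iff)
  have sub: "subtree one i = one" for i by (simp add: one_def subtree_def)
  have n: "\<not> 0 < cmass one"
  proof
    assume c: "0 < cmass one"
    have "cmass one = 0" unfolding cmass_def sub cmass_pos(4)[OF c] by simp
    thus False using c by simp
  qed
  from one have "AE c in Q. \<not> shallow 0 c" by eventually_elim (use n in simp)
  thus ?thesis unfolding r_def by (subst Q.prob_eq_0[OF pred_sets[OF measurable_shallow]]) simp
qed

text \<open>A bound uniform in \<open>K\<close> and quadratic in \<open>r 0\<close>, obtained from
  the recursion of \<open>r_Suc\<close>: the linear coefficient \<open>pmf q 1\<close> is below 1
  except on the ray, so small values stay of order \<open>r 0\<close>.\<close>

lemma r_bound: "(r K)\<^sup>2 \<le> 16 / (1 - pmf q 1)\<^sup>2 * (r 0)\<^sup>2"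
proof (cases "pmf q 1 = 1")
  \<comment> \<open>The right-hand side is 0 here because 16 / 0 = 0, so the claim amounts to
    \<open>r K = 0\<close>.\<close>
  case True
  have "r K = 0"
  proof (induction K)
    case 0
    show ?case by (rule r0_line[OF True])
  next
    case (Suc K)
    thus ?case using r_Suc[of K] r0_line[OF True] r_bounds(1)[of "Suc K"] True by simp
  qed
  thus ?thesis by simp
next
  case False
  define b where "b = 1 - pmf q 1"
  have b: "0 < b" "b \<le> 1" using False pmf_le_1[of q 1] by (auto simp: b_def less_le)
  define x where "x = r 0"
  have x: "0 \<le> x" unfolding x_def by (rule r_bounds)
  show ?thesis
  proof (cases "4 * x \<le> b")
    case True
    \<comment> \<open>An invariant level of x + (1 - b) t + b t^2: with b y = 2 x and 2 y \<le> 1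
      the value at y is y - x + 2 x y \<le> y.\<close>
    define y where "y = 2 * x / b"
    have y: "0 \<le> y" "b * y = 2 * x" using x b by (auto simp: y_def)
    have "r K \<le> y"
    proof (induction K)
      case 0
      have "x * b \<le> x * 2" using x b by (intro mult_left_mono) auto
      thus ?case using b unfolding y_def x_def[symmetric] by (simp add: pos_le_divide_eq mult.commute)
    next
      case (Suc K)
      have "r (Suc K) \<le> x + (r K)\<^sup>2 + (r K - (r K)\<^sup>2) * (1 - b)"
        using r_Suc[of K] by (simp add: b_def x_def)
      also have "\<dots> = x + (1 - b) * r K + b * (r K)\<^sup>2" by (simp add: algebra_simps)
      also have "\<dots> \<le> x + (1 - b) * y + b * y\<^sup>2"
        using Suc r_bounds(1)[of K] b by (intro add_mono mult_left_mono power_mono) auto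
      also have "\<dots> = y - x + 2 * x * y" using y by (simp add: algebra_simps power2_eq_square)
      also have "\<dots> \<le> y"
      proof -
        have "2 * y \<le> 1" using True b by (simp add: y_def)
        hence "x * (2 * y) \<le> x * 1" using x by (intro mult_left_mono) auto
        thus ?thesis by (simp add: mult.commute mult.left_commute)
      qed
      finally show ?case .
    qed
    hence "(r K)\<^sup>2 \<le> y\<^sup>2" using r_bounds by (intro power_mono) auto
    also have "\<dots> \<le> 16 / b\<^sup>2 * x\<^sup>2" by (simp add: y_def power_divide power_mult_distrib divide_right_mono)
    finally show ?thesis by (simp add: b_def x_def)
  next
    case False
    hence "1 \<le> 4 * x / b" using b by simp
    hence "1 \<le> (4 * x / b)\<^sup>2" by (rule one_le_power)
    moreover have "(r K)\<^sup>2 \<le> 1" using r_bounds[of K] by (simp add: power_le_one)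
    ultimately have "(r K)\<^sup>2 \<le> (4 * x / b)\<^sup>2" by linarith
    thus ?thesis by (simp add: b_def x_def power_divide power_mult_distrib)
  qed
qed

lemma prob_child:
  "Q.prob {c. 0 < mu (subtree c i)} = pm"
proof -
  have "emeasure Q {c. True \<and> (\<forall>j\<in>{i}. 0 < mu (subtree c j))} =
      (\<integral>\<^sup>+k. (if True then ennreal (pm ^ card {i}) else 0) \<partial>measure_pmf q)"
    unfolding pm_def
    by (rule emeasure_children(1)[OF pred_mu, of "\<lambda>_. {i}" q "\<lambda>_. True"]) simp
  hence "ennreal (Q.prob {c. 0 < mu (subtree c i)}) = ennreal pm"
    by (simp add: Q.emeasure_eq_measure measure_pmf.emeasure_space_1)
  thus ?thesis by (simp add: pm_def)
qed

text \<open>A frontier vertex has a massive child, and there are at most \<open>d\<close>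
  candidates.\<close>

lemma r0_le: "r 0 \<le> real d * pm"
proof -
  have S: "{c. 0 < mu (subtree c i)} \<in> sets Q" for i
    using pred_sets[OF measurable_compose[OF measurable_subtree pred_mu]] by simp
  have "{c. shallow 0 c} \<subseteq> (\<Union>i<d. {c. 0 < mu (subtree c i)})"
  proof
    fix c assume "c \<in> {c. shallow 0 c}"
    hence "\<exists>i<rdeg c. mu (subtree c i) \<noteq> 0"
      by (auto simp: cmass_def) (metis (no_types, lifting) lessThan_iff less_irrefl sum.neutral)
    thus "c \<in> (\<Union>i<d. {c. 0 < mu (subtree c i)})"
      using mu_nonneg rdeg_le[of c] by (fastforce simp: less_le)
  qed
  hence "r 0 \<le> Q.prob (\<Union>i<d. {c. 0 < mu (subtree c i)})"
    unfolding r_def using S by (intro Q.finite_measure_mono) auto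
  also have "\<dots> \<le> (\<Sum>i<d. Q.prob {c. 0 < mu (subtree c i)})"
    using S by (intro Q.finite_measure_subadditive_finite) auto
  finally show ?thesis by (simp add: prob_child)
qed

text \<open>It suffices that the root has degree \<open>k\<close> and that its first two branches,
  which are independent of each other and of the degree, are massive.\<close>

lemma two_massive_lower:
  assumes k: "2 \<le> k"
  shows "pmf p k * pm\<^sup>2 \<le> X.prob {c. two_massive c}"
proof -
  have "emeasure X {c. c [] = k \<and> (\<forall>i\<in>{0,1}. 0 < mu (subtree c i))} =
      (\<integral>\<^sup>+j. (if j = k then ennreal (pm ^ card {0::nat,1}) else 0) \<partial>measure_pmf p)"
    unfolding pm_def
    by (rule emeasure_children(1)[OF pred_mu, of "\<lambda>_. {0,1}" p "\<lambda>j. j = k"]) simp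
  also have "\<dots> = (\<integral>\<^sup>+j. ennreal (pm\<^sup>2) * indicator {k} j \<partial>measure_pmf p)"
    by (intro nn_integral_cong) (auto simp: indicator_def numeral_2_eq_2)
  also have "\<dots> = ennreal (pmf p k * pm\<^sup>2)"
    by (subst nn_integral_cmult_indicator) (auto simp: emeasure_pmf_single ennreal_mult mult.commute)
  finally have "ennreal (pmf p k * pm\<^sup>2) = emeasure X {c. c [] = k \<and> (\<forall>i\<in>{0,1}. 0 < mu (subtree c i))}" ..
  also have "\<dots> \<le> emeasure X {c. two_massive c}"
  proof (rule emeasure_mono)
    show "{c. c [] = k \<and> (\<forall>i\<in>{0,1}. 0 < mu (subtree c i))} \<subseteq> {c. two_massive c}"
    proof
      fix c assume c: "c \<in> {c. c [] = k \<and> (\<forall>i\<in>{0,1}. 0 < mu (subtree c i))}"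
      have "0 < c []" "1 < c []" using c k by auto
      moreover have "0 < mu (subtree c 0)" "0 < mu (subtree c 1)" using c by auto
      ultimately have "0 < c [] \<and> (\<exists>j<c []. 0 \<noteq> j \<and> 0 < mu (subtree c 0) \<and> 0 < mu (subtree c j))"
        by (intro conjI exI[of _ 1]) auto
      thus "c \<in> {c. two_massive c}" unfolding two_massive_def mem_Collect_eq by (rule exI[of _ 0])
    qed
    show "{c. two_massive c} \<in> sets X" by (rule pred_sets[OF measurable_two_massive])
  qed
  finally show ?thesis by (simp add: X.emeasure_eq_measure)
qed

lemma bsize_mono_le: "K \<le> K' \<Longrightarrow> bsize K c \<le> bsize K' c"
  by (rule lift_Suc_mono_le[of "\<lambda>K. bsize K c", OF bsize_mono])

text \<open>If all child branches are shallow up to \<open>K\<close>, the block is finite, an event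
  of probability at most \<open>(r K)\<^sup>2\<close>, and since \<open>l\<close> is not an
  exceptional eigenvalue some child is not shallow up to \<open>D\<close>, so the block has at least
  D + 2 vertices. Otherwise the block has at least K + 2 vertices.\<close>

lemma block_density_bound:
  assumes l: "l \<notin> block_eigenvalues D" and DK: "D \<le> K"
  shows "(\<integral>\<^sup>+c. ennreal (if 0 < mu c then 1 / (1 + (\<Sum>i<c []. bsize (Suc K) (subtree c i))) else 0) \<partial>X)
    \<le> ennreal ((r K)\<^sup>2 / (real D + 2) + 1 / (real K + 2))" (is "?R \<le> _")
proof -
  let ?A = "{c. 2 \<le> c [] \<and> (\<forall>i\<in>{..<c []}. shallow K (subtree c i))}"
  have A: "?A \<in> sets X"
    by (rule pred_sets, rule emeasure_children(2)[OF measurable_shallow]) simp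
  have "?R \<le> (\<integral>\<^sup>+c. ennreal (1 / (real D + 2)) * indicator ?A c + ennreal (1 / (real K + 2)) \<partial>X)"
  proof (rule nn_integral_mono_AE)
    show "AE c in X. ennreal (if 0 < mu c then 1 / (1 + (\<Sum>i<c []. bsize (Suc K) (subtree c i))) else 0) \<le>
        ennreal (1 / (real D + 2)) * indicator ?A c + ennreal (1 / (real K + 2))"
      using AE_labels(1) AE_root
    proof eventually_elim
      case (elim c)
      define S where "S = (\<Sum>i<c []. bsize (Suc K) (subtree c i))"
      have k: "rdeg c = c []" using elim by (simp add: rdeg_def)
      have big: "1 / (1 + S) \<le> 1 / (real N + 2)" if i: "i < c []" "\<not> shallow N (subtree c i)" and N: "N \<le> K" for i N
      proof -
        have "real (Suc N) \<le> bsize (Suc N) (subtree c i)" by (rule bsize_not_shallow[OF i(2)])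
        also have "\<dots> \<le> bsize (Suc K) (subtree c i)" using N by (intro bsize_mono_le) simp
        also have "\<dots> \<le> S" unfolding S_def by (rule member_le_sum) (use i bsize_nonneg in \<open>auto simp del: bsize.simps\<close>)
        finally show ?thesis by (intro divide_left_mono) auto
      qed
      show ?case
      proof (cases "0 < mu c")
        case True
        show ?thesis
        proof (cases "\<forall>i<c []. shallow K (subtree c i)")
          case sh: True
          have "\<not> (\<forall>i<c []. shallow D (subtree c i))" using shallow_eigenvalue[OF True] l k by auto
          then obtain i where i: "i < c []" "\<not> shallow D (subtree c i)" by auto
          \<comment> \<open>The child \<open>i\<close> excludes an isolated root and
            \<open>AE_root\<close> excludes degree 1, so two branches must be closed off.\<close>
          have "c \<in> ?A" using i(1) elim(2) sh by auto
          moreover have "ennreal (1 / (1 + S)) \<le> ennreal (1 / (real D + 2))" by (rule ennreal_leI[OF big[OF i DK]])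
          hence "ennreal (1 / (1 + S)) \<le> ennreal (1 / (real D + 2)) + ennreal (1 / (real K + 2))"
            by (rule add_increasing2[OF zero_le])
          ultimately show ?thesis using True by (simp add: S_def)
        next
          case False
          then obtain i where i: "i < c []" "\<not> shallow K (subtree c i)" by auto
          have "ennreal (1 / (1 + S)) \<le> ennreal (1 / (real K + 2))" by (rule ennreal_leI[OF big[OF i order_refl]])
          hence "ennreal (1 / (1 + S)) \<le> ennreal (1 / (real D + 2)) * indicator ?A c + ennreal (1 / (real K + 2))"
            by (rule add_increasing[OF zero_le])
          thus ?thesis using True by (simp add: S_def)
        qed
      qed simp
    qed
  qed
  also have "\<dots> = ennreal (1 / (real D + 2)) * emeasure X ?A + ennreal (1 / (real K + 2))"
  proof -
    have "(\<lambda>c. ennreal (1 / (real D + 2)) * indicator ?A c) \<in> borel_measurable X" using A by simp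
    hence "(\<integral>\<^sup>+c. ennreal (1 / (real D + 2)) * indicator ?A c + ennreal (1 / (real K + 2)) \<partial>X) =
       (\<integral>\<^sup>+c. ennreal (1 / (real D + 2)) * indicator ?A c \<partial>X) + (\<integral>\<^sup>+c. ennreal (1 / (real K + 2)) \<partial>X)"
      by (rule nn_integral_add) (rule borel_measurable_const)
    moreover have "(\<integral>\<^sup>+c. ennreal (1 / (real D + 2)) * indicator ?A c \<partial>X) = ennreal (1 / (real D + 2)) * emeasure X ?A"
      by (rule nn_integral_cmult_indicator[OF A])
    moreover have "(\<integral>\<^sup>+c. ennreal (1 / (real K + 2)) \<partial>X) = ennreal (1 / (real K + 2))"
      using X.emeasure_space_1 by simp
    ultimately show ?thesis by (simp only:)
  qed
  also have "\<dots> \<le> ennreal (1 / (real D + 2)) * ennreal ((r K)\<^sup>2) + ennreal (1 / (real K + 2))"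
    by (intro add_right_mono mult_left_mono shallow_root_bound) auto
  also have "\<dots> = ennreal ((r K)\<^sup>2 / (real D + 2) + 1 / (real K + 2))"
    by (simp add: ennreal_plus[symmetric] ennreal_mult[symmetric] del: ennreal_plus)
  finally show ?thesis .
qed

text \<open>With x = \<open>r 0\<close>, T the probability of \<open>two_massive\<close> and C = 16
  / (1 - q_1)^2, letting \<open>K\<close> grow gives expected mass + T \<le> C x^2 / (D + 2). As x
  \<le> d * \<open>pm\<close> and T \<ge> p_k * \<open>pm\<close>^2, the factor \<open>pm\<close>^2
  is common to both sides, and the hypothesis on \<open>D\<close> is exactly what makes the
  right-hand side at most T.\<close>

theorem no_atom:
  assumes l: "l \<notin> block_eigenvalues D" and k: "2 \<le> k" "0 < pmf p k"
    and D: "16 / (1 - pmf q 1)\<^sup>2 * (real d)\<^sup>2 \<le> (real D + 2) * pmf p k"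
  shows "AE c in X. mu c = 0"
proof -
  let ?A = "\<integral>\<^sup>+c. ennreal (mu c) \<partial>X"
  define C where "C = 16 / (1 - pmf q 1)\<^sup>2"
  define T where "T = X.prob {c. two_massive c}"
  define x where "x = r 0"
  have C: "0 \<le> C" by (simp add: C_def)
  have T: "(\<integral>\<^sup>+c. ennreal (if two_massive c then 1 else 0) \<partial>X) = ennreal T"
  proof -
    have "(\<integral>\<^sup>+c. ennreal (if two_massive c then 1 else 0) \<partial>X) = (\<integral>\<^sup>+c. indicator {c. two_massive c} c \<partial>X)"
      by (intro nn_integral_cong) (auto simp: indicator_def)
    thus ?thesis using pred_sets[OF measurable_two_massive] by (simp add: T_def X.emeasure_eq_measure)
  qed
  have AT: "?A + ennreal T \<le> ennreal (C * x\<^sup>2 / (real D + 2) + 1 / (real K + 2))" if "D \<le> K" for K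
  proof -
    have "?A + ennreal T \<le> ennreal ((r K)\<^sup>2 / (real D + 2) + 1 / (real K + 2))"
      using order_trans[OF expected_mass_balance block_density_bound[OF l that]] unfolding T .
    also have "\<dots> \<le> ennreal (C * x\<^sup>2 / (real D + 2) + 1 / (real K + 2))"
      using r_bound[of K] unfolding C_def x_def by (intro ennreal_leI add_right_mono divide_right_mono) auto
    finally show ?thesis .
  qed
  have "?A \<le> ?A + ennreal T" by simp
  also have "\<dots> < \<infinity>" by (rule le_less_trans[OF AT[OF order_refl]]) simp
  finally obtain a where a: "?A = ennreal a" "0 \<le> a" by (cases ?A) auto
  have T0: "0 \<le> T" by (simp add: T_def)
  have "a + T \<le> C * x\<^sup>2 / (real D + 2) + 1 / (real K + 2)" if "D \<le> K" for K
  proof -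
    have "0 \<le> C * x\<^sup>2 / (real D + 2) + 1 / (real K + 2)" using C by (intro add_nonneg_nonneg divide_nonneg_nonneg) auto
    thus ?thesis using AT[OF that] a T0 by (simp add: ennreal_plus[symmetric] ennreal_le_iff del: ennreal_plus)
  qed
  note bound = this
  have "(\<lambda>K. C * x\<^sup>2 / (real D + 2) + 1 / real (K + 2)) \<longlonglongrightarrow> C * x\<^sup>2 / (real D + 2) + 0"
    by (intro tendsto_add tendsto_const LIMSEQ_ignore_initial_segment[OF lim_1_over_n])
  hence "a + T \<le> C * x\<^sup>2 / (real D + 2) + 0"
    by (rule LIMSEQ_le_const) (intro exI[of _ D] allI impI, use bound in \<open>simp add: add.commute\<close>)
  moreover have "C * x\<^sup>2 / (real D + 2) \<le> T"
  proof -
    have "x\<^sup>2 \<le> (real d)\<^sup>2 * pm\<^sup>2"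
      using r0_le r_bounds(1)[of 0] power_mono[of x "real d * pm" 2] by (simp add: x_def power_mult_distrib)
    hence "C * x\<^sup>2 \<le> C * ((real d)\<^sup>2 * pm\<^sup>2)" using C by (rule mult_left_mono)
    also have "\<dots> = (C * (real d)\<^sup>2) * pm\<^sup>2" by (simp add: mult.assoc)
    also have "\<dots> \<le> ((real D + 2) * pmf p k) * pm\<^sup>2" using D unfolding C_def by (rule mult_right_mono) simp
    also have "\<dots> = (real D + 2) * (pmf p k * pm\<^sup>2)" by (simp add: mult.assoc)
    also have "\<dots> \<le> (real D + 2) * T" unfolding T_def by (intro mult_left_mono two_massive_lower[OF k(1)]) auto
    finally show ?thesis by (simp add: pos_divide_le_eq mult.commute)
  qed
  ultimately have "?A = 0" using a by simp
  hence "AE c in X. ennreal (mu c) = 0"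
    by (subst (asm) nn_integral_0_iff_AE) (auto simp: measurable_X intro: measurable_compose[OF measurable_mu measurable_ennreal])
  thus ?thesis using mu_nonneg by (auto simp: ennreal_eq_0_iff intro: antisym elim!: eventually_mono)
qed

end

text \<open>The integral is a supremum over simple functions below \<open>f\<close>, and each of
  these vanishes almost everywhere after pull-back, even for non-measurable \<open>f\<close>.
  Applied to the atom of the spectral measure as a function on \<open>tree_space\<close>, this
  avoids the question of its measurability there.\<close>

lemma nn_integral_distr_eq_0:
  assumes T: "T \<in> M \<rightarrow>\<^sub>M N" and f: "AE x in M. f (T x) = 0"
  shows "(\<integral>\<^sup>+y. f y \<partial>distr M N T) = 0"
proof -
  have "integral\<^sup>S (distr M N T) g = 0" if g: "simple_function (distr M N T) g" "g \<le> f" for g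
  proof -
    have gm: "g \<in> borel_measurable N" using borel_measurable_simple_function[OF g(1)] by simp
    have "integral\<^sup>S (distr M N T) g = (\<integral>\<^sup>+y. g y \<partial>distr M N T)"
      by (rule nn_integral_eq_simple_integral[symmetric, OF g(1)])
    also have "\<dots> = (\<integral>\<^sup>+x. g (T x) \<partial>M)" by (rule nn_integral_distr[OF T]) (simp add: gm)
    also have "\<dots> = (\<integral>\<^sup>+x. 0 \<partial>M)"
    proof (rule nn_integral_cong_AE)
      show "AE x in M. g (T x) = 0" using f
      proof eventually_elim
        case (elim x)
        thus ?case using le_funD[OF g(2), of "T x"] by simp
      qed
    qed
    finally show ?thesis by simp
  qed
  thus ?thesis unfolding nn_integral_def by (intro antisym SUP_least) auto
qed

theorem corollary7:
  fixes \<pi> :: "nat pmf"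
  assumes "summable (\<lambda>k. real k * pmf \<pi> k)"
    and "(\<Sum>k. real k * pmf \<pi> k) \<noteq> 0"
    and "finite (set_pmf \<pi>)"
    and "pmf \<pi> 1 = 0"
  shows "finite (pp_support (ugwt \<pi>))"
proof -
  define m where "m = (\<Sum>k. real k * pmf \<pi> k)"
  define q where "q = offspring_hat \<pi>"
  obtain d where d: "set_pmf \<pi> \<subseteq> {..d}"
    using assms(3) finite_nat_iff_bounded_le by blast
  have m: "0 < m"
    using assms(2) suminf_nonneg[OF assms(1)] unfolding m_def by (simp add: less_le)
  have ugw: "ugw_point d \<pi> q m"
    by unfold_locales (use d assms m pmf_offspring_hat[OF assms(1,2)] in \<open>auto simp: m_def q_def\<close>)
  \<comment> \<open>A non-zero mean needs some positive degree, and degree 1 is excluded. A degree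
    of at least 2 supplies the lower bound for the frontier.\<close>
  have "\<exists>k\<ge>2. 0 < pmf \<pi> k"
  proof (rule ccontr)
    assume neg: "\<not> ?thesis"
    have "real k * pmf \<pi> k = 0" for k
    proof -
      consider "k = 0" | "k = 1" | "2 \<le> k" by linarith
      thus ?thesis using assms(4) neg by cases (auto simp: less_le)
    qed
    hence "(\<Sum>k. real k * pmf \<pi> k) = 0" by (simp only: suminf_zero)
    thus False using assms(2) by simp
  qed
  then obtain k where k: "2 \<le> k" "0 < pmf \<pi> k" by auto
  \<comment> \<open>\<open>D\<close> is fixed before any point \<open>l\<close> is considered, so a
    single finite set contains all atoms.\<close>
  obtain D :: nat where D: "16 / (1 - pmf q 1)\<^sup>2 * (real d)\<^sup>2 / pmf \<pi> k \<le> D"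
    using real_arch_simple by blast
  hence "16 / (1 - pmf q 1)\<^sup>2 * (real d)\<^sup>2 \<le> D * pmf \<pi> k" unfolding pos_divide_le_eq[OF k(2)] .
  also have "\<dots> \<le> (real D + 2) * pmf \<pi> k" by (rule mult_right_mono) auto
  finally have D': "16 / (1 - pmf q 1)\<^sup>2 * (real d)\<^sup>2 \<le> (real D + 2) * pmf \<pi> k" .
  have "pp_support (ugwt \<pi>) \<subseteq> degree_bound.block_eigenvalues d D"
  proof
    fix l assume l: "l \<in> pp_support (ugwt \<pi>)"
    interpret ugw_point d l \<pi> q m by (rule ugw)
    show "l \<in> block_eigenvalues D"
    proof (rule ccontr)
      assume "l \<notin> block_eigenvalues D"
      from no_atom[OF this k D'] have "AE c in offspring_law \<pi> q. mu c = 0" .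
      hence "AE c in offspring_law \<pi> q. emeasure (spectral_measure (tree_graph (tree_of_offspring c)) []) {l} = 0"
        using AE_labels(1)
      proof eventually_elim
        case (elim c)
        have "emeasure (spectral_measure (tree_graph (tree_of_offspring c)) []) {l} = ennreal (mass (hseq l c))"
          by (rule spectral_measure_atom) (use elim in auto)
        thus ?case using elim by (simp add: mu_def)
      qed
      hence "mean_spectral_measure (ugwt \<pi>) {l} = 0"
        unfolding mean_spectral_measure_def ugwt_def q_def offspring_law_def
        by (intro nn_integral_distr_eq_0 measurable_tree_of_offspring)
      thus False using l by (simp add: pp_support_def)
    qed
  qed
  thus ?thesis using degree_bound.finite_block_eigenvalues finite_subset by blast
qed

end
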